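(* Let $G$ be a compact connected commutative Lie group (torus) of dimension $n$ with Lie algebra $\mathfrak g$, and let $(\Gamma,\alpha)$ be an abstract GKM one-skeleton. Then there exist a complex manifold $M$ and a GKM action of $G$ on $M$ for which $(\Gamma,\alpha)$ is its GKM one-skeleton.
   Context: Abstract GKM one-skeleton: a finite $d$-valent graph $\Gamma$ with vertex set $V_\Gamma$ and set $E_\Gamma$ of oriented edges (each edge occurs with both orientations; $i(e),t(e)$ are the initial and terminal vertices of $e$, $\bar e$ is $e$ reversed, $E_p=\{e: i(e)=p\}$ has $d$ elements), a connection $\theta$, i.e. bijections $\theta_e:E_{i(e)}\to E_{t(e)}$ with $\theta_{\bar e}=\theta_e^{-1}$, and an axial function $\alpha:E_\Gamma\to\mathfrak g^*$ such that every $\alpha_e$ lies in the weight lattice of $G$ and: for every vertex $p$ the vectors $\alpha_e$, $e\in E_p$, are pairwise linearly independent; $\alpha_{\bar e}=-\alpha_e$ for every $e$; and for every $e\in E_\Gamma$ and $e_i\in E_{i(e)}$, $\alpha_{\theta_e(e_i)}=\alpha_{e_i}+c_{i,e}\alpha_e$ with $c_{i,e}\in\mathbb Z$. GKM action of $G$ on a (not necessarily compact) manifold $M$ of real dimension $2d$: a faithful action such that the fixed point set $M^G$ is finite, $M$ possesses a $G$-invariant almost complex structure, and for every $p\in M^G$ the $d$ weights $\alpha_{i,p}\in\mathfrak g^*$ of the isotropy representation of $G$ on $T_pM$ are pairwise linearly independent. A weight $\beta$ corresponds to the character $\exp\xi\mapsto e^{\sqrt{-1}\beta(\xi)}$. GKM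 one-skeleton of such an action: the graph whose vertices are the points of $M^G$ and whose edges are the $G$-invariant embedded 2-spheres $X$ in $M$, each containing exactly two fixed points and joining them, where for $p\in M^G$ and each weight $\alpha_{i,p}$ the connected component through $p$ of the fixed point set of the identity component of $\ker(\exp\xi\mapsto e^{\sqrt{-1}\alpha_{i,p}(\xi)})$ is such a sphere (these being all of them through $p$); the axial function assigns to each oriented edge $e$, with corresponding sphere $X_e$, the weight of the isotropy representation of $G$ on $T_{i(e)}X_e$. *)

theory Defs
  imports "HOL-Analysis.Analysis"
begin

section \<open>Tori, characters and weights\<close>

text \<open>
  A compact connected commutative Lie group, written additively, together with its Lie algebra
  (a Euclidean space, so the dimension of the group is \<open>DIM('a)\<close>) and its exponential map. For a
  commutative Lie group the exponential map is a homomorphism and a local homeomorphism, and its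
  local inverses are charts for the (unique) Lie group structure; see \<open>log_charts\<close>.
\<close>

locale torus =
  fixes ex :: "'a::euclidean_space \<Rightarrow> 'g::{topological_ab_group_add, t2_space}"
  assumes compact: "compact (UNIV :: 'g set)"
    and connected: "connected (UNIV :: 'g set)"
    and ex_add: "ex (\<xi> + \<eta>) = ex \<xi> + ex \<eta>"
    and ex_local_homeo:
      "\<exists>N l. open N \<and> 0 \<in> N \<and> open (ex ` N) \<and> homeomorphism N (ex ` N) ex l"

definition weight_lattice ::
  "('a::euclidean_space \<Rightarrow> 'g::{topological_ab_group_add, t2_space}) \<Rightarrow> ('a \<Rightarrow>\<^sub>L real) set" where
  "weight_lattice ex = {\<beta>. \<exists>ch :: 'g \<Rightarrow> complex.
     continuous_on UNIV ch \<and> (\<forall>g h. ch (g + h) = ch g * ch h) \<and> (\<forall>\<xi>. ch (ex \<xi>) = cis (blinfun_apply \<beta> \<xi>))}"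

text \<open>The identity component of the kernel of \<open>exp \<xi> \<mapsto> e\<^bsup>i\<beta>(\<xi>)\<^esup>\<close>, for a weight \<open>\<beta>\<close>.\<close>

definition character_kernel0 ::
  "('a::euclidean_space \<Rightarrow> 'g::{topological_ab_group_add, t2_space}) \<Rightarrow> ('a \<Rightarrow>\<^sub>L real) \<Rightarrow> 'g set" where
  "character_kernel0 ex \<beta> = connected_component_set {ex \<xi> | \<xi>. cis (blinfun_apply \<beta> \<xi>) = 1} 0"

text \<open>
  Pairwise linear independence of a family. The case \<open>i = j\<close> says that all members are nonzero,
  which matters only if the family has just one member.
\<close>

definition pairwise_independent :: "'i set \<Rightarrow> ('i \<Rightarrow> 'b::real_vector) \<Rightarrow> bool" where
  "pairwise_independent I w \<longleftrightarrow> (\<forall>i\<in>I. \<forall>j\<in>I. inj_on w {i, j} \<and> independent (w ` {i, j}))"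


section \<open>Abstract GKM one-skeleta\<close>

text \<open>
  \<open>E\<close> is the set of oriented edges; multiple edges are allowed. \<open>\<theta> e\<close> is the connection along \<open>e\<close>.
\<close>

locale abstract_gkm =
  fixes ex :: "'a::euclidean_space \<Rightarrow> 'g::{topological_ab_group_add, t2_space}"
    and d :: nat
    and V :: "'v set"
    and E :: "'e set"
    and ini ter :: "'e \<Rightarrow> 'v"
    and bar :: "'e \<Rightarrow> 'e"
    and \<theta> :: "'e \<Rightarrow> 'e \<Rightarrow> 'e"
    and \<alpha> :: "'e \<Rightarrow> ('a \<Rightarrow>\<^sub>L real)"
  assumes finite_V: "finite V"
    and finite_E: "finite E"
    and ini_in: "e \<in> E \<Longrightarrow> ini e \<in> V"
    and ter_in: "e \<in> E \<Longrightarrow> ter e \<in> V"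
    and bar_in: "e \<in> E \<Longrightarrow> bar e \<in> E"
    and bar_bar: "e \<in> E \<Longrightarrow> bar (bar e) = e"
    and bar_neq: "e \<in> E \<Longrightarrow> bar e \<noteq> e"
    and ini_bar: "e \<in> E \<Longrightarrow> ini (bar e) = ter e"
    and ter_bar: "e \<in> E \<Longrightarrow> ter (bar e) = ini e"
    and valent: "p \<in> V \<Longrightarrow> card {e\<in>E. ini e = p} = d"
    and connection_bij:
      "e \<in> E \<Longrightarrow> bij_betw (\<theta> e) {e'\<in>E. ini e' = ini e} {e'\<in>E. ini e' = ter e}"
    and connection_bar:
      "e \<in> E \<Longrightarrow> e' \<in> E \<Longrightarrow> ini e' = ini e \<Longrightarrow> \<theta> (bar e) (\<theta> e e') = e'"
    and axial_weight: "e \<in> E \<Longrightarrow> \<alpha> e \<in> weight_lattice ex"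
    and axial_independent: "p \<in> V \<Longrightarrow> pairwise_independent {e\<in>E. ini e = p} \<alpha>"
    and axial_bar: "e \<in> E \<Longrightarrow> \<alpha> (bar e) = - \<alpha> e"
    and axial_connection:
      "e \<in> E \<Longrightarrow> e' \<in> E \<Longrightarrow> ini e' = ini e \<Longrightarrow>
         \<exists>c::int. \<alpha> (\<theta> e e') = \<alpha> e' + of_int c *\<^sub>R \<alpha> e"


section \<open>Smooth and holomorphic maps between manifolds\<close>

text \<open>Continuous differentiability of order \<open>k\<close> on an open set, via directional derivatives.\<close>

fun Ck_on :: "nat \<Rightarrow> 'a::real_normed_vector set \<Rightarrow> ('a \<Rightarrow> 'b::real_normed_vector) \<Rightarrow> bool" where
  "Ck_on 0 S f \<longleftrightarrow> continuous_on S f"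
| "Ck_on (Suc k) S f \<longleftrightarrow>
     (\<forall>x\<in>S. f differentiable (at x)) \<and> (\<forall>v. Ck_on k S (\<lambda>x. frechet_derivative f (at x) v))"

definition smooth_on :: "'a::real_normed_vector set \<Rightarrow> ('a \<Rightarrow> 'b::real_normed_vector) \<Rightarrow> bool" where
  "smooth_on S f \<longleftrightarrow> (\<forall>k. Ck_on k S f)"

text \<open>Holomorphy on an open set: differentiability with complex linear derivative.\<close>

definition holo_on :: "(complex^'d) set \<Rightarrow> (complex^'d \<Rightarrow> complex^'d) \<Rightarrow> bool" where
  "holo_on S f \<longleftrightarrow>
     (\<forall>x\<in>S. \<exists>D. (f has_derivative D) (at x) \<and> (\<forall>c v. D (c *s v) = c *s D v))"

type_synonym ('m, 'b) charts = "('m set \<times> ('m \<Rightarrow> 'b)) set"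

definition in_charts ::
  "('b set \<Rightarrow> ('b \<Rightarrow> 'c) \<Rightarrow> bool) \<Rightarrow> ('m, 'b) charts \<Rightarrow> ('n, 'c) charts \<Rightarrow> ('m \<Rightarrow> 'n) \<Rightarrow> bool" where
  "in_charts P A B f \<longleftrightarrow>
     (\<forall>(U, \<phi>) \<in> A. \<forall>(W, \<psi>) \<in> B. P (\<phi> ` (U \<inter> f -` W)) (\<lambda>y. \<psi> (f (inv_into U \<phi> y))))"

definition smooth_map ::
  "'m topology \<Rightarrow> ('m, 'b::real_normed_vector) charts \<Rightarrow>
   'n topology \<Rightarrow> ('n, 'c::real_normed_vector) charts \<Rightarrow> ('m \<Rightarrow> 'n) \<Rightarrow> bool" where
  "smooth_map X A Y B f \<longleftrightarrow> continuous_map X Y f \<and> in_charts smooth_on A B f"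

definition complex_manifold :: "'m topology \<Rightarrow> ('m, complex^'d) charts \<Rightarrow> bool" where
  "complex_manifold T A \<longleftrightarrow>
     Hausdorff_space T \<and> second_countable T \<and>
     (\<Union>(U, \<phi>) \<in> A. U) = topspace T \<and>
     (\<forall>(U, \<phi>) \<in> A. openin T U \<and> open (\<phi> ` U) \<and>
        homeomorphic_map (subtopology T U) (top_of_set (\<phi> ` U)) \<phi>) \<and>
     in_charts holo_on A A (\<lambda>x. x)"

text \<open>
  A second countable Hausdorff manifold has at most continuum many points, so every complex
  manifold of dimension \<open>CARD('d)\<close> is isomorphic to one whose points are of the following type;
  sets are used so that points may be equivalence classes.
\<close>

type_synonym 'd point = "(nat \<times> (complex^'d)) set"

definition prod_charts :: "('m, 'b) charts \<Rightarrow> ('n, 'c) charts \<Rightarrow> ('m \<times> 'n, 'b \<times> 'c) charts" where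
  "prod_charts A B = {(U \<times> W, \<lambda>(x, y). (\<phi> x, \<psi> y)) | U \<phi> W \<psi>. (U, \<phi>) \<in> A \<and> (W, \<psi>) \<in> B}"

definition log_charts ::
  "('a::euclidean_space \<Rightarrow> 'g::{topological_ab_group_add, t2_space}) \<Rightarrow> ('g, 'a) charts" where
  "log_charts ex = {(ex ` N, inv_into N ex) | N. open N \<and> inj_on ex N}"

text \<open>
  Smoothly embedded 2-spheres. A smooth map on the unit sphere is given by its extension to
  \<open>\<real>\<^sup>3 - {0}\<close> that is constant along rays; it is an immersion iff the kernel of the derivative of the
  extension is just the radial direction. An injective immersion of a compact manifold is an
  embedding.
\<close>

definition embedded_sphere ::
  "'m topology \<Rightarrow> ('m, complex^'d) charts \<Rightarrow> 'm set \<Rightarrow> bool" where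
  "embedded_sphere T A X \<longleftrightarrow> (\<exists>f :: real^3 \<Rightarrow> 'm.
     smooth_map (top_of_set (- {0})) {(- {0}, \<lambda>x. x)} T A f \<and>
     (\<forall>x r. x \<noteq> 0 \<longrightarrow> r > 0 \<longrightarrow> f (r *\<^sub>R x) = f x) \<and>
     inj_on f (sphere 0 1) \<and>
     (\<forall>x \<in> sphere 0 1. \<forall>(U, \<phi>) \<in> A. f x \<in> U \<longrightarrow>
        (\<forall>v. frechet_derivative (\<lambda>y. \<phi> (f y)) (at x) v = 0 \<longrightarrow> v \<in> span {x})) \<and>
     X = f ` sphere 0 1)"


section \<open>GKM actions\<close>

definition fixed_points :: "'m topology \<Rightarrow> ('g \<Rightarrow> 'm \<Rightarrow> 'm) \<Rightarrow> 'g set \<Rightarrow> 'm set" where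
  "fixed_points T act K = {x \<in> topspace T. \<forall>g\<in>K. act g x = x}"

text \<open>
  The isotropy representation at a fixed point \<open>p\<close>, on the tangent space at \<open>p\<close> as seen in the
  chart \<open>(U, \<phi>)\<close>.
\<close>

definition isotropy ::
  "('g \<Rightarrow> 'm \<Rightarrow> 'm) \<Rightarrow> 'm set \<Rightarrow> ('m \<Rightarrow> complex^'d) \<Rightarrow> 'm \<Rightarrow> 'g \<Rightarrow> complex^'d \<Rightarrow> complex^'d" where
  "isotropy act U \<phi> p g = frechet_derivative (\<lambda>y. \<phi> (act g (inv_into U \<phi> y))) (at (\<phi> p))"

text \<open>
  \<open>w\<close> is the family of the \<open>d\<close> weights, with multiplicity, of the isotropy representation at \<open>p\<close>:
  it is diagonal with these weights in a complex basis \<open>b\<close> of the tangent space.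
\<close>

definition isotropy_weights ::
  "('a::euclidean_space \<Rightarrow> 'g) \<Rightarrow> ('m, complex^'d) charts \<Rightarrow> ('g \<Rightarrow> 'm \<Rightarrow> 'm) \<Rightarrow> 'm \<Rightarrow>
   ('d \<Rightarrow> ('a \<Rightarrow>\<^sub>L real)) \<Rightarrow> bool" where
  "isotropy_weights ex A act p w \<longleftrightarrow> (\<forall>(U, \<phi>) \<in> A. p \<in> U \<longrightarrow>
     (\<exists>b :: 'd \<Rightarrow> complex^'d. inj b \<and> vec.independent (range b) \<and>
        (\<forall>i \<xi>. isotropy act U \<phi> p (ex \<xi>) (b i) = cis (blinfun_apply (w i) \<xi>) *s b i)))"

text \<open>
  The action is by holomorphic maps, i.e. the almost complex structure of the complex manifold is
  invariant, and isotropy weights are taken with respect to that structure.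
\<close>

definition gkm_action ::
  "('a::euclidean_space \<Rightarrow> 'g::{topological_ab_group_add, t2_space}) \<Rightarrow>
   'm topology \<Rightarrow> ('m, complex^'d) charts \<Rightarrow> ('g \<Rightarrow> 'm \<Rightarrow> 'm) \<Rightarrow> bool" where
  "gkm_action ex T A act \<longleftrightarrow>
     (\<forall>x \<in> topspace T. act 0 x = x) \<and>
     (\<forall>g h. \<forall>x \<in> topspace T. act (g + h) x = act g (act h x)) \<and>
     smooth_map (prod_topology euclidean T) (prod_charts (log_charts ex) A) T A (\<lambda>(g, x). act g x) \<and>
     (\<forall>g. in_charts holo_on A A (act g)) \<and>
     (\<forall>g. (\<forall>x \<in> topspace T. act g x = x) \<longrightarrow> g = 0) \<and>
     finite (fixed_points T act UNIV) \<and>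
     (\<forall>p \<in> fixed_points T act UNIV. \<exists>w. isotropy_weights ex A act p w \<and> pairwise_independent UNIV w)"


section \<open>The GKM one-skeleton of an action\<close>

definition gkm_spheres ::
  "'m topology \<Rightarrow> ('m, complex^'d) charts \<Rightarrow> ('g \<Rightarrow> 'm \<Rightarrow> 'm) \<Rightarrow> 'm set set" where
  "gkm_spheres T A act = {X. embedded_sphere T A X \<and> (\<forall>g. act g ` X = X) \<and>
     card (X \<inter> fixed_points T act UNIV) = 2}"

text \<open>
  The component through \<open>p\<close> of the fixed point set of the identity component of the kernel of the
  character with weight \<open>\<beta>\<close>.
\<close>

definition weight_component ::
  "('a::euclidean_space \<Rightarrow> 'g::{topological_ab_group_add, t2_space}) \<Rightarrow>
   'm topology \<Rightarrow> ('g \<Rightarrow> 'm \<Rightarrow> 'm) \<Rightarrow> 'm \<Rightarrow> ('a \<Rightarrow>\<^sub>L real) \<Rightarrow> 'm set" where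
  "weight_component ex T act p \<beta> =
     connected_component_of_set (subtopology T (fixed_points T act (character_kernel0 ex \<beta>))) p"

text \<open>The tangent space of \<open>X\<close> at \<open>p\<close> in the chart \<open>(U, \<phi>)\<close>: velocities of curves in \<open>X\<close>.\<close>

definition tangent_in_chart :: "'m set \<Rightarrow> ('m \<Rightarrow> complex^'d) \<Rightarrow> 'm set \<Rightarrow> 'm \<Rightarrow> (complex^'d) set" where
  "tangent_in_chart U \<phi> X p = {v. \<exists>c :: real \<Rightarrow> 'm. c 0 = p \<and> range c \<subseteq> X \<inter> U \<and>
     ((\<lambda>t. \<phi> (c t)) has_vector_derivative v) (at 0)}"

definition tangent_weight ::
  "('a::euclidean_space \<Rightarrow> 'g) \<Rightarrow> ('m, complex^'d) charts \<Rightarrow> ('g \<Rightarrow> 'm \<Rightarrow> 'm) \<Rightarrow>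
   'm set \<Rightarrow> 'm \<Rightarrow> ('a \<Rightarrow>\<^sub>L real) \<Rightarrow> bool" where
  "tangent_weight ex A act X p \<beta> \<longleftrightarrow> (\<forall>(U, \<phi>) \<in> A. p \<in> U \<longrightarrow>
     (\<forall>v \<in> tangent_in_chart U \<phi> X p.
        \<i> *s v \<in> tangent_in_chart U \<phi> X p \<and>
        (\<forall>\<xi>. isotropy act U \<phi> p (ex \<xi>) v = cis (blinfun_apply \<beta> \<xi>) *s v)))"

text \<open>
  Any two families \<open>w\<close> of isotropy weights at \<open>p\<close> agree up to order. An oriented edge of the
  one-skeleton of the action is a pair \<open>(p, X)\<close> of a sphere \<open>X\<close> and its initial point \<open>p\<close>; \<open>F\<close> and
  \<open>\<lambda>e. (F (ini e), S e)\<close> constitute an isomorphism of the given graph onto that one-skeleton.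
\<close>

definition is_gkm_one_skeleton ::
  "('a::euclidean_space \<Rightarrow> 'g::{topological_ab_group_add, t2_space}) \<Rightarrow>
   'm topology \<Rightarrow> ('m, complex^'d) charts \<Rightarrow> ('g \<Rightarrow> 'm \<Rightarrow> 'm) \<Rightarrow>
   'v set \<Rightarrow> 'e set \<Rightarrow> ('e \<Rightarrow> 'v) \<Rightarrow> ('e \<Rightarrow> 'v) \<Rightarrow> ('e \<Rightarrow> 'e) \<Rightarrow> ('e \<Rightarrow> ('a \<Rightarrow>\<^sub>L real)) \<Rightarrow> bool" where
  "is_gkm_one_skeleton ex T A act V E ini ter bar \<alpha> \<longleftrightarrow>
     (\<forall>p \<in> fixed_points T act UNIV. \<forall>w. isotropy_weights ex A act p w \<longrightarrow>
        {X \<in> gkm_spheres T A act. p \<in> X} = range (\<lambda>i. weight_component ex T act p (w i))) \<and>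
     (\<exists>F S. bij_betw F V (fixed_points T act UNIV) \<and>
        bij_betw (\<lambda>e. (F (ini e), S e)) E
          {(p, X). X \<in> gkm_spheres T A act \<and> p \<in> X \<inter> fixed_points T act UNIV} \<and>
        (\<forall>e \<in> E. S (bar e) = S e \<and>
           S e \<inter> fixed_points T act UNIV = {F (ini e), F (ter e)} \<and>
           tangent_weight ex A act (S e) (F (ini e)) (\<alpha> e)))"

end

theory Submission
  imports Defs
begin

text \<open>
  Every vertex contributes a star-shaped neighbourhood of the axes in \<open>\<complex>\<^sup>d\<close>, on which the torus acts
  diagonally with the weights of the edges at that vertex. For every edge, the two neighbourhoods
  are glued along a collar of the corresponding axes by \<open>z\<^sub>e \<mapsto> 1/z\<^sub>e\<close>, \<open>z\<^sub>j \<mapsto> z\<^sub>e\<^sup>c z\<^sub>j\<close>, where \<open>c\<close> is the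
  integer in the compatibility condition of the connection; this is equivariant. Collars of
  different edges are disjoint, so that no cocycle condition arises, and the graph of each gluing map
  is closed, so that the quotient is Hausdorff. Near the image of the one-skeleton the manifold is a
  union of equivariant rank \<open>d - 1\<close> bundles over projective lines.

  The weights of the graph need not span the weight lattice. Faithfulness is achieved by adding
  finitely many components without fixed points, on which the torus acts through characters that
  separate its points.

  An invariant sphere with a fixed point has no orbit of dimension two: by invariance of domain such
  an orbit would be open, hence the whole sphere. By pairwise independence of the weights, it
  therefore consists of points with at most one nonzero coordinate, and connectedness confines it to
  a single projective line, which it then exhausts.
\<close>

section \<open>Calculus of smooth and holomorphic maps\<close>

text \<open>The monomial gluing maps are dictated by the weights. Where \<open>z_i\<close> has
  weight \<open>w_i\<close>, its inverse has weight \<open>- w_i\<close>, the weight of the reversed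
  edge, and \<open>z_i^c z_j\<close> has weight \<open>w_j + c w_i\<close>, which is the rule by
  which the axial function changes along the edge. Integrality of \<open>c\<close> makes the
  monomial single valued on the collar. Since the manifold may be noncompact, nothing has to be
  filled in away from the axes, and no condition on two-dimensional faces of the graph enters. An
  axis carries radius 2 and the transversal coordinates radius 1/2: inversion preserves the annulus
  between 1/2 and 2, and a coordinate of modulus at least 1/2 identifies the axis near which a point
  lies. The obstacle is that every invariant embedded sphere with two fixed points counts as an
  edge, whether or not it is holomorphic. Ruling out further spheres uses of the embedding only that
  it is continuous and injective, so the argument is topological: connectedness, compactness and
  invariance of domain.\<close>

lemma has_derivative_frechet: "(f has_derivative D) (at x) \<Longrightarrow> frechet_derivative f (at x) = D"
  using frechet_derivative_at by metis

text \<open>\<open>Ck_on\<close> iterates \<open>frechet_derivative\<close>, which does not see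
  changes off an open neighbourhood. Coordinate expressions agree with explicit formulas only on
  such sets, so smoothness has to be transferred between them.\<close>

lemma Ck_on_cong:
  assumes "open S" "\<And>x. x \<in> S \<Longrightarrow> f x = g x" "Ck_on k S (f::'a::real_normed_vector \<Rightarrow> 'b::real_normed_vector)"
  shows "Ck_on k S g"
  using assms(2,3)
proof (induction k arbitrary: f g)
  case 0
  then show ?case by (simp cong: continuous_on_cong)
next
  case (Suc k)
  have D: "(g has_derivative frechet_derivative f (at x)) (at x)" if "x \<in> S" for x
    using Suc.prems that has_derivative_transform_within_open[OF _ assms(1) that, of f _ UNIV g]
    by (auto simp: frechet_derivative_works)
  show ?case
    unfolding Ck_on.simps
  proof (intro conjI ballI allI)
    fix x assume "x \<in> S" then show "g differentiable at x" using D differentiableI by blast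
  next
    fix v
    show "Ck_on k S (\<lambda>x. frechet_derivative g (at x) v)"
      by (rule Suc.IH[of "\<lambda>x. frechet_derivative f (at x) v"])
         (use Suc.prems(2) D has_derivative_frechet in fastforce)+
  qed
qed

text \<open>Lets the derivative be exhibited by a formula in place of
  \<open>frechet_derivative\<close>; the closure rules below are mostly inductions through this
  rule.\<close>

lemma Ck_on_Suc:
  assumes "open S" "\<And>x. x \<in> S \<Longrightarrow> (f has_derivative f' x) (at x)" "\<And>v. Ck_on k S (\<lambda>x. f' x v)"
  shows "Ck_on (Suc k) S f"
  unfolding Ck_on.simps
proof (intro conjI ballI allI)
  fix x assume "x \<in> S" then show "f differentiable at x" using assms(2) differentiableI by blast
next
  fix v
  show "Ck_on k S (\<lambda>x. frechet_derivative f (at x) v)"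
    by (rule Ck_on_cong[OF assms(1) _ assms(3)[of v]]) (use assms(2) has_derivative_frechet in fastforce)
qed

lemma Ck_on_SucD:
  assumes "Ck_on (Suc k) S f" shows "Ck_on k S f"
  using assms
proof (induction k arbitrary: f)
  case 0
  then have "continuous (at x) f" if "x \<in> S" for x
    using that differentiable_imp_continuous_within by auto
  then show ?case by (simp add: continuous_at_imp_continuous_on)
next
  case (Suc k)
  have "\<And>v. Ck_on (Suc k) S (\<lambda>x. frechet_derivative f (at x) v)" using Suc.prems by simp
  then have "\<And>v. Ck_on k S (\<lambda>x. frechet_derivative f (at x) v)" by (rule Suc.IH)
  then show ?case using Suc.prems by simp
qed

lemma Ck_on_derivative:
  "Ck_on (Suc k) S f \<Longrightarrow> x \<in> S \<Longrightarrow> (f has_derivative frechet_derivative f (at x)) (at x)"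
  by (simp add: frechet_derivative_works)

lemma Ck_on_const: "open S \<Longrightarrow> Ck_on k S (\<lambda>x. c)"
  by (induction k arbitrary: c) (auto intro!: Ck_on_Suc[where f'="\<lambda>_ _. 0"] derivative_eq_intros simp del: Ck_on.simps(2))

lemma Ck_on_bounded_linear:
  assumes "open S" "bounded_linear f" shows "Ck_on k S f"
proof (cases k)
  case 0 then show ?thesis by (simp add: assms linear_continuous_on)
next
  case (Suc n)
  then show ?thesis unfolding Suc
    by (intro Ck_on_Suc[where f'="\<lambda>x. f"] Ck_on_const) (use assms bounded_linear_imp_has_derivative in auto)
qed

lemma Ck_on_add:
  assumes "open S" shows "Ck_on k S f \<Longrightarrow> Ck_on k S g \<Longrightarrow> Ck_on k S (\<lambda>x. f x + g x)"
proof (induction k arbitrary: f g)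
  case 0 then show ?case by (simp add: continuous_on_add)
next
  case (Suc k)
  show ?case
    by (rule Ck_on_Suc[OF assms has_derivative_add[OF Ck_on_derivative Ck_on_derivative]])
       (use Suc in auto)
qed

lemma Ck_on_sum:
  assumes "open S" "finite I" shows "(\<And>i. i \<in> I \<Longrightarrow> Ck_on k S (f i)) \<Longrightarrow> Ck_on k S (\<lambda>x. \<Sum>i\<in>I. f i x)"
  using assms(2) by (induction I) (auto intro: Ck_on_const Ck_on_add assms)

lemma Ck_on_linear_compose:
  assumes "open S" "bounded_linear L" shows "Ck_on k S f \<Longrightarrow> Ck_on k S (\<lambda>x. L (f x))"
proof (induction k arbitrary: f)
  case 0 then show ?case using assms bounded_linear.continuous_on by auto
next
  case (Suc k)
  show ?case
    by (rule Ck_on_Suc[OF assms(1) bounded_linear.has_derivative[OF assms(2) Ck_on_derivative]])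
       (use Suc in auto)
qed

lemma Ck_on_mult:
  fixes f g :: "'a::real_normed_vector \<Rightarrow> 'b::real_normed_algebra"
  assumes "open S" shows "Ck_on k S f \<Longrightarrow> Ck_on k S g \<Longrightarrow> Ck_on k S (\<lambda>x. f x * g x)"
proof (induction k arbitrary: f g)
  case 0 then show ?case by (simp add: continuous_on_mult)
next
  case (Suc k)
  show ?case
    by (rule Ck_on_Suc[OF assms has_derivative_mult[OF Ck_on_derivative Ck_on_derivative]])
       (use Suc.prems Ck_on_SucD[OF Suc.prems(1)] Ck_on_SucD[OF Suc.prems(2)]
         in \<open>auto intro!: Ck_on_add Suc.IH assms\<close>)
qed

text \<open>The derivative is a product of two factors \<open>inverse f\<close> and the derivative
  of \<open>f\<close>, so order \<open>k\<close> for \<open>inverse f\<close> itself gives order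
  \<open>Suc k\<close>. The functions in \<open>Ck_on_cis\<close> and \<open>Ck_on_norm\<close>
  bootstrap in the same way.\<close>

lemma Ck_on_inverse:
  fixes f :: "'a::real_normed_vector \<Rightarrow> 'b::real_normed_field"
  assumes "open S" "\<And>x. x \<in> S \<Longrightarrow> f x \<noteq> 0"
  shows "Ck_on k S f \<Longrightarrow> Ck_on k S (\<lambda>x. inverse (f x))"
proof (induction k)
  case 0 then show ?case using assms by (simp add: continuous_on_inverse)
next
  case (Suc k)
  note IH = Suc.IH[OF Ck_on_SucD[OF Suc.prems]]
  show ?case
  proof (rule Ck_on_Suc[OF assms(1)])
    fix x assume "x \<in> S"
    then show "((\<lambda>x. inverse (f x)) has_derivative
        (\<lambda>v. - (inverse (f x) * frechet_derivative f (at x) v * inverse (f x)))) (at x)"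
      by (intro Deriv.has_derivative_inverse assms Ck_on_derivative[OF Suc.prems])
  next
    fix v
    show "Ck_on k S (\<lambda>x. - (inverse (f x) * frechet_derivative f (at x) v * inverse (f x)))"
      using Suc.prems
      by (intro Ck_on_mult IH assms Ck_on_linear_compose[OF _ bounded_linear_minus[OF bounded_linear_ident]]) auto
  qed
qed

lemma Ck_on_power_int:
  fixes f :: "'a::real_normed_vector \<Rightarrow> 'b::real_normed_field"
  assumes "open S" "\<And>x. x \<in> S \<Longrightarrow> f x \<noteq> 0" "Ck_on k S f"
  shows "Ck_on k S (\<lambda>x. f x powi n)"
proof -
  have P: "Ck_on k S (\<lambda>x. g x ^ m)" if "Ck_on k S g" for m and g :: "'a \<Rightarrow> 'b"
    by (induction m) (auto intro: Ck_on_const Ck_on_mult assms that)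
  show ?thesis unfolding power_int_def
    by (cases "n \<ge> 0") (auto intro!: P Ck_on_inverse assms)
qed

lemma Ck_on_cis:
  fixes \<beta> :: "'a::real_normed_vector \<Rightarrow> real"
  assumes "open S" "bounded_linear \<beta>"
  shows "Ck_on k S (\<lambda>x. cis (\<beta> x))"
proof (induction k)
  case 0 then show ?case
    by (simp add: cis_conv_exp) (intro continuous_intros linear_continuous_on assms)
next
  case (Suc k)
  have D: "((\<lambda>x. cis (\<beta> x)) has_derivative (\<lambda>v. \<i> * of_real (\<beta> v) * cis (\<beta> x))) (at x)" for x
  proof -
    have "((\<lambda>x. \<i> * of_real (\<beta> x)) has_derivative (\<lambda>v. \<i> * of_real (\<beta> v))) (at x)"
      by (rule has_derivative_mult_right, rule bounded_linear.has_derivative[OF bounded_linear_of_real],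
          rule bounded_linear_imp_has_derivative[OF assms(2)])
    from has_derivative_compose[OF this DERIV_exp[THEN has_field_derivative_imp_has_derivative]] show ?thesis
      by (simp add: cis_conv_exp mult_ac)
  qed
  show ?case
    by (rule Ck_on_Suc[OF assms(1) D]) (use Suc in \<open>intro Ck_on_mult Ck_on_const assms\<close>)
qed

text \<open>The norm is cast to the complex numbers because it enters the denominator of a complex
  coordinate on the sphere.\<close>

lemma Ck_on_norm:
  fixes S :: "'a::euclidean_space set"
  assumes "open S" "0 \<notin> S"
  shows "Ck_on k S (\<lambda>x. complex_of_real (norm x))"
proof (induction k)
  case 0 then show ?case using assms by (auto intro!: continuous_intros)
next
  case (Suc k)
  have D: "((\<lambda>x. complex_of_real (norm x)) has_derivative
      (\<lambda>v. of_real (x \<bullet> v) * inverse (of_real (norm x)))) (at x)" if "x \<in> S" for x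
  proof -
    have "x \<noteq> 0" using that assms by auto
    then have "(norm has_derivative (\<lambda>v. v \<bullet> sgn x)) (at x)" by (rule has_derivative_norm)
    then show ?thesis
      by (rule has_derivative_eq_rhs[OF bounded_linear.has_derivative[OF bounded_linear_of_real]])
         (simp add: sgn_div_norm inner_commute divide_inverse fun_eq_iff)
  qed
  show ?case
  proof (rule Ck_on_Suc[OF assms(1) D])
    fix v
    have "Ck_on k S (\<lambda>x. complex_of_real (x \<bullet> v))"
      by (intro Ck_on_bounded_linear bounded_linear_compose[OF bounded_linear_of_real] bounded_linear_inner_left assms)
    then show "Ck_on k S (\<lambda>x. complex_of_real (x \<bullet> v) * inverse (complex_of_real (norm x)))"
      using assms Suc by (intro Ck_on_mult Ck_on_inverse) auto
  qed
qed

lemma Ck_on_Union: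
  assumes "\<And>S. S \<in> \<U> \<Longrightarrow> open S" "\<And>S. S \<in> \<U> \<Longrightarrow> Ck_on k S f"
  shows "Ck_on k (\<Union>\<U>) f"
  using assms(2)
proof (induction k arbitrary: f)
  case 0
  have "continuous_on (\<Union>\<U>) f"
  proof (rule continuous_on_open_Union)
    show "open S" if "S \<in> \<U>" for S using assms(1) that .
    show "continuous_on S f" if "S \<in> \<U>" for S using 0 that by simp
  qed
  then show ?case by simp
next
  case (Suc k)
  have "Ck_on k (\<Union>\<U>) (\<lambda>x. frechet_derivative f (at x) v)" for v
    by (rule Suc.IH) (use Suc.prems in simp)
  moreover have "f differentiable at x" if "x \<in> \<Union>\<U>" for x
    using that Suc.prems by fastforce
  ultimately show ?case by simp
qed

text \<open>A coordinate expression agrees with different formulas near different points; an open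
  cover reduces its smoothness to that of the formulas.\<close>

lemma smooth_on_local:
  assumes "\<And>x. x \<in> S \<Longrightarrow> \<exists>N g. open N \<and> x \<in> N \<and> N \<subseteq> S \<and> (\<forall>y\<in>N. f y = g y) \<and> smooth_on N g"
  shows "smooth_on S f"
  unfolding smooth_on_def
proof
  fix k
  let ?U = "{N. open N \<and> N \<subseteq> S \<and> Ck_on k N f}"
  have "\<Union>?U = S"
  proof (intro equalityI subsetI)
    fix x assume "x \<in> S"
    from assms[OF this] obtain N g where "open N" "x \<in> N" "N \<subseteq> S" "\<forall>y\<in>N. f y = g y" "smooth_on N g" by blast
    then have "Ck_on k N f" using Ck_on_cong[of N g f k] unfolding smooth_on_def by auto
    with \<open>open N\<close> \<open>N \<subseteq> S\<close> \<open>x \<in> N\<close> show "x \<in> \<Union>?U" by blast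
  qed auto
  moreover have "Ck_on k (\<Union>?U) f" by (rule Ck_on_Union) auto
  ultimately show "Ck_on k S f" by simp
qed

lemma bounded_linear_axis: "bounded_linear (\<lambda>x::complex. axis i x :: complex^'n)"
proof -
  have "linear (\<lambda>x::complex. axis i x :: complex^'n)"
    by (rule linearI) (auto simp: axis_def vec_eq_iff)
  then show ?thesis by (simp add: linear_conv_bounded_linear)
qed

lemma smooth_on_vec:
  fixes f :: "'a::real_normed_vector \<Rightarrow> complex^'n"
  assumes "open S" "\<And>i. smooth_on S (\<lambda>x. f x $ i)"
  shows "smooth_on S f"
proof -
  have *: "f = (\<lambda>x. \<Sum>i\<in>UNIV. axis i (f x $ i))"
    by (auto simp: fun_eq_iff vec_eq_iff axis_def)
  show ?thesis unfolding smooth_on_def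
    by (subst *) (use assms in \<open>auto simp: smooth_on_def intro!: Ck_on_sum Ck_on_linear_compose[OF _ bounded_linear_axis]\<close>)
qed

section \<open>Holomorphic functions of several variables\<close>

definition holo_at :: "(complex^'d \<Rightarrow> complex) \<Rightarrow> complex^'d \<Rightarrow> bool" where
  "holo_at f x \<longleftrightarrow> (\<exists>D. (f has_derivative D) (at x) \<and> (\<forall>c v. D (c *s v) = c * D v))"

lemma holo_at_mult: "holo_at f x \<Longrightarrow> holo_at g x \<Longrightarrow> holo_at (\<lambda>x. f x * g x) x"
  unfolding holo_at_def
proof (elim exE conjE)
  fix D D'
  assume *: "(f has_derivative D) (at x)" "\<forall>c v. D (c *s v) = c * D v"
    "(g has_derivative D') (at x)" "\<forall>c v. D' (c *s v) = c * D' v"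
  show "\<exists>D. ((\<lambda>x. f x * g x) has_derivative D) (at x) \<and> (\<forall>c v. D (c *s v) = c * D v)"
    by (rule exI, rule conjI[OF has_derivative_mult[OF *(1,3)]]) (use * in \<open>simp add: algebra_simps\<close>)
qed

lemma holo_at_const: "holo_at (\<lambda>x. c) x"
  unfolding holo_at_def by (rule exI[of _ "\<lambda>_. 0"]) auto

lemma holo_at_nth: "holo_at (\<lambda>x. x $ i) x"
  unfolding holo_at_def
  by (rule exI[of _ "\<lambda>v. v $ i"]) (auto intro: bounded_linear_imp_has_derivative bounded_linear_vec_nth)

lemma holo_at_power_int: "x $ i \<noteq> 0 \<Longrightarrow> holo_at (\<lambda>x. (x $ i) powi n) x"
proof -
  assume "x $ i \<noteq> 0"
  from has_derivative_power_int[OF this bounded_linear_imp_has_derivative[OF bounded_linear_vec_nth]]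
  show ?thesis unfolding holo_at_def
    by (intro exI conjI, assumption) (auto simp: algebra_simps)
qed

lemma holo_on_componentwise:
  fixes f :: "complex^'d \<Rightarrow> complex^'d"
  assumes "\<And>x i. x \<in> S \<Longrightarrow> holo_at (\<lambda>y. f y $ i) x"
  shows "holo_on S f"
  unfolding holo_on_def
proof
  fix x assume "x \<in> S"
  then have "\<exists>D. \<forall>i. ((\<lambda>y. f y $ i) has_derivative D i) (at x) \<and> (\<forall>c v. D i (c *s v) = c * D i v)"
    using assms unfolding holo_at_def by (intro choice) blast
  then obtain D where D: "\<And>i. ((\<lambda>y. f y $ i) has_derivative D i) (at x)" "\<And>i c v. D i (c *s v) = c * D i v" by blast
  have *: "f = (\<lambda>x. \<Sum>i\<in>UNIV. axis i (f x $ i))"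
    by (auto simp: fun_eq_iff vec_eq_iff axis_def)
  have "(f has_derivative (\<lambda>v. \<Sum>i\<in>UNIV. axis i (D i v))) (at x)"
    by (subst *) (intro has_derivative_sum bounded_linear.has_derivative[OF bounded_linear_axis] D)
  moreover have "(\<Sum>i\<in>UNIV. axis i (D i (c *s v))) = c *s (\<Sum>i\<in>UNIV. axis i (D i v))" for c v
    by (auto simp: vec_eq_iff axis_def D if_distrib cong: if_cong)
  ultimately show "\<exists>D. (f has_derivative D) (at x) \<and> (\<forall>c v. D (c *s v) = c *s D v)" by blast
qed

lemma holo_on_local:
  assumes "\<And>x. x \<in> S \<Longrightarrow> \<exists>N g. open N \<and> x \<in> N \<and> (\<forall>y\<in>N. f y = g y) \<and> holo_on N g"
  shows "holo_on S f"
  unfolding holo_on_def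
proof
  fix x assume "x \<in> S"
  from assms[OF this] obtain N g where N: "open N" "x \<in> N" "\<forall>y\<in>N. f y = g y" "holo_on N g" by blast
  then obtain D where "(g has_derivative D) (at x)" "\<forall>c v. D (c *s v) = c *s D v" unfolding holo_on_def by blast
  with N show "\<exists>D. (f has_derivative D) (at x) \<and> (\<forall>c v. D (c *s v) = c *s D v)"
    using has_derivative_transform_within_open[of g D x UNIV N f] by auto
qed

section \<open>Gluing open subsets of complex coordinate space\<close>

text \<open>The identifications form one relation between the pieces rather than a family of
  transition maps. \<open>R_inj\<close> keeps each piece embedded, \<open>R_open\<close> makes the
  quotient map open, and \<open>R_sep\<close> says that the relation is closed, which for an open
  quotient map is the Hausdorff property.\<close>

locale gluing =
  fixes I :: "nat set"
    and Dom :: "nat \<Rightarrow> (complex^'d) set"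
    and R :: "nat \<Rightarrow> complex^'d \<Rightarrow> nat \<Rightarrow> complex^'d \<Rightarrow> bool"
  assumes open_Dom: "open (Dom k)"
    and R_dom: "R k z l u \<Longrightarrow> k \<in> I \<and> l \<in> I \<and> z \<in> Dom k \<and> u \<in> Dom l"
    and R_refl: "k \<in> I \<Longrightarrow> z \<in> Dom k \<Longrightarrow> R k z k z"
    and R_sym: "R k z l u \<Longrightarrow> R l u k z"
    and R_trans: "R k z l u \<Longrightarrow> R l u j v \<Longrightarrow> R k z j v"
    and R_inj: "R k z k u \<Longrightarrow> z = u"
    and R_open: "open W \<Longrightarrow> open {z. \<exists>u\<in>W. R k z l u}"
    and R_sep: "k \<in> I \<Longrightarrow> l \<in> I \<Longrightarrow> z \<in> Dom k \<Longrightarrow> u \<in> Dom l \<Longrightarrow> \<not> R k z l u \<Longrightarrow>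
      \<exists>A B. open A \<and> open B \<and> z \<in> A \<and> u \<in> B \<and> (\<forall>z'\<in>A. \<forall>u'\<in>B. \<not> R k z' l u')"
begin

definition c :: "nat \<Rightarrow> complex^'d \<Rightarrow> 'd point" where
  "c k z = {(l, u). R k z l u}"

definition carrier :: "'d point set" where
  "carrier = (\<Union>k\<in>I. c k ` Dom k)"

text \<open>This is the quotient topology of the disjoint union of the pieces.\<close>

definition T :: "'d point topology" where
  "T = topology (\<lambda>W. W \<subseteq> carrier \<and> (\<forall>k\<in>I. open {z \<in> Dom k. c k z \<in> W}))"

definition U :: "nat \<Rightarrow> 'd point set" where
  "U k = c k ` Dom k"

definition \<phi> :: "nat \<Rightarrow> 'd point \<Rightarrow> complex^'d" where
  "\<phi> k = inv_into (Dom k) (c k)"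

definition A :: "('d point, complex^'d) charts" where
  "A = (\<lambda>k. (U k, \<phi> k)) ` I"

lemma c_eq_iff:
  assumes "k \<in> I" "z \<in> Dom k"
  shows "c k z = c l u \<longleftrightarrow> R k z l u"
proof
  assume "c k z = c l u"
  moreover have "(k, z) \<in> c k z" using R_refl assms by (simp add: c_def)
  ultimately show "R k z l u" using R_sym by (auto simp: c_def)
next
  assume "R k z l u" then show "c k z = c l u"
    unfolding c_def using R_sym R_trans by blast
qed

lemma inj_on_c: "k \<in> I \<Longrightarrow> inj_on (c k) (Dom k)"
  using c_eq_iff R_inj by (auto intro!: inj_onI)

lemma \<phi>_c [simp]: "k \<in> I \<Longrightarrow> z \<in> Dom k \<Longrightarrow> \<phi> k (c k z) = z"
  by (simp add: \<phi>_def inj_on_c)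

lemma c_in_U: "z \<in> Dom k \<Longrightarrow> c k z \<in> U k"
  by (simp add: U_def)

lemma c_in_U_iff: "k \<in> I \<Longrightarrow> z \<in> Dom k \<Longrightarrow> c k z \<in> U l \<longleftrightarrow> (\<exists>u. R k z l u)"
  using c_eq_iff[of k z l] R_dom unfolding U_def by (auto; metis image_iff)

lemma openin_T: "openin T W \<longleftrightarrow> W \<subseteq> carrier \<and> (\<forall>k\<in>I. open {z \<in> Dom k. c k z \<in> W})"
proof -
  have "istopology (\<lambda>W. W \<subseteq> carrier \<and> (\<forall>k\<in>I. open {z \<in> Dom k. c k z \<in> W}))"
    unfolding istopology_def
  proof (rule conjI; intro allI impI conjI ballI)
    fix S S' k assume *: "S \<subseteq> carrier \<and> (\<forall>k\<in>I. open {z \<in> Dom k. c k z \<in> S})"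
        "S' \<subseteq> carrier \<and> (\<forall>k\<in>I. open {z \<in> Dom k. c k z \<in> S'})"
    show "S \<inter> S' \<subseteq> carrier" using * by blast
    assume "k \<in> I"
    have "{z \<in> Dom k. c k z \<in> S \<inter> S'} = {z \<in> Dom k. c k z \<in> S} \<inter> {z \<in> Dom k. c k z \<in> S'}" by auto
    then show "open {z \<in> Dom k. c k z \<in> S \<inter> S'}" using * \<open>k \<in> I\<close> by (simp add: open_Int)
  next
    fix \<K> k assume *: "\<forall>K\<in>\<K>. K \<subseteq> carrier \<and> (\<forall>k\<in>I. open {z \<in> Dom k. c k z \<in> K})"
    show "\<Union> \<K> \<subseteq> carrier" using * by blast
    assume "k \<in> I"
    have "{z \<in> Dom k. c k z \<in> \<Union> \<K>} = (\<Union>K\<in>\<K>. {z \<in> Dom k. c k z \<in> K})" by auto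
    then show "open {z \<in> Dom k. c k z \<in> \<Union> \<K>}" using * \<open>k \<in> I\<close> by auto
  qed
  then show ?thesis unfolding T_def by simp
qed

lemma topspace_T: "topspace T = carrier"
proof -
  have "openin T carrier"
    unfolding openin_T
  proof (intro conjI ballI)
    fix k assume "k \<in> I"
    then have "{z \<in> Dom k. c k z \<in> carrier} = Dom k" by (auto simp: carrier_def)
    then show "open {z \<in> Dom k. c k z \<in> carrier}" using open_Dom by simp
  qed simp
  then show ?thesis
    by (metis openin_T openin_subset openin_topspace subset_antisym)
qed

lemma c_in_topspace: "k \<in> I \<Longrightarrow> z \<in> Dom k \<Longrightarrow> c k z \<in> topspace T"
  by (auto simp: topspace_T carrier_def)

lemma topspaceE:
  assumes "x \<in> topspace T" obtains k z where "k \<in> I" "z \<in> Dom k" "x = c k z"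
  using assms by (auto simp: topspace_T carrier_def)

text \<open>Pulled back to another piece, the image of \<open>W\<close> becomes the set of points
  related to \<open>W\<close>, which \<open>R_open\<close> makes open.\<close>

lemma openin_c:
  assumes "k \<in> I" "open W" "W \<subseteq> Dom k"
  shows "openin T (c k ` W)"
proof -
  have "{z \<in> Dom l. c l z \<in> c k ` W} = {z. \<exists>u\<in>W. R l z k u}" if "l \<in> I" for l
    using that R_dom c_eq_iff by blast
  moreover have "c k ` W \<subseteq> carrier" using assms by (auto simp: carrier_def)
  ultimately show ?thesis unfolding openin_T using R_open[OF assms(2)] by simp
qed

lemma openin_U: "k \<in> I \<Longrightarrow> openin T (U k)"
  unfolding U_def by (rule openin_c) (auto simp: open_Dom)

lemma open_preimage: "openin T W \<Longrightarrow> k \<in> I \<Longrightarrow> open {z \<in> Dom k. c k z \<in> W}"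
  by (simp add: openin_T)

lemma continuous_map_c: "k \<in> I \<Longrightarrow> continuous_map (top_of_set (Dom k)) T (c k)"
  unfolding continuous_map_def
  using open_preimage c_in_topspace open_Dom by (auto simp: openin_open_eq Pi_def)

lemma \<phi>_image: "k \<in> I \<Longrightarrow> \<phi> k ` U k = Dom k"
  by (auto simp: U_def image_image intro!: image_eqI)

lemma inv_\<phi>: "k \<in> I \<Longrightarrow> y \<in> Dom k \<Longrightarrow> inv_into (U k) (\<phi> k) y = c k y"
  by (rule inv_into_f_eq) (auto simp: U_def inj_on_def)

lemma homeomorphic_map_c: "k \<in> I \<Longrightarrow> homeomorphic_map (top_of_set (Dom k)) (subtopology T (U k)) (c k)"
proof (rule bijective_open_imp_homeomorphic_map)
  assume k: "k \<in> I"
  show "continuous_map (top_of_set (Dom k)) (subtopology T (U k)) (c k)"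
    using k continuous_map_c by (auto simp: continuous_map_in_subtopology U_def)
  show "open_map (top_of_set (Dom k)) (subtopology T (U k)) (c k)"
    unfolding open_map_def
  proof (intro allI impI)
    fix W assume "openin (top_of_set (Dom k)) W"
    then have "open W" "W \<subseteq> Dom k" using open_Dom by (auto simp: openin_open_eq)
    then show "openin (subtopology T (U k)) (c k ` W)"
      using openin_c[OF k] openin_U[OF k] by (auto simp: openin_open_subtopology U_def)
  qed
  show "c k ` topspace (top_of_set (Dom k)) = topspace (subtopology T (U k))"
    using openin_subset[OF openin_U[OF k]] by (auto simp: U_def)
  show "inj_on (c k) (topspace (top_of_set (Dom k)))" using k inj_on_c by simp
qed

lemma homeomorphic_map_\<phi>: "k \<in> I \<Longrightarrow> homeomorphic_map (subtopology T (U k)) (top_of_set (Dom k)) (\<phi> k)"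
proof -
  assume k: "k \<in> I"
  obtain g where g: "homeomorphic_maps (top_of_set (Dom k)) (subtopology T (U k)) (c k) g"
    using homeomorphic_map_c[OF k] homeomorphic_map_maps by blast
  have "\<phi> k x = g x" if "x \<in> topspace (subtopology T (U k))" for x
    using that g k by (auto simp: homeomorphic_maps_def U_def)
  then have "homeomorphic_maps (top_of_set (Dom k)) (subtopology T (U k)) (c k) (\<phi> k)"
    using g homeomorphic_maps_eq by metis
  then show ?thesis using homeomorphic_maps_map by blast
qed

lemma Hausdorff_T: "Hausdorff_space T"
  unfolding Hausdorff_space_def
proof (intro allI impI)
  fix x y assume "x \<in> topspace T \<and> y \<in> topspace T \<and> x \<noteq> y"
  then obtain k z l u where k: "k \<in> I" "z \<in> Dom k" "x = c k z" and l: "l \<in> I" "u \<in> Dom l" "y = c l u"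
    and "x \<noteq> y" by (meson topspaceE)
  then have "\<not> R k z l u" using c_eq_iff by blast
  from R_sep[OF k(1) l(1) k(2) l(2) this] obtain A B where AB: "open A" "open B" "z \<in> A" "u \<in> B"
    "\<forall>z'\<in>A. \<forall>u'\<in>B. \<not> R k z' l u'" by blast
  have "disjnt (c k ` (A \<inter> Dom k)) (c l ` (B \<inter> Dom l))"
    using AB(5) k l c_eq_iff by (auto simp: disjnt_iff)
  moreover have "openin T (c k ` (A \<inter> Dom k))" "openin T (c l ` (B \<inter> Dom l))"
    using AB k l open_Dom by (auto intro!: openin_c)
  ultimately show "\<exists>U V. openin T U \<and> openin T V \<and> x \<in> U \<and> y \<in> V \<and> disjnt U V"
    using AB k l by blast
qed

text \<open>Images of a countable basis of the coordinate space suffice because the pieces are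
  indexed by natural numbers.\<close>

lemma second_countable_T: "second_countable T"
proof -
  obtain \<B> :: "(complex^'d) set set" where \<B>: "countable \<B>" "\<And>C. C \<in> \<B> \<Longrightarrow> open C"
    "\<And>S. open S \<Longrightarrow> \<exists>\<U>. \<U> \<subseteq> \<B> \<and> S = \<Union>\<U>"
    by (metis (no_types, lifting) ex_countable_basis topological_basis_def)
  let ?\<C> = "(\<lambda>(k, C). c k ` (C \<inter> Dom k)) ` (I \<times> \<B>)"
  show ?thesis unfolding second_countable_def
  proof (intro exI conjI ballI allI impI)
    show "countable ?\<C>" using \<B>(1) by (intro countable_image countable_SIGMA) auto
    show "openin T V" if "V \<in> ?\<C>" for V using that \<B>(2) open_Dom by (auto intro!: openin_c)
    fix W x assume W: "openin T W \<and> x \<in> W"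
    then have "x \<in> topspace T" using openin_subset by blast
    then obtain k z where k: "k \<in> I" "z \<in> Dom k" "x = c k z" by (rule topspaceE)
    have "open {z \<in> Dom k. c k z \<in> W}" using W k open_preimage by blast
    then obtain \<U> where \<U>: "\<U> \<subseteq> \<B>" "{z \<in> Dom k. c k z \<in> W} = \<Union>\<U>" using \<B>(3) by meson
    then obtain C where C: "C \<in> \<U>" "z \<in> C" using k W by auto
    then have "C \<subseteq> {z \<in> Dom k. c k z \<in> W}" using \<U> by auto
    moreover have "(k, C) \<in> I \<times> \<B>" using C \<U> k by auto
    ultimately show "\<exists>V\<in>?\<C>. x \<in> V \<and> V \<subseteq> W"
      by (intro bexI[of _ "c k ` (C \<inter> Dom k)"] image_eqI[of _ _ "(k, C)"]) (use C k in auto)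
  qed
qed

lemma complex_manifold_T:
  assumes "in_charts holo_on A A (\<lambda>x. x)"
  shows "complex_manifold T A"
  unfolding complex_manifold_def
  using Hausdorff_T second_countable_T assms homeomorphic_map_\<phi> openin_U \<phi>_image open_Dom
  by (auto simp: A_def topspace_T carrier_def U_def)

lemma in_charts_A:
  assumes "\<And>k l. k \<in> I \<Longrightarrow> l \<in> I \<Longrightarrow>
    P {y \<in> Dom k. f (c k y) \<in> U l} (\<lambda>y. \<phi> l (f (inv_into (U k) (\<phi> k) y)))"
  shows "in_charts P A A f"
proof -
  have "\<phi> k ` (U k \<inter> f -` U l) = {y \<in> Dom k. f (c k y) \<in> U l}" if "k \<in> I" for k l
    using that by (force simp: U_def)
  then show ?thesis using assms by (auto simp: in_charts_def A_def)
qed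

end

section \<open>Lattices and tori\<close>

lemma additive_subgroup_of_int:
  fixes L :: "'a::real_vector set"
  assumes "0 \<in> L" "\<And>x y. x \<in> L \<Longrightarrow> y \<in> L \<Longrightarrow> x - y \<in> L" "x \<in> L"
  shows "of_int n *\<^sub>R x \<in> L"
proof -
  have neg: "- y \<in> L" if "y \<in> L" for y using assms(2)[OF assms(1) that] by simp
  have "real m *\<^sub>R x \<in> L" for m
  proof (induction m)
    case (Suc m)
    then show ?case using assms(2)[OF Suc neg[OF assms(3)]] by (simp add: algebra_simps)
  qed (simp add: assms)
  then show ?thesis
    using neg by (cases n rule: int_cases2) fastforce+
qed

lemma additive_subgroup_sum:
  fixes L :: "'a::real_vector set"
  assumes "0 \<in> L" "\<And>x y. x \<in> L \<Longrightarrow> y \<in> L \<Longrightarrow> x - y \<in> L" "finite C" "C \<subseteq> L"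
  shows "(\<Sum>c\<in>C. of_int (n c) *\<^sub>R c) \<in> L"
proof -
  have add: "x + y \<in> L" if "x \<in> L" "y \<in> L" for x y
    using assms(2)[OF that(1) assms(2)[OF assms(1) that(2)]] by simp
  show ?thesis using assms(3,4)
    by (induction C) (auto intro!: add additive_subgroup_of_int assms(1,2))
qed

lemma span_insert_cong:
  assumes "r \<noteq> 0" "v - r *\<^sub>R b \<in> span C"
  shows "span (insert v C) = span (insert b C)"
proof (rule span_eq[THEN iffD2], intro conjI insert_subsetI)
  show "v \<in> span (insert b C)" using assms(2) by (auto simp: span_breakdown_eq)
  have "b - (1 / r) *\<^sub>R v = (- 1 / r) *\<^sub>R (v - r *\<^sub>R b)" using assms(1) by (simp add: algebra_simps)
  then have "b - (1 / r) *\<^sub>R v \<in> span C" using assms(2) by (metis span_scale)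
  then show "b \<in> span (insert v C)" by (auto simp: span_breakdown_eq)
qed (auto intro: span_base)

text \<open>The lattice vector added to \<open>C\<close> is one whose \<open>b\<close>-coordinate
  modulo \<open>span C\<close> is positive and least; division with remainder by that coordinate
  then reduces every lattice vector to one in \<open>span C\<close>. A least coordinate exists
  because, after subtracting integer parts along \<open>C\<close>, only a bounded region of the
  discrete set \<open>L\<close> has to be searched.\<close>

lemma discrete_subgroup_basis:
  fixes L :: "'a::euclidean_space set"
  assumes L: "0 \<in> L" "\<And>x y. x \<in> L \<Longrightarrow> y \<in> L \<Longrightarrow> x - y \<in> L" "\<And>r. finite (cball 0 r \<inter> L)"
    and "finite B" "independent B" "B \<subseteq> L"
  shows "\<exists>C. finite C \<and> independent C \<and> span C = span B \<and> C \<subseteq> L \<and>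
    (\<forall>x \<in> L \<inter> span B. \<exists>n :: 'a \<Rightarrow> int. x = (\<Sum>c\<in>C. of_int (n c) *\<^sub>R c))"
  using assms(4-6)
proof (induction B)
  case empty
  show ?case by (rule exI[of _ "{}"]) (auto simp: independent_empty)
next
  case (insert b B)
  have "independent B" "b \<notin> span B"
    using insert.prems(1) insert.hyps(2) by (auto simp: independent_insert)
  with insert obtain C where C: "finite C" "independent C" "span C = span B" "C \<subseteq> L"
    "\<And>x. x \<in> L \<inter> span B \<Longrightarrow> \<exists>n :: 'a \<Rightarrow> int. x = (\<Sum>c\<in>C. of_int (n c) *\<^sub>R c)"
    by (metis insert_subset)
  have b: "b \<notin> span C" "b \<in> L" using C \<open>b \<notin> span B\<close> insert.prems by auto
  define P where "P = {t::real. 0 < t \<and> (\<exists>x\<in>L. x - t *\<^sub>R b \<in> span C)}"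
  \<comment> \<open>This bounds every vector whose \<open>b\<close>-coordinate lies between 0 and 1
    and whose coordinates along \<open>C\<close> are fractional parts.\<close>
  define r where "r = norm b + (\<Sum>c\<in>C. norm c)"
  have "P \<inter> {..1} \<subseteq> (\<lambda>x. SOME t. x - t *\<^sub>R b \<in> span C) ` (cball 0 r \<inter> L)"
  proof
    fix t assume t: "t \<in> P \<inter> {..1}"
    then obtain x where x: "x \<in> L" "x - t *\<^sub>R b \<in> span C" and "0 < t" "t \<le> 1" by (auto simp: P_def)
    then obtain u where u: "x - t *\<^sub>R b = (\<Sum>c\<in>C. u c *\<^sub>R c)" using span_finite[OF C(1)] by auto
    define y where "y = x - (\<Sum>c\<in>C. of_int \<lfloor>u c\<rfloor> *\<^sub>R c)"
    have "y \<in> L" unfolding y_def by (intro L x additive_subgroup_sum C)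
    have y: "y - t *\<^sub>R b = (\<Sum>c\<in>C. frac (u c) *\<^sub>R c)"
      using u by (simp add: y_def frac_def algebra_simps sum_subtractf)
    then have "y = t *\<^sub>R b + (\<Sum>c\<in>C. frac (u c) *\<^sub>R c)" by (simp add: algebra_simps)
    moreover have "norm (t *\<^sub>R b) \<le> norm b" using \<open>0 < t\<close> \<open>t \<le> 1\<close> by (simp add: mult_left_le_one_le)
    moreover have "norm (\<Sum>c\<in>C. frac (u c) *\<^sub>R c) \<le> (\<Sum>c\<in>C. norm c)"
      by (rule order_trans[OF norm_sum], rule sum_mono) (simp add: mult_left_le_one_le frac_lt_1 less_imp_le)
    ultimately have "norm y \<le> r" unfolding r_def
      by (simp only: norm_triangle_mono)
    have yC: "y - t *\<^sub>R b \<in> span C" unfolding y by (intro span_sum span_scale span_base)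
    have unique: "s = t" if "y - s *\<^sub>R b \<in> span C" for s
    proof (rule ccontr)
      assume "s \<noteq> t"
      have "(t - s) *\<^sub>R b = (y - s *\<^sub>R b) - (y - t *\<^sub>R b)" by (simp add: algebra_simps)
      then have "(1 / (t - s)) *\<^sub>R ((t - s) *\<^sub>R b) \<in> span C" using span_diff[OF that yC] by (metis span_scale)
      then show False using \<open>s \<noteq> t\<close> b by simp
    qed
    have "(SOME t. y - t *\<^sub>R b \<in> span C) = t" 
      by (rule some_equality[where P="\<lambda>t. y - t *\<^sub>R b \<in> span C", OF yC unique])
    moreover have "y \<in> cball 0 r \<inter> L" using \<open>norm y \<le> r\<close> \<open>y \<in> L\<close> by simp
    ultimately show "t \<in> (\<lambda>x. SOME t. x - t *\<^sub>R b \<in> span C) ` (cball 0 r \<inter> L)"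
      by (metis (lifting) image_eqI)
  qed
  then have fin: "finite (P \<inter> {..1})" using L(3) finite_surj by blast
  have "1 \<in> P" using b by (auto simp: P_def intro!: bexI[of _ b] span_zero)
  \<comment> \<open>The cutoff at 1 loses nothing: \<open>b\<close> itself has coordinate 1, so the
    minimum over the truncated set is the minimum over \<open>P\<close>.\<close>
  define t0 where "t0 = Min (P \<inter> {..1})"
  have "t0 \<in> P \<inter> {..1}" unfolding t0_def using fin \<open>1 \<in> P\<close> by (intro Min_in) auto
  then obtain v where v: "v \<in> L" "v - t0 *\<^sub>R b \<in> span C" and t0: "0 < t0" "t0 \<le> 1" by (auto simp: P_def)
  have min: "t0 \<le> t" if "t \<in> P" for t
    using that t0 Min_le[OF fin, of t] by (cases "t \<le> 1") (auto simp: t0_def)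
  have span: "span (insert v C) = span (insert b C)" using v t0 by (intro span_insert_cong[of t0]) auto
  also have "\<dots> = span (insert b B)" using C(3) by (simp add: span_insert)
  finally have spanB: "span (insert v C) = span (insert b B)" .
  have "v \<notin> span C"
  proof
    assume "v \<in> span C"
    then have "span (insert v C) = span C" by (rule span_redundant)
    then show False using span b span_base[of b "insert b C"] by auto
  qed
  then have indep: "independent (insert v C)" and "v \<notin> C"
    using C(2) span_base by (auto simp: independent_insert)
  have "\<exists>n :: 'a \<Rightarrow> int. x = (\<Sum>c\<in>insert v C. of_int (n c) *\<^sub>R c)" if x: "x \<in> L \<inter> span (insert b B)" for x
  proof -
    obtain t where t: "x - t *\<^sub>R b \<in> span C" using x C(3) by (auto simp: span_breakdown_eq)
    define n where "n = \<lfloor>t / t0\<rfloor>"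
    define s where "s = t - of_int n * t0"
    define y where "y = x - of_int n *\<^sub>R v"
    have "y \<in> L" unfolding y_def using x v by (intro L additive_subgroup_of_int) auto
    have "y - s *\<^sub>R b = (x - t *\<^sub>R b) - of_int n *\<^sub>R (v - t0 *\<^sub>R b)"
      by (simp add: y_def s_def algebra_simps)
    then have yC: "y - s *\<^sub>R b \<in> span C" using t v by (simp add: span_diff span_scale)
    have "0 \<le> s" "s < t0"
      using t0 floor_divide_lower[of t0 t] floor_divide_upper[of t0 t] by (auto simp: s_def n_def algebra_simps)
    then have "s = 0" using min[of s] yC \<open>y \<in> L\<close> by (force simp: P_def)
    then have "y \<in> L \<inter> span B" using yC \<open>y \<in> L\<close> C(3) by simp
    then obtain m :: "'a \<Rightarrow> int" where m: "y = (\<Sum>c\<in>C. of_int (m c) *\<^sub>R c)" using C(5) by blast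
    have "(\<Sum>c\<in>C. of_int ((m(v := n)) c) *\<^sub>R c) = y"
      unfolding m using \<open>v \<notin> C\<close> by (intro sum.cong) auto
    then have "x = (\<Sum>c\<in>insert v C. of_int ((m(v := n)) c) *\<^sub>R c)"
      using C(1) \<open>v \<notin> C\<close> by (simp add: y_def)
    then show ?thesis by blast
  qed
  with C v indep spanB show ?case by (intro exI[of _ "insert v C"]) auto
qed

lemma cis_eq_1_iff: "cis x = 1 \<longleftrightarrow> (\<exists>n::int. x = n * 2 * pi)"
  unfolding cos_one_2pi_int[symmetric] by (auto simp: complex_eq_iff intro: cos_one_sin_zero)

section \<open>The exponential map, characters and periods\<close>

context torus
begin

lemma ex_0 [simp]: "ex 0 = 0"
  using ex_add[of 0 0] by simp

lemma ex_minus: "ex (- \<xi>) = - ex \<xi>"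
  using ex_add[of \<xi> "- \<xi>"] by (simp add: eq_neg_iff_add_eq_0 add.commute)

lemma ex_diff: "ex (\<xi> - \<eta>) = ex \<xi> - ex \<eta>"
  using ex_add[of \<xi> "- \<eta>"] by (simp add: ex_minus)

lemma continuous_ex: "continuous_on UNIV ex"
proof -
  obtain N l where N: "open N" "0 \<in> N" "homeomorphism N (ex ` N) ex l" using ex_local_homeo by blast
  then have "continuous_on N ex" by (simp add: homeomorphism_def)
  then have "isCont ex 0" using N by (simp add: continuous_on_eq_continuous_at)
  then have *: "(ex \<longlongrightarrow> 0) (at 0)" by (simp add: isCont_def)
  have "(ex \<longlongrightarrow> ex x) (at x)" for x
  proof -
    have "((\<lambda>h. ex x + ex h) \<longlongrightarrow> ex x + 0) (at 0)" by (intro tendsto_add tendsto_const *)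
    then have "((\<lambda>h. ex (x + h)) \<longlongrightarrow> ex x) (at 0)" by (simp add: ex_add)
    then show ?thesis using LIM_offset_zero_iff[of x ex] by (simp add: LIM_offset_zero_cancel)
  qed
  then show ?thesis by (simp add: continuous_at_imp_continuous_on isCont_def)
qed

lemma open_translate: "open S \<Longrightarrow> open ((\<lambda>h. h - g) -` S)" for g :: 'g
  by (intro open_vimage continuous_intros)

lemma open_ex: assumes "open W" shows "open (ex ` W)"
proof (subst open_subopen, intro ballI)
  fix g assume "g \<in> ex ` W"
  then obtain x where x: "x \<in> W" "g = ex x" by blast
  obtain N l where N: "open N" "0 \<in> N" "open (ex ` N)" "homeomorphism N (ex ` N) ex l" using ex_local_homeo by blast
  let ?W = "N \<inter> (\<lambda>h. x + h) -` W"
  have "open ?W" by (intro open_Int N open_vimage assms continuous_intros)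
  then have "openin (top_of_set N) ?W" using N by (auto simp: openin_open)
  then have "openin (top_of_set (ex ` N)) (ex ` ?W)" using homeomorphism_imp_open_map N(4) by blast
  then have "open (ex ` ?W)" using N(3) openin_open_trans by blast
  then have "open ((\<lambda>h. h - g) -` (ex ` ?W))" by (rule open_translate)
  moreover have "g \<in> (\<lambda>h. h - g) -` (ex ` ?W)" using N x by (auto intro!: image_eqI[of _ _ 0])
  moreover have "(\<lambda>h. h - g) -` (ex ` ?W) \<subseteq> ex ` W"
  proof
    fix h assume "h \<in> (\<lambda>h. h - g) -` (ex ` ?W)"
    then obtain y where "h - g = ex y" "x + y \<in> W" by auto
    then show "h \<in> ex ` W" using x by (intro image_eqI[of _ _ "x + y"]) (auto simp: ex_add algebra_simps)
  qed
  ultimately show "\<exists>T. open T \<and> g \<in> T \<and> T \<subseteq> ex ` W" by blast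
qed

text \<open>The range is an open subgroup, so its complement, a union of cosets, is open
  too.\<close>

lemma surj_ex: "range ex = UNIV"
proof -
  have "open (range ex)" by (rule open_ex) simp
  moreover have "open (- range ex)"
  proof (subst open_subopen, intro ballI)
    fix g assume g: "g \<in> - range ex"
    have "(\<lambda>h. h - g) -` range ex \<subseteq> - range ex"
    proof
      fix h assume "h \<in> (\<lambda>h. h - g) -` range ex"
      then obtain x where x: "h - g = ex x" by auto
      have "g = ex (y - x)" if "h = ex y" for y using x that by (simp add: ex_diff algebra_simps)
      then show "h \<in> - range ex" using g by auto
    qed
    moreover have "g \<in> (\<lambda>h. h - g) -` range ex" by (auto intro!: image_eqI[of _ _ 0])
    moreover have "open ((\<lambda>h. h - g) -` range ex)" by (intro open_translate open_ex open_UNIV)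
    ultimately show "\<exists>T. open T \<and> g \<in> T \<and> T \<subseteq> - range ex" by blast
  qed
  ultimately show ?thesis
    using connected unfolding connected_clopen by (auto simp: closed_def)
qed

lemma obtain_log: obtains \<xi> where "g = ex \<xi>"
  using surj_ex by (metis rangeE UNIV_I)

text \<open>The hypothesis makes the choice of a logarithm immaterial, so the exponential of
  \<open>\<beta>\<close> descends along \<open>ex\<close>. Continuity descends as well because
  \<open>ex\<close> is open and surjective.\<close>

lemma weight_latticeI:
  assumes "\<And>\<xi>. ex \<xi> = 0 \<Longrightarrow> cis (blinfun_apply \<beta> \<xi>) = 1"
  shows "\<beta> \<in> weight_lattice ex"
proof -
  define ch where "ch g = cis (blinfun_apply \<beta> (SOME \<xi>. ex \<xi> = g))" for g
  have ch: "ch (ex \<xi>) = cis (\<beta> \<xi>)" for \<xi>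
  proof -
    have "ex (SOME \<eta>. ex \<eta> = ex \<xi>) = ex \<xi>" by (rule someI) simp
    then have "cis (\<beta> ((SOME \<eta>. ex \<eta> = ex \<xi>) - \<xi>)) = 1" by (intro assms) (simp add: ex_diff)
    then show ?thesis by (simp add: ch_def blinfun.diff_right flip: cis_divide)
  qed
  have "ch (g + h) = ch g * ch h" for g h
  proof -
    obtain \<xi> \<eta> where "g = ex \<xi>" "h = ex \<eta>" using obtain_log by metis
    then show ?thesis by (simp add: ch cis_mult blinfun.add_right flip: ex_add)
  qed
  moreover have "continuous_on UNIV ch"
  proof (subst continuous_on_open_vimage[OF open_UNIV], intro allI impI)
    fix W :: "complex set" assume "open W"
    have "open ((\<lambda>\<xi>. cis (\<beta> \<xi>)) -` W)"
      using \<open>open W\<close> by (rule open_vimage) (simp add: cis_conv_exp, intro continuous_intros)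
    moreover have "ch -` W = ex ` ((\<lambda>\<xi>. cis (\<beta> \<xi>)) -` W)"
    proof (intro equalityI subsetI)
      fix g assume "g \<in> ch -` W"
      moreover obtain \<xi> where "g = ex \<xi>" by (rule obtain_log)
      ultimately show "g \<in> ex ` ((\<lambda>\<xi>. cis (\<beta> \<xi>)) -` W)" by (auto simp: ch)
    qed (auto simp: ch)
    ultimately show "open (ch -` W \<inter> UNIV)" using open_ex by simp
  qed
  ultimately show ?thesis using ch by (auto simp: weight_lattice_def)
qed

definition character :: "('a \<Rightarrow>\<^sub>L real) \<Rightarrow> 'g \<Rightarrow> complex" where
  "character \<beta> = (SOME ch. continuous_on UNIV ch \<and> (\<forall>g h. ch (g + h) = ch g * ch h) \<and> (\<forall>\<xi>. ch (ex \<xi>) = cis (\<beta> \<xi>)))"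

lemma
  assumes "\<beta> \<in> weight_lattice ex"
  shows continuous_character: "continuous_on UNIV (character \<beta>)"
    and character_ex: "character \<beta> (ex \<xi>) = cis (\<beta> \<xi>)"
proof -
  have "continuous_on UNIV (character \<beta>) \<and> (\<forall>g h. character \<beta> (g + h) = character \<beta> g * character \<beta> h) \<and>
    (\<forall>\<xi>. character \<beta> (ex \<xi>) = cis (\<beta> \<xi>))"
    using assms someI_ex[of "\<lambda>ch. continuous_on UNIV ch \<and> (\<forall>g h. ch (g + h) = ch g * ch h) \<and>
      (\<forall>\<xi>. ch (ex \<xi>) = cis (\<beta> \<xi>))", folded character_def]
    by (simp add: weight_lattice_def)
  then show "continuous_on UNIV (character \<beta>)" "character \<beta> (ex \<xi>) = cis (\<beta> \<xi>)" by auto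
qed

lemma character_kernel0_subset: "character_kernel0 ex \<beta> \<subseteq> {ex \<xi> | \<xi>. cis (blinfun_apply \<beta> \<xi>) = 1}"
  unfolding character_kernel0_def by (rule connected_component_subset)

text \<open>The kernel of \<open>\<beta>\<close> is a linear subspace, so its image under
  \<open>ex\<close> is connected and contains 0. Together with
  \<open>character_kernel0_subset\<close> this brackets the identity component tightly enough to
  find its fixed points.\<close>

lemma ex_in_character_kernel0:
  assumes "blinfun_apply \<beta> \<xi> = 0" shows "ex \<xi> \<in> character_kernel0 ex \<beta>"
proof -
  have "convex {\<xi>. blinfun_apply \<beta> \<xi> = 0}"
    by (rule convexI) (simp add: blinfun.add_right blinfun.scaleR_right)
  then have "connected (ex ` {\<xi>. blinfun_apply \<beta> \<xi> = 0})"
    by (intro connected_continuous_image continuous_on_subset[OF continuous_ex] convex_connected) auto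
  then have "ex ` {\<xi>. blinfun_apply \<beta> \<xi> = 0} \<subseteq> character_kernel0 ex \<beta>"
    unfolding character_kernel0_def
    by (intro connected_component_maximal) (auto intro!: image_eqI[of _ _ 0])
  then show ?thesis using assms by auto
qed

text \<open>\<open>ex\<close> is injective near 0, so two periods closer than a fixed bound coincide
  and the periods do not accumulate.\<close>

lemma finite_period_ball: "finite (cball 0 r \<inter> {\<xi>. ex \<xi> = 0})"
proof (rule finite_not_islimpt_in_compact)
  obtain N l where N: "open N" "0 \<in> N" "homeomorphism N (ex ` N) ex l" using ex_local_homeo by blast
  obtain \<epsilon> where \<epsilon>: "\<epsilon> > 0" "ball 0 \<epsilon> \<subseteq> N" using N(1,2) by (rule openE)
  have "x = y" if "ex x = 0" "ex y = 0" "dist y x < \<epsilon>" for x y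
  proof -
    have "y - x \<in> N" using that(3) \<epsilon>(2) by (auto simp: dist_norm norm_minus_commute dest!: subsetD[of _ _ "y - x"])
    then have "l (ex (y - x)) = y - x" "l (ex 0) = 0" using N(2,3) by (auto simp only: homeomorphism_apply1)
    then have "y - x = 0" using that by (simp add: ex_diff)
    then show ?thesis by simp
  qed
  then show "\<not> z islimpt {\<xi>. ex \<xi> = 0}" for z
    by (intro discrete_imp_not_islimpt[OF \<epsilon>(1)]) (metis mem_Collect_eq)
qed simp

text \<open>The open images of the balls about 0 exhaust a compact group.\<close>

lemma ex_ball_UNIV: "\<exists>r>0. ex ` ball 0 r = UNIV"
proof -
  have "UNIV \<subseteq> (\<Union>n::nat. ex ` ball 0 (real n))"
  proof
    fix g :: 'g
    obtain \<xi> where "g = ex \<xi>" by (rule obtain_log)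
    moreover obtain n where "norm \<xi> < real n" using reals_Archimedean2 by blast
    ultimately have "g \<in> ex ` ball 0 (real n)" by simp
    then show "g \<in> (\<Union>n::nat. ex ` ball 0 (real n))" by blast
  qed
  then obtain C' where C: "finite C'" "UNIV \<subseteq> (\<Union>n\<in>C'. ex ` ball 0 (real n))"
    using compactE_image[OF compact, of UNIV "\<lambda>n::nat. ex ` ball 0 (real n)"] open_ex by (metis open_ball)
  define m where "m = Suc (Max (insert 0 C'))"
  have "ball 0 (real n) \<subseteq> ball (0::'a) (real m)" if "n \<in> C'" for n
  proof (rule subset_ball)
    have "n \<le> Max (insert 0 C')" using C(1) that by (intro Max_ge) auto
    then show "real n \<le> real m" by (simp add: m_def)
  qed
  then have "ex ` ball 0 (real m) = UNIV" using C(2) by blast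
  then show ?thesis by (intro exI[of _ "real m"]) (auto simp: m_def)
qed

text \<open>Compactness forces the period lattice to have full rank. A vector of length
  \<open>r\<close> orthogonal to all periods would agree modulo periods with a vector shorter than
  \<open>r\<close>, although subtracting a vector orthogonal to it cannot shorten it.\<close>

lemma span_periods: "span {\<xi>. ex \<xi> = 0} = UNIV"
proof (rule ccontr)
  assume "span {\<xi>. ex \<xi> = 0} \<noteq> UNIV"
  then have "dim {\<xi>. ex \<xi> = 0} < DIM('a)"
    by (metis dim_eq_full dim_subset_UNIV le_neq_implies_less)
  then obtain u where u: "u \<noteq> 0" "\<And>y. y \<in> span {\<xi>. ex \<xi> = 0} \<Longrightarrow> orthogonal u y"
    using orthogonal_to_subspace_exists by blast
  obtain r where r: "r > 0" "ex ` ball 0 r = UNIV" using ex_ball_UNIV by blast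
  define w where "w = (r / norm u) *\<^sub>R u"
  have "norm w = r" using u r by (simp add: w_def)
  obtain \<eta> where \<eta>: "norm \<eta> < r" "ex w = ex \<eta>" using r(2) by (metis UNIV_I dist_0_norm imageE mem_ball)
  then have "orthogonal u (w - \<eta>)" by (intro u(2) span_base) (simp add: ex_diff)
  then have "w \<bullet> w = w \<bullet> \<eta>" by (simp add: w_def orthogonal_def inner_diff_right)
  also have "\<dots> \<le> norm w * norm \<eta>" by (rule norm_cauchy_schwarz)
  finally have "r * r \<le> r * norm \<eta>" using \<open>norm w = r\<close> by (simp add: dot_square_norm power2_eq_square)
  then show False using \<eta>(1) r(1) by simp
qed

text \<open>The weights are the dual basis of a basis of the period lattice, times 2 pi. If all of
  them take values in 2 pi Z at \<open>\<xi>\<close>, the coordinates of \<open>\<xi>\<close> are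
  integers and \<open>\<xi>\<close> is a period. They supply the characters that make the action
  faithful.\<close>

lemma separating_weights:
  "\<exists>(\<mu> :: nat \<Rightarrow> ('a \<Rightarrow>\<^sub>L real)) N. (\<forall>k<N. \<mu> k \<in> weight_lattice ex \<and> \<mu> k \<noteq> 0) \<and>
     (\<forall>\<xi>. (\<forall>k<N. cis (\<mu> k \<xi>) = 1) \<longrightarrow> ex \<xi> = 0)"
proof -
  let ?L = "{\<xi>. ex \<xi> = 0}"
  obtain B where B: "B \<subseteq> ?L" "independent B" "?L \<subseteq> span B" using maximal_independent_subset by blast
  then have "span B = UNIV" using span_periods by (metis span_mono span_span top.extremum_uniqueI)
  obtain C where C: "finite C" "independent C" "span C = span B" "C \<subseteq> ?L"
    "\<And>x. x \<in> ?L \<inter> span B \<Longrightarrow> \<exists>n :: 'a \<Rightarrow> int. x = (\<Sum>c\<in>C. of_int (n c) *\<^sub>R c)"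
    using discrete_subgroup_basis[of ?L B] finite_period_ball B independent_imp_finite by (force simp: ex_diff)
  obtain h where h: "bij_betw h {..<card C} C" using C(1) by (metis bij_betw_from_nat_into_finite)
  have "\<exists>f. linear f \<and> (\<forall>x\<in>C. f x = (if x = c then 2 * pi else 0 :: real))" for c
    by (rule linear_independent_extend[OF C(2)])
  then obtain f where f: "\<And>c. linear (f c)" "\<And>c x. x \<in> C \<Longrightarrow> f c x = (if x = c then 2 * pi else 0 :: real)" by metis
  have fsum: "f c (\<Sum>x\<in>C. u x *\<^sub>R x) = 2 * pi * u c" if "c \<in> C" for c u
    using that C(1) by (simp add: linear_sum[OF f(1)] linear_cmul[OF f(1)] f(2) if_distrib cong: if_cong)
  define \<mu> where "\<mu> k = Blinfun (f (h k))" for k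
  have \<mu>: "blinfun_apply (\<mu> k) = f (h k)" for k
    unfolding \<mu>_def by (rule bounded_linear_Blinfun_apply) (simp add: f(1) linear_conv_bounded_linear[symmetric])
  have hC: "h k \<in> C" if "k < card C" for k using h that by (auto simp: bij_betw_def)
  have "\<mu> k \<in> weight_lattice ex" if "k < card C" for k
  proof (rule weight_latticeI)
    fix \<xi> assume "ex \<xi> = 0"
    then obtain n :: "'a \<Rightarrow> int" where "\<xi> = (\<Sum>c\<in>C. of_int (n c) *\<^sub>R c)" using C(5) \<open>span B = UNIV\<close> by auto
    then have "\<mu> k \<xi> = of_int (n (h k)) * 2 * pi" using fsum[OF hC[OF that], of "\<lambda>c. of_int (n c)"] by (simp add: \<mu>)
    then show "cis (\<mu> k \<xi>) = 1" unfolding cis_eq_1_iff by blast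
  qed
  moreover have "\<mu> k \<noteq> 0" if "k < card C" for k
  proof -
    have "\<mu> k (h k) = 2 * pi" using hC[OF that] by (simp add: \<mu> f)
    then show ?thesis by auto
  qed
  moreover have "ex \<xi> = 0" if *: "\<forall>k<card C. cis (\<mu> k \<xi>) = 1" for \<xi>
  proof -
    have "\<xi> \<in> span C" using C(3) \<open>span B = UNIV\<close> by simp
    then obtain u where u: "\<xi> = (\<Sum>c\<in>C. u c *\<^sub>R c)" using span_finite[OF C(1)] by auto
    have "\<exists>n::int. u c = of_int n" if "c \<in> C" for c
    proof -
      obtain k where k: "k < card C" "h k = c" using h \<open>c \<in> C\<close>
        by (metis bij_betw_iff_bijections lessThan_iff)
      then have "\<exists>n::int. f c \<xi> = n * 2 * pi" using * by (metis \<mu> cis_eq_1_iff)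
      then show ?thesis using fsum[OF that, of u] u by auto
    qed
    then obtain n :: "'a \<Rightarrow> int" where "\<And>c. c \<in> C \<Longrightarrow> u c = of_int (n c)" by metis
    then have "\<xi> = (\<Sum>c\<in>C. of_int (n c) *\<^sub>R c)" unfolding u by (intro sum.cong) auto
    moreover have "(\<Sum>c\<in>C. of_int (n c) *\<^sub>R c) \<in> ?L"
      by (rule additive_subgroup_sum) (use C in \<open>auto simp: ex_diff\<close>)
    ultimately show ?thesis by auto
  qed
  ultimately show ?thesis by (intro exI[of _ \<mu>] exI[of _ "card C"]) auto
qed

end

section \<open>The local model\<close>

text \<open>The kernel of \<open>\<beta>\<close> is contained in that of \<open>\<gamma>\<close>
  only if \<open>\<gamma>\<close> is a multiple of \<open>\<beta>\<close>. For two weights at a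
  vertex this yields one-parameter subgroups that rotate one coordinate and fix another.\<close>

lemma blinfun_dual_vector:
  fixes \<beta> \<gamma> :: "'a::real_normed_vector \<Rightarrow>\<^sub>L real"
  assumes "\<And>r. \<gamma> \<noteq> r *\<^sub>R \<beta>"
  obtains \<xi> where "\<beta> \<xi> = 0" "\<gamma> \<xi> = 1"
proof -
  have "\<exists>\<xi>. \<beta> \<xi> = 0 \<and> \<gamma> \<xi> \<noteq> 0"
  proof (rule ccontr)
    assume *: "\<not> (\<exists>\<xi>. \<beta> \<xi> = 0 \<and> \<gamma> \<xi> \<noteq> 0)"
    show False
    proof (cases "\<beta> = 0")
      case True
      then have "\<gamma> = 0" using * by (auto intro!: blinfun_eqI)
      then show False using assms[of 0] by simp
    next
      case False
      then obtain \<eta> where \<eta>: "\<beta> \<eta> \<noteq> 0" by (metis blinfun_eqI zero_blinfun.rep_eq)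
      have eq: "\<gamma> \<xi> = (\<gamma> \<eta> / \<beta> \<eta>) * \<beta> \<xi>" for \<xi>
      proof -
        have "\<beta> (\<xi> - (\<beta> \<xi> / \<beta> \<eta>) *\<^sub>R \<eta>) = 0" using \<eta> by (simp add: blinfun.diff_right blinfun.scaleR_right)
        then have "\<gamma> (\<xi> - (\<beta> \<xi> / \<beta> \<eta>) *\<^sub>R \<eta>) = 0" using * by blast
        then show ?thesis using \<eta> by (simp add: blinfun.diff_right blinfun.scaleR_right field_simps)
      qed
      have "\<gamma> = (\<gamma> \<eta> / \<beta> \<eta>) *\<^sub>R \<beta>"
        by (rule blinfun_eqI) (simp only: scaleR_blinfun.rep_eq real_scaleR_def, rule eq)
      then show False using assms by blast
    qed
  qed
  then obtain \<xi> where "\<beta> \<xi> = 0" "\<gamma> \<xi> \<noteq> 0" by blast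
  then show ?thesis by (intro that[of "(1 / \<gamma> \<xi>) *\<^sub>R \<xi>"]) (auto simp: blinfun.scaleR_right)
qed

text \<open>
  A one-skeleton in coordinates: vertices are numbered by \<open>k < m\<close>, and \<open>(k, i)\<close> is the \<open>i\<close>-th
  oriented edge at vertex \<open>k\<close>; its reverse is \<open>(nb k i, rv k i)\<close>. The weights \<open>\<mu> k\<close> belong to
  auxiliary pieces without fixed points, which make the action faithful.
\<close>

locale gkm_model = torus ex
  for ex :: "'a::euclidean_space \<Rightarrow> 'g::{topological_ab_group_add, t2_space}" +
  fixes m N :: nat
    and w :: "nat \<Rightarrow> 'd::finite \<Rightarrow> ('a \<Rightarrow>\<^sub>L real)"
    and nb :: "nat \<Rightarrow> 'd \<Rightarrow> nat"
    and rv :: "nat \<Rightarrow> 'd \<Rightarrow> 'd"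
    and \<sigma> :: "nat \<Rightarrow> 'd \<Rightarrow> 'd \<Rightarrow> 'd"
    and cc :: "nat \<Rightarrow> 'd \<Rightarrow> 'd \<Rightarrow> int"
    and \<mu> :: "nat \<Rightarrow> ('a \<Rightarrow>\<^sub>L real)"
  assumes nb_less: "k < m \<Longrightarrow> nb k i < m"
    and nb_nb: "k < m \<Longrightarrow> nb (nb k i) (rv k i) = k"
    and rv_rv: "k < m \<Longrightarrow> rv (nb k i) (rv k i) = i"
    and \<sigma>_\<sigma>: "k < m \<Longrightarrow> \<sigma> (nb k i) (rv k i) (\<sigma> k i j) = j"
    and w_weight: "k < m \<Longrightarrow> w k i \<in> weight_lattice ex"
    and w_indep: "k < m \<Longrightarrow> pairwise_independent UNIV (w k)"
    and w_rv: "k < m \<Longrightarrow> w (nb k i) (rv k i) = - w k i"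
    and w_\<sigma>: "k < m \<Longrightarrow> w (nb k i) (\<sigma> k i j) = w k j + of_int (cc k i j) *\<^sub>R w k i"
    and \<mu>_weight: "k < N \<Longrightarrow> \<mu> k \<in> weight_lattice ex"
    and \<mu>_nonzero: "k < N \<Longrightarrow> \<mu> k \<noteq> 0"
    and \<mu>_separating: "(\<And>k. k < N \<Longrightarrow> cis (\<mu> k \<xi>) = 1) \<Longrightarrow> ex \<xi> = 0"
begin

section \<open>Consequences of the axioms of a one-skeleton\<close>

lemma w_nonzero: "k < m \<Longrightarrow> w k i \<noteq> 0"
proof
  assume "k < m" "w k i = 0"
  then have "independent (w k ` {i, i})" using w_indep unfolding pairwise_independent_def by blast
  then show False using \<open>w k i = 0\<close> by simp
qed

lemma w_dep:
  assumes "k < m" "w k i = r *\<^sub>R w k j" shows "i = j"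
proof (rule ccontr)
  assume "i \<noteq> j"
  have *: "inj_on (w k) {i, j}" "independent (w k ` {i, j})"
    using w_indep[OF assms(1)] unfolding pairwise_independent_def by blast+
  then have "w k i \<noteq> w k j" using \<open>i \<noteq> j\<close> by (auto simp: inj_on_def)
  then have "w k i \<notin> span {w k j}" using * by (auto simp: independent_insert)
  then show False using assms(2) by (auto simp: span_singleton)
qed

lemma w_dual:
  assumes "k < m" "i \<noteq> j"
  obtains \<xi> where "w k i \<xi> = 0" "w k j \<xi> = 1"
proof -
  have "w k j \<noteq> r *\<^sub>R w k i" for r using w_dep[OF assms(1), of j r i] assms(2) by blast
  then show thesis by (rule blinfun_dual_vector) (rule that)
qed

text \<open>The axioms do not say that the connection sends an edge to its reverse. The transported
  edge has a weight proportional to that of the reversed edge, and pairwise independence leaves only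
  that edge.\<close>

lemma \<sigma>_self: assumes "k < m" shows "\<sigma> k i i = rv k i"
proof (rule w_dep[OF nb_less[OF assms]])
  show "w (nb k i) (\<sigma> k i i) = (- (1 + of_int (cc k i i))) *\<^sub>R w (nb k i) (rv k i)"
    using assms by (simp add: w_\<sigma> w_rv algebra_simps)
qed

text \<open>With exponent -2 the general formula \<open>z_i^c z_j\<close> becomes
  \<open>1/z_i\<close> for \<open>j = i\<close>, so \<open>\<tau>\<close> has no separate clause for
  the coordinate along the edge.\<close>

lemma cc_self: assumes "k < m" shows "cc k i i = -2"
proof -
  have "- w k i = w k i + of_int (cc k i i) *\<^sub>R w k i"
    using w_\<sigma>[OF assms, of i i] w_rv[OF assms, of i] \<sigma>_self[OF assms, of i] by simp
  then have "w k i + (w k i + of_int (cc k i i) *\<^sub>R w k i) = 0" unfolding neg_eq_iff_add_eq_0 .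
  then have "(2 + of_int (cc k i i)) *\<^sub>R w k i = 0" by (simp add: algebra_simps scaleR_2)
  then have "(2 + of_int (cc k i i)) = (0::real)" using w_nonzero[OF assms] by simp
  then show ?thesis by linarith
qed

text \<open>Going along the edge and back restores the weight of \<open>j\<close>; since the weight
  of the edge itself changes sign, the two integers agree. This makes the two gluing maps of an edge
  inverse to each other.\<close>

lemma cc_rev: assumes "k < m" shows "cc (nb k i) (rv k i) (\<sigma> k i j) = cc k i j"
proof -
  have "w k j = (w k j + of_int (cc k i j) *\<^sub>R w k i)
      + of_int (cc (nb k i) (rv k i) (\<sigma> k i j)) *\<^sub>R (- w k i)"
    using w_\<sigma>[OF nb_less[OF assms, of i], of "rv k i" "\<sigma> k i j"]
    by (simp add: assms nb_nb \<sigma>_\<sigma> w_\<sigma> w_rv)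
  then have "of_int (cc k i j - cc (nb k i) (rv k i) (\<sigma> k i j)) *\<^sub>R w k i = 0"
    by (auto simp add: algebra_simps)
  then show ?thesis using w_nonzero[OF assms] by auto
qed

lemma \<sigma>_\<sigma>': "k < m \<Longrightarrow> \<sigma> k i (\<sigma> (nb k i) (rv k i) l) = l"
  using \<sigma>_\<sigma>[OF nb_less, of k i "rv k i" l] by (simp add: nb_nb rv_rv)

text \<open>The two orientations of a loop would be edges at one vertex with opposite weights, hence
  equal by independence, and a weight would be its own negative. Consequently no piece is glued to
  itself.\<close>

lemma nb_neq: assumes "k < m" shows "nb k i \<noteq> k"
proof
  assume *: "nb k i = k"
  then have "w k (rv k i) = (-1) *\<^sub>R w k i" using w_rv[OF assms, of i] by simp
  then have "rv k i = i" by (rule w_dep[OF assms])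
  then have "w k i = - w k i" using w_rv[OF assms, of i] * by simp
  then have "2 *\<^sub>R w k i = 0" unfolding eq_neg_iff_add_eq_0 scaleR_2 .
  then show False using w_nonzero[OF assms] by simp
qed

section \<open>Pieces and gluing maps\<close>

definition W :: "nat \<Rightarrow> 'd \<Rightarrow> ('a \<Rightarrow>\<^sub>L real)" where
  "W k j = (if k < m then w k j else \<mu> (k - m))"

definition I :: "nat set" where
  "I = {..<m + N}"

definition arm :: "'d \<Rightarrow> (complex^'d) set" where
  "arm i = {z. norm (z $ i) < 2 \<and> (\<forall>j. j \<noteq> i \<longrightarrow> norm (z $ j) < 1 / 2)}"

text \<open>All coordinates of an added piece carry the same nonzero weight, so the origin would be
  its only point fixed by the torus; this is why it is removed.\<close>

definition Dom :: "nat \<Rightarrow> (complex^'d) set" where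
  "Dom k = (if k < m then \<Union>i. arm i else if k < m + N then - {0} else {})"

text \<open>Transport along the reversed edge names the source direction \<open>j\<close> that
  becomes the target direction \<open>l\<close>; the new coordinate is the monomial
  \<open>z_i^c z_j\<close> with the exponent \<open>c\<close> belonging to \<open>j\<close>.\<close>

definition \<tau> :: "nat \<Rightarrow> 'd \<Rightarrow> complex^'d \<Rightarrow> complex^'d" where
  "\<tau> k i z = (\<chi> l. (z $ i) powi cc k i (\<sigma> (nb k i) (rv k i) l) * z $ \<sigma> (nb k i) (rv k i) l)"

text \<open>The condition on the image shrinks the collar until \<open>\<tau>\<close> carries it
  onto the collar at the other end: for a nonzero exponent, \<open>z_i^c z_j\<close> can leave the
  arm.\<close>

definition V :: "nat \<Rightarrow> 'd \<Rightarrow> (complex^'d) set" where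
  "V k i = {z \<in> arm i. 1 / 2 < norm (z $ i) \<and> \<tau> k i z \<in> arm (rv k i)}"

definition rel :: "nat \<Rightarrow> complex^'d \<Rightarrow> nat \<Rightarrow> complex^'d \<Rightarrow> bool" where
  "rel k z l u \<longleftrightarrow> (k = l \<and> z = u \<and> z \<in> Dom k) \<or> (k < m \<and> (\<exists>i. l = nb k i \<and> z \<in> V k i \<and> u = \<tau> k i z))"

lemma I_less: "k < m \<Longrightarrow> k \<in> I" and Dom_I: "z \<in> Dom k \<Longrightarrow> k \<in> I"
  by (auto simp: I_def Dom_def split: if_splits)

lemma W_weight: "k \<in> I \<Longrightarrow> W k j \<in> weight_lattice ex"
  by (auto simp: W_def I_def w_weight \<mu>_weight)

lemma W_nonzero: "k \<in> I \<Longrightarrow> W k j \<noteq> 0"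
  by (auto simp: W_def I_def w_nonzero \<mu>_nonzero)

lemma arm_unique: "z \<in> arm i \<Longrightarrow> 1 / 2 \<le> norm (z $ j) \<Longrightarrow> j = i"
  by (force simp: arm_def)

lemma V_unique: "z \<in> V k i \<Longrightarrow> z \<in> V k j \<Longrightarrow> j = i"
  by (auto simp: V_def intro: arm_unique)

lemma arm_subset_Dom: "k < m \<Longrightarrow> arm i \<subseteq> Dom k"
  by (auto simp: Dom_def)

lemma V_subset_arm: "V k i \<subseteq> arm i"
  by (auto simp: V_def)

lemma V_subset_Dom: "k < m \<Longrightarrow> z \<in> V k i \<Longrightarrow> z \<in> Dom k"
  using V_subset_arm arm_subset_Dom by blast

lemma open_arm: "open (arm i)"
proof -
  have "arm i = {z. norm (z $ i) < 2} \<inter> (\<Inter>j\<in>-{i}. {z. norm (z $ j) < 1 / 2})" by (auto simp: arm_def)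
  also have "open \<dots>"
    by (intro open_Int open_INT open_Collect_less continuous_intros ballI) auto
  finally show ?thesis .
qed

lemma open_Dom_model: "open (Dom k)"
  by (auto simp: Dom_def open_arm)

lemma open_coord_nonzero: "open {z :: complex^'d. z $ i \<noteq> 0}"
  by (intro open_Collect_neq continuous_intros)

lemma continuous_\<tau>: "continuous_on {z. z $ i \<noteq> 0} (\<tau> k i)"
  unfolding \<tau>_def by (intro continuous_intros) auto

lemma open_\<tau>_vimage: "open S \<Longrightarrow> open ({z. z $ i \<noteq> 0} \<inter> \<tau> k i -` S)"
  by (rule continuous_open_preimage[OF continuous_\<tau> open_coord_nonzero])

lemma open_V_vimage: assumes "open S" shows "open {z \<in> V k i. \<tau> k i z \<in> S}"
proof -
  have "{z \<in> V k i. \<tau> k i z \<in> S} =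
      arm i \<inter> {z. 1 / 2 < norm (z $ i)} \<inter> ({z. z $ i \<noteq> 0} \<inter> \<tau> k i -` (arm (rv k i) \<inter> S))"
    by (auto simp: V_def)
  also have "open \<dots>"
    by (intro open_Int open_arm open_\<tau>_vimage assms open_Collect_less continuous_intros)
  finally show ?thesis .
qed

lemma open_V: "open (V k i)"
  using open_V_vimage[of UNIV k i] by simp

lemma V_nonzero: "z \<in> V k i \<Longrightarrow> z $ i \<noteq> 0"
  by (auto simp: V_def)

lemma \<tau>_rv: "k < m \<Longrightarrow> z $ i \<noteq> 0 \<Longrightarrow> \<tau> k i z $ rv k i = inverse (z $ i)"
  using \<sigma>_\<sigma>[of k i i] by (simp add: \<tau>_def \<sigma>_self cc_self power_int_minus power2_eq_square)

lemma \<tau>_\<tau>: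
  assumes "k < m" "z $ i \<noteq> 0" shows "\<tau> (nb k i) (rv k i) (\<tau> k i z) = z"
proof (subst vec_eq_iff, rule allI)
  fix j
  have "\<tau> (nb k i) (rv k i) (\<tau> k i z) $ j = inverse (z $ i) powi cc k i j * ((z $ i) powi cc k i j * z $ j)"
    unfolding \<tau>_def[of "nb k i"] using assms
    by (simp add: nb_nb rv_rv \<tau>_rv cc_rev) (simp add: \<tau>_def \<sigma>_\<sigma>)
  then show "\<tau> (nb k i) (rv k i) (\<tau> k i z) $ j = z $ j"
    using assms(2) by (simp add: power_int_inverse)
qed

lemma \<tau>_V:
  assumes "k < m" "z \<in> V k i" shows "\<tau> k i z \<in> V (nb k i) (rv k i)"
  using assms V_nonzero[OF assms(2)]
  by (auto simp: V_def \<tau>_rv \<tau>_\<tau> rv_rv norm_inverse norm_divide arm_def[of i] field_simps)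

lemma rel_cross: "rel k z l u \<Longrightarrow> k \<noteq> l \<Longrightarrow> k < m \<and> l < m \<and> (\<exists>i. l = nb k i \<and> z \<in> V k i \<and> u = \<tau> k i z)"
  by (auto simp: rel_def nb_less)

lemma rel_same: "rel k z k u \<longleftrightarrow> z = u \<and> z \<in> Dom k"
proof -
  have "k \<noteq> nb k i" if "k < m" for i using nb_neq[OF that] by metis
  then show ?thesis by (auto simp: rel_def)
qed

lemma rel_V: "k < m \<Longrightarrow> z \<in> V k i \<Longrightarrow> rel k z l u \<Longrightarrow> (l = k \<and> u = z) \<or> (l = nb k i \<and> u = \<tau> k i z)"
  using V_unique by (auto simp: rel_def)

text \<open>The delicate points are those on the boundary of a collar. If \<open>z $ i\<close> or
  the corresponding coordinate of \<open>u\<close> has modulus below 1/2, collar points stay away.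
  Otherwise both points lie in the arms of the edge, where \<open>\<tau>\<close> is continuous, and
  \<open>u = \<tau> k i z\<close> would put \<open>z\<close> into the open collar.\<close>

lemma rel_separated:
  assumes z: "z \<in> Dom k" and u: "u \<in> Dom l" and "\<not> rel k z l u"
  shows "\<exists>A B. open A \<and> open B \<and> z \<in> A \<and> u \<in> B \<and> (\<forall>z'\<in>A. \<forall>u'\<in>B. \<not> rel k z' l u')"
proof (cases "k = l")
  case True
  then have "z \<noteq> u" using assms by (auto simp: rel_same)
  then obtain A B where "open A" "open B" "z \<in> A" "u \<in> B" "A \<inter> B = {}" using hausdorff[OF \<open>z \<noteq> u\<close>] by blast
  then show ?thesis using True by (intro exI[of _ A] exI[of _ B]) (auto simp: rel_same)
next
  case kl: False
  show ?thesis
  proof (cases "k < m \<and> l < m")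
    case False
    then show ?thesis using rel_cross[of k _ l] kl by (intro exI[of _ UNIV]) blast
  next
    case True
    have "\<exists>A B. open A \<and> open B \<and> z \<in> A \<and> u \<in> B \<and> (\<forall>z'\<in>A. \<forall>u'\<in>B. \<not> (l = nb k i \<and> z' \<in> V k i \<and> u' = \<tau> k i z'))" for i
    proof (cases "l = nb k i")
      case l: True
      consider "norm (z $ i) < 1 / 2" | "norm (u $ rv k i) < 1 / 2" | "norm (z $ i) \<ge> 1 / 2" "norm (u $ rv k i) \<ge> 1 / 2"
        by linarith
      then show ?thesis
      proof cases
        case 1
        then show ?thesis
          by (intro exI[of _ "{z. norm (z $ i) < 1 / 2}"] exI[of _ UNIV])
             (auto simp: V_def intro!: open_Collect_less continuous_intros)
      next
        case 2
        have "norm (u' $ rv k i) \<ge> 1 / 2" if "z' \<in> V k i" "u' = \<tau> k i z'" for z' u'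
          using \<tau>_V[of k z' i] that True by (auto simp: V_def[of "nb k i"])
        then show ?thesis using 2
          by (intro exI[of _ UNIV] exI[of _ "{u. norm (u $ rv k i) < 1 / 2}"])
             (force intro!: open_Collect_less continuous_intros)
      next
        case 3
        have "z \<in> arm i" "u \<in> arm (rv k i)"
          using z u True 3 arm_unique by (auto simp: Dom_def)
        have "z $ i \<noteq> 0" using 3 by auto
        have "\<tau> k i z \<noteq> u"
        proof
          assume eq: "\<tau> k i z = u"
          \<comment> \<open>The strict bound 2 of the other arm excludes the boundary value 1/2 of
            \<open>norm (z $ i)\<close>.\<close>
          then have "norm (inverse (z $ i)) < 2"
            using \<open>u \<in> arm (rv k i)\<close> \<tau>_rv[of k z i] True \<open>z $ i \<noteq> 0\<close> by (auto simp: arm_def)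
          then have "1 / 2 < norm (z $ i)" using \<open>z $ i \<noteq> 0\<close> by (auto simp: norm_inverse norm_divide field_simps)
          then have "z \<in> V k i" using \<open>z \<in> arm i\<close> \<open>u \<in> arm (rv k i)\<close> eq by (simp add: V_def)
          then show False using assms(3) True l eq by (auto simp: rel_def)
        qed
        then obtain A B where "open A" "open B" "\<tau> k i z \<in> A" "u \<in> B" "A \<inter> B = {}" using hausdorff[OF \<open>\<tau> k i z \<noteq> u\<close>] by blast
        then show ?thesis using \<open>z $ i \<noteq> 0\<close>
          by (intro exI[of _ "{z. z $ i \<noteq> 0} \<inter> \<tau> k i -` A"] exI[of _ B]) (auto simp: open_\<tau>_vimage)
      qed
    qed auto
    then obtain A B where AB: "\<And>i. open (A i)" "\<And>i. open (B i)" "\<And>i. z \<in> A i" "\<And>i. u \<in> B i"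
      "\<And>i z' u'. z' \<in> A i \<Longrightarrow> u' \<in> B i \<Longrightarrow> \<not> (l = nb k i \<and> z' \<in> V k i \<and> u' = \<tau> k i z')" by metis
    \<comment> \<open>Several edges may join the same two pieces, so the neighbourhoods for all
      \<open>i\<close> are intersected.\<close>
    show ?thesis
      by (intro exI[of _ "\<Inter>i. A i"] exI[of _ "\<Inter>i. B i"]) (use AB kl in \<open>auto simp: rel_def\<close>)
  qed
qed

sublocale gluing I Dom rel
proof
  fix k l j z u v and S :: "(complex^'d) set"
  show "open (Dom k)" by (rule open_Dom_model)
  show "k \<in> I \<Longrightarrow> z \<in> Dom k \<Longrightarrow> rel k z k z" by (simp add: rel_same)
  show sym: "rel l u k z" if "rel k z l u"
  proof (cases "k = l")
    case True
    then show ?thesis using that by (auto simp: rel_same)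
  next
    case False
    from rel_cross[OF that this] obtain i where "k < m" "l < m" "l = nb k i" "z \<in> V k i" "u = \<tau> k i z" by blast
    then have "u \<in> V l (rv k i)" "nb l (rv k i) = k" "\<tau> l (rv k i) u = z"
      using \<tau>_V \<tau>_\<tau> V_nonzero nb_nb by auto
    then show ?thesis using \<open>l < m\<close> unfolding rel_def by metis
  qed
  show "k \<in> I \<and> l \<in> I \<and> z \<in> Dom k \<and> u \<in> Dom l" if "rel k z l u"
  proof -
    have "z \<in> Dom k" if "rel k z l u" for k z l u
      using that V_subset_Dom by (auto simp: rel_def)
    then show ?thesis using that sym Dom_I by blast
  qed
  show "rel k z j v" if "rel k z l u" "rel l u j v"
  proof (cases "k = l")
    case True
    then show ?thesis using that rel_same by metis
  next
    case False
    from rel_cross[OF that(1) this] obtain i where i: "k < m" "l = nb k i" "z \<in> V k i" "u = \<tau> k i z" by blast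
    \<comment> \<open>A point of a collar has exactly two representatives, itself and its image, so
      a chain of two identifications either stops at \<open>u\<close> or returns to
      \<open>z\<close>.\<close>
    have "u \<in> V l (rv k i)" "l < m" using i \<tau>_V nb_less by auto
    from rel_V[OF this(2,1) that(2)] show ?thesis
      using that(1) i V_subset_Dom[OF i(1,3)] \<tau>_\<tau>[OF i(1) V_nonzero[OF i(3)]]
      by (auto simp: rel_same nb_nb)
  qed
  show "z = u" if "rel k z k u" using that by (simp add: rel_same)
  show "open {z. \<exists>u\<in>S. rel k z l u}" if "open S"
  proof -
    have "{z. \<exists>u\<in>S. rel k z l u} = (if k = l then S \<inter> Dom k else {}) \<union>
        (if k < m then \<Union>i\<in>{i. nb k i = l}. {z \<in> V k i. \<tau> k i z \<in> S} else {})"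
      by (auto simp: rel_def) metis
    also have "open \<dots>"
      using that open_V_vimage open_Dom_model by (simp add: open_Un open_Int open_UN)
    finally show ?thesis .
  qed
  show "\<exists>A B. open A \<and> open B \<and> z \<in> A \<and> u \<in> B \<and> (\<forall>z'\<in>A. \<forall>u'\<in>B. \<not> rel k z' l u')"
    if "k \<in> I" "l \<in> I" "z \<in> Dom k" "u \<in> Dom l" "\<not> rel k z l u"
    using that(3-5) by (rule rel_separated)
qed

section \<open>The action on the local model\<close>

definition D :: "nat \<Rightarrow> 'a \<Rightarrow> complex^'d \<Rightarrow> complex^'d" where
  "D k \<xi> z = (\<chi> j. cis (W k j \<xi>) * z $ j)"

text \<open>The diagonal representation as a function of the group element, in whose topology
  continuity is stated; calculations use its pullback \<open>D\<close> along
  \<open>ex\<close>.\<close>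

definition Dg :: "nat \<Rightarrow> 'g \<Rightarrow> complex^'d \<Rightarrow> complex^'d" where
  "Dg k g z = (\<chi> j. character (W k j) g * z $ j)"

text \<open>Acting on all representatives of a class at once avoids a choice; \<open>act_c\<close>
  shows that the result is a class again.\<close>

definition act :: "'g \<Rightarrow> 'd point \<Rightarrow> 'd point" where
  "act g x = (\<lambda>(k, z). (k, Dg k g z)) ` x"

lemma D_nth [simp]: "D k \<xi> z $ j = cis (W k j \<xi>) * z $ j"
  by (simp add: D_def)

lemma Dg_ex: "k \<in> I \<Longrightarrow> Dg k (ex \<xi>) = D k \<xi>"
  by (simp add: fun_eq_iff Dg_def D_def character_ex W_weight)

lemma D_add: "D k (\<xi> + \<eta>) z = D k \<xi> (D k \<eta> z)"
  by (simp add: vec_eq_iff blinfun.add_right cis_mult[symmetric])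

lemma D_0 [simp]: "D k 0 z = z"
  by (simp add: vec_eq_iff)

lemma D_minus [simp]: "D k (- \<xi>) (D k \<xi> z) = z" "D k \<xi> (D k (- \<xi>) z) = z"
  by (simp_all flip: D_add)

lemma D_arm [simp]: "D k \<xi> z \<in> arm i \<longleftrightarrow> z \<in> arm i"
  by (simp add: arm_def norm_mult)

lemma D_zero [simp]: "D k \<xi> 0 = 0"
  by (simp add: vec_eq_iff)

lemma D_zero_iff [simp]: "D k \<xi> z = 0 \<longleftrightarrow> z = 0"
  by (simp add: vec_eq_iff)

lemma D_Dom [simp]: "D k \<xi> z \<in> Dom l \<longleftrightarrow> z \<in> Dom l"
  by (simp add: Dom_def)

lemma \<tau>_D:
  assumes "k < m" shows "\<tau> k i (D k \<xi> z) = D (nb k i) \<xi> (\<tau> k i z)"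
proof (subst vec_eq_iff, rule allI)
  fix l
  define j where "j = \<sigma> (nb k i) (rv k i) l"
  have "w (nb k i) l = w k j + of_int (cc k i j) *\<^sub>R w k i"
    using w_\<sigma>[OF assms, of i j] \<sigma>_\<sigma>'[OF assms, of i l] by (simp add: j_def)
  then have "cis (W (nb k i) l \<xi>) = cis (w k j \<xi>) * cis (of_int (cc k i j) * w k i \<xi>)"
    using nb_less[OF assms] by (simp add: W_def cis_mult plus_blinfun.rep_eq scaleR_blinfun.rep_eq)
  then show "\<tau> k i (D k \<xi> z) $ l = D (nb k i) \<xi> (\<tau> k i z) $ l"
    using assms by (simp add: \<tau>_def W_def power_int_mult_distrib cis_power_int flip: j_def)
qed

lemma D_V [simp]: "k < m \<Longrightarrow> D k \<xi> z \<in> V k i \<longleftrightarrow> z \<in> V k i"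
  by (simp add: V_def \<tau>_D norm_mult)

lemma rel_D: "rel k z l u \<Longrightarrow> rel k (D k \<xi> z) l (D l \<xi> u)"
  unfolding rel_def by (auto simp: \<tau>_D)

lemma act_c:
  assumes "k \<in> I" "z \<in> Dom k"
  shows "act (ex \<xi>) (c k z) = c k (D k \<xi> z)"
proof (intro equalityI subsetI)
  fix p assume "p \<in> act (ex \<xi>) (c k z)"
  then obtain l u where lu: "rel k z l u" "p = (l, Dg l (ex \<xi>) u)" by (auto simp: act_def c_def)
  then show "p \<in> c k (D k \<xi> z)" using rel_D R_dom[OF lu(1)] by (simp add: c_def Dg_ex)
next
  fix p assume "p \<in> c k (D k \<xi> z)"
  then obtain l u where lu: "rel k (D k \<xi> z) l u" "p = (l, u)" by (auto simp: c_def)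
  then have "rel k z l (D l (- \<xi>) u)" "l \<in> I" using rel_D[OF lu(1), of "- \<xi>"] R_dom[OF lu(1)] by auto
  then show "p \<in> act (ex \<xi>) (c k z)"
    by (auto simp: act_def c_def Dg_ex lu(2) intro!: image_eqI[of _ _ "(l, D l (- \<xi>) u)"])
qed

lemma act_0: "x \<in> topspace T \<Longrightarrow> act 0 x = x"
  by (erule topspaceE) (use act_c[of _ _ 0] in simp)

lemma act_topspace: "x \<in> topspace T \<Longrightarrow> act g x \<in> topspace T"
  by (erule topspaceE, rule obtain_log[of g]) (simp add: act_c c_in_topspace)

lemma act_add: "x \<in> topspace T \<Longrightarrow> act (g + h) x = act g (act h x)"
proof (erule topspaceE, rule obtain_log[of g], rule obtain_log[of h])
  fix k z \<xi> \<eta> assume "k \<in> I" "z \<in> Dom k" "x = c k z" "g = ex \<xi>" "h = ex \<eta>"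
  then show ?thesis by (simp add: act_c D_add flip: ex_add)
qed

text \<open>Since chart domains are invariant, the action in any pair of charts is a transition map
  followed by the diagonal map \<open>D\<close>.\<close>

lemma act_U_iff: "x \<in> topspace T \<Longrightarrow> act g x \<in> U l \<longleftrightarrow> x \<in> U l"
proof -
  have *: "act h y \<in> U l" if "l \<in> I" "y \<in> U l" for h y
    using that by (auto simp: U_def, rule_tac obtain_log[of h]) (auto simp: act_c)
  have **: "l \<in> I" if "y \<in> U l" for y using that Dom_I by (auto simp: U_def)
  assume "x \<in> topspace T"
  then have "x = act (- g) (act g x)" using act_add[of x "- g" g] act_0 by simp
  then show ?thesis using * ** by metis
qed

section \<open>Transition maps and regularity of the action\<close>

lemma c_in_U_cases:
  assumes "k \<in> I" "y \<in> Dom k" "c k y \<in> U l"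
  shows "l = k \<or> k < m \<and> (\<exists>i. l = nb k i \<and> y \<in> V k i)"
  using assms c_in_U_iff[OF assms(1,2)] by (auto simp: rel_def)

lemma c_\<tau>: assumes "k < m" "y \<in> V k i" shows "c (nb k i) (\<tau> k i y) = c k y"
proof -
  have "rel k y (nb k i) (\<tau> k i y)" using assms by (auto simp: rel_def)
  then show ?thesis using c_eq_iff I_less V_subset_Dom assms by metis
qed

lemma \<tau>_in_Dom: "k < m \<Longrightarrow> y \<in> V k i \<Longrightarrow> \<tau> k i y \<in> Dom (nb k i)"
  using \<tau>_V V_subset_Dom nb_less by blast

lemma \<phi>_\<tau>: "k < m \<Longrightarrow> y \<in> V k i \<Longrightarrow> \<phi> (nb k i) (c k y) = \<tau> k i y"
  using c_\<tau> \<phi>_c[OF I_less[OF nb_less] \<tau>_in_Dom] by metis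

lemma transition_cases:
  assumes "k \<in> I" "y \<in> Dom k" "c k y \<in> U l"
  obtains "l = k"
  | i where "k < m" "l = nb k i" "y \<in> V k i" "\<And>y'. y' \<in> V k i \<Longrightarrow> y' \<in> Dom k \<and> c k y' \<in> U l \<and> \<phi> l (c k y') = \<tau> k i y'"
proof -
  have "y' \<in> Dom k \<and> c k y' \<in> U (nb k i) \<and> \<phi> (nb k i) (c k y') = \<tau> k i y'" if "k < m" "y' \<in> V k i" for i y'
    using that V_subset_Dom \<phi>_\<tau> c_\<tau> c_in_U[OF \<tau>_in_Dom] by metis
  then show thesis using c_in_U_cases[OF assms] that by metis
qed

text \<open>One statement for two purposes: for \<open>\<xi> = 0\<close> it gives holomorphic
  transition maps, for general \<open>\<xi>\<close> a holomorphic action.\<close>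

lemma in_charts_holo_on:
  assumes f: "\<And>k z. k \<in> I \<Longrightarrow> z \<in> Dom k \<Longrightarrow> f (c k z) = c k (D k \<xi> z)"
  shows "in_charts holo_on A A f"
proof (rule in_charts_A, rule holo_on_local)
  fix k l y
  assume kl: "k \<in> I" "l \<in> I" and "y \<in> {y \<in> Dom k. f (c k y) \<in> U l}"
  then have y: "y \<in> Dom k" "f (c k y) \<in> U l" by auto
  then have cU: "c k y \<in> U l" using act_U_iff[of "c k y" "ex \<xi>" l] kl by (simp add: f act_c c_in_topspace)
  let ?F = "\<lambda>y. \<phi> l (f (inv_into (U k) (\<phi> k) y))"
  have F: "?F y' = D l \<xi> (\<phi> l (c k y'))" if y': "y' \<in> Dom k" "c k y' \<in> U l" for y'
  proof -
    obtain u where "u \<in> Dom l" "c k y' = c l u" using y'(2) by (auto simp: U_def)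
    then show ?thesis using y' kl by (simp add: inv_\<phi> f)
  qed
  from kl(1) y(1) cU show "\<exists>N g. open N \<and> y \<in> N \<and> (\<forall>y\<in>N. ?F y = g y) \<and> holo_on N g"
  proof (cases rule: transition_cases)
    case 1
    have "holo_on (Dom k) (D l \<xi>)"
      by (rule holo_on_componentwise) (simp add: holo_at_mult holo_at_const holo_at_nth)
    moreover have "?F y' = D l \<xi> y'" if "y' \<in> Dom k" for y'
      using F[OF that] that 1 kl c_in_U by simp
    ultimately show ?thesis using open_Dom y
      by (intro exI[of _ "Dom k"] exI[of _ "D l \<xi>"] conjI ballI) simp_all
  next
    case (2 i)
    have "holo_on (V k i) (\<lambda>y. D l \<xi> (\<tau> k i y))"
      by (rule holo_on_componentwise)
         (use V_nonzero in \<open>simp add: \<tau>_def holo_at_mult holo_at_const holo_at_nth holo_at_power_int\<close>)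
    moreover have "?F y' = D l \<xi> (\<tau> k i y')" if "y' \<in> V k i" for y'
      using F 2(4)[OF that] by simp
    ultimately show ?thesis using open_V 2(3)
      by (intro exI[of _ "V k i"] exI[of _ "\<lambda>y. D l \<xi> (\<tau> k i y)"] conjI ballI) simp_all
  qed
qed

lemma complex_manifold: "complex_manifold T A"
  by (rule complex_manifold_T, rule in_charts_holo_on[where \<xi> = 0]) simp

lemma in_charts_holo_on_act: "in_charts holo_on A A (act g)"
proof -
  obtain \<xi> where "g = ex \<xi>" by (rule obtain_log)
  then show ?thesis by (intro in_charts_holo_on[where \<xi> = \<xi>]) (simp add: act_c)
qed

lemma smooth_on_D:
  fixes f :: "'a \<times> (complex^'d) \<Rightarrow> complex^'d"
  assumes "open S" "\<And>j. smooth_on S (\<lambda>p. f p $ j)"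
  shows "smooth_on S (\<lambda>p. D l (fst p) (f p))"
  using assms
  by (intro smooth_on_vec)
     (auto simp: smooth_on_def intro!: Ck_on_mult Ck_on_cis bounded_linear_compose[OF blinfun.bounded_linear_right bounded_linear_fst])

lemma Ck_on_snd_nth: "open S \<Longrightarrow> Ck_on n S (\<lambda>p :: 'a \<times> (complex^'d). snd p $ j)"
  by (intro Ck_on_bounded_linear bounded_linear_compose[OF bounded_linear_vec_nth bounded_linear_snd])

lemma in_charts_smooth_on_act:
  "in_charts smooth_on (prod_charts (log_charts ex) A) A (\<lambda>(g, x). act g x)"
proof -
  have "smooth_on ((\<lambda>(x, y). (inv_into N ex x, \<phi> k y)) ` ((ex ` N \<times> U k) \<inter> (\<lambda>(g, x). act g x) -` U l))
      (\<lambda>y. \<phi> l (case inv_into (ex ` N \<times> U k) (\<lambda>(x, y). (inv_into N ex x, \<phi> k y)) y of (g, x) \<Rightarrow> act g x))"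
    (is "smooth_on ?S ?F")
    if N: "open N" "inj_on ex N" and kl: "k \<in> I" "l \<in> I" for N k l
  proof -
    \<comment> \<open>By invariance of the charts the coordinate domain is a product: the condition
      on \<open>y\<close> does not involve \<open>\<xi>\<close>.\<close>
    have S: "?S = N \<times> {y \<in> Dom k. c k y \<in> U l}"
    proof (intro equalityI subsetI)
      fix p assume "p \<in> ?S"
      then show "p \<in> N \<times> {y \<in> Dom k. c k y \<in> U l}"
        using N kl by (auto simp: U_def[of k] act_U_iff c_in_topspace)
    next
      fix p assume "p \<in> N \<times> {y \<in> Dom k. c k y \<in> U l}"
      then show "p \<in> ?S"
        using N kl by (auto simp: act_U_iff c_in_topspace c_in_U intro!: image_eqI[of _ _ "(ex (fst p), c k (snd p))"])
    qed
    have inv: "inv_into (ex ` N \<times> U k) (\<lambda>(x, y). (inv_into N ex x, \<phi> k y)) (\<xi>, y) = (ex \<xi>, c k y)"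
      if "\<xi> \<in> N" "y \<in> Dom k" for \<xi> y
      by (rule inv_into_f_eq) (use N kl that in \<open>auto simp: inj_on_def U_def\<close>)
    have F: "?F (\<xi>, y) = D l \<xi> (\<phi> l (c k y))" if y: "\<xi> \<in> N" "y \<in> Dom k" "c k y \<in> U l" for \<xi> y
    proof -
      obtain u where "u \<in> Dom l" "c k y = c l u" using y(3) by (auto simp: U_def)
      then show ?thesis using inv[OF y(1,2)] kl by (simp add: act_c)
    qed
    show ?thesis unfolding S
    proof (rule smooth_on_local)
      fix p assume p: "p \<in> N \<times> {y \<in> Dom k. c k y \<in> U l}"
      then obtain \<xi> y where y: "p = (\<xi>, y)" "\<xi> \<in> N" "y \<in> Dom k" "c k y \<in> U l" by auto
      from kl(1) y(3,4) show "\<exists>O' g. open O' \<and> p \<in> O' \<and> O' \<subseteq> N \<times> {y \<in> Dom k. c k y \<in> U l} \<and> (\<forall>q\<in>O'. ?F q = g q) \<and> smooth_on O' g"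
      proof (cases rule: transition_cases)
        case 1
        have "open (N \<times> Dom k)" by (intro open_Times N open_Dom)
        moreover have "smooth_on (N \<times> Dom k) (\<lambda>p. D l (fst p) (snd p))"
          using \<open>open (N \<times> Dom k)\<close> by (intro smooth_on_D) (auto simp: smooth_on_def intro: Ck_on_snd_nth)
        moreover have "?F q = D l (fst q) (snd q)" if "q \<in> N \<times> Dom k" for q
          using F[of "fst q" "snd q"] that 1 kl c_in_U[of "snd q" k] by auto
        moreover have "N \<times> Dom k \<subseteq> N \<times> {y \<in> Dom k. c k y \<in> U l}" using 1 c_in_U by auto
        ultimately show ?thesis using y
          by (intro exI[of _ "N \<times> Dom k"] exI[of _ "\<lambda>p. D l (fst p) (snd p)"] conjI) auto
      next
        case (2 i)
        have op: "open (N \<times> V k i)" by (intro open_Times N open_V)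
        moreover have "smooth_on (N \<times> V k i) (\<lambda>p. D l (fst p) (\<tau> k i (snd p)))"
          using op V_nonzero by (intro smooth_on_D)
            (auto simp: smooth_on_def \<tau>_def intro!: Ck_on_snd_nth Ck_on_mult Ck_on_power_int)
        moreover have "?F q = D l (fst q) (\<tau> k i (snd q))" if "q \<in> N \<times> V k i" for q
          using F[of "fst q" "snd q"] that 2(4)[of "snd q"] by auto
        moreover have "N \<times> V k i \<subseteq> N \<times> {y \<in> Dom k. c k y \<in> U l}" using 2(4) by auto
        ultimately show ?thesis using y 2(3)
          by (intro exI[of _ "N \<times> V k i"] exI[of _ "\<lambda>p. D l (fst p) (\<tau> k i (snd p))"] conjI) auto
      qed
    qed
  qed
  then show ?thesis
    unfolding in_charts_def prod_charts_def log_charts_def A_def by auto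
qed

lemma continuous_Dg: "k \<in> I \<Longrightarrow> continuous_on UNIV (\<lambda>(g, z). Dg k g z)"
proof -
  assume k: "k \<in> I"
  have "continuous_on UNIV (\<lambda>p :: 'g \<times> (complex^'d). character (W k j) (fst p))" for j
    by (rule continuous_on_compose2[OF continuous_character[OF W_weight[OF k]]]) (auto intro: continuous_intros)
  then show ?thesis unfolding Dg_def case_prod_unfold by (intro continuous_intros)
qed

text \<open>Each orbit stays in one piece, where joint continuity is continuity of the characters on
  the group.\<close>

lemma continuous_map_act: "continuous_map (prod_topology euclidean T) T (\<lambda>(g, x). act g x)"
  unfolding continuous_map_def
proof (intro conjI allI impI)
  show "(\<lambda>(g, x). act g x) \<in> topspace (prod_topology euclidean T) \<rightarrow> topspace T"
    using act_topspace by auto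
  fix O' assume O': "openin T O'"
  show "openin (prod_topology euclidean T) {p \<in> topspace (prod_topology euclidean T). (case p of (g, x) \<Rightarrow> act g x) \<in> O'}"
    (is "openin _ ?P")
  proof (subst openin_subopen, intro ballI)
    fix p assume "p \<in> ?P"
    then obtain g x where p: "p = (g, x)" "x \<in> topspace T" "act g x \<in> O'" by auto
    then obtain k z where k: "k \<in> I" "z \<in> Dom k" "x = c k z" using topspaceE by metis
    have act: "act h (c k y) = c k (Dg k h y)" and DomDg: "Dg k h y \<in> Dom k" if "y \<in> Dom k" for h y
      by (rule obtain_log[of h], use that k in \<open>simp add: act_c Dg_ex\<close>)+
    let ?Q = "(UNIV \<times> Dom k) \<inter> (\<lambda>(g, z). Dg k g z) -` {z \<in> Dom k. c k z \<in> O'}"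
    have "open ?Q"
      using open_vimage[OF open_preimage[OF O' k(1)] continuous_Dg[OF k(1)]]
      by (intro open_Int open_Times open_UNIV open_Dom)
    moreover have "(g, z) \<in> ?Q" using k p act DomDg by auto
    ultimately obtain B C where BC: "open B" "open C" "(g, z) \<in> B \<times> C" "B \<times> C \<subseteq> ?Q" by (rule open_prod_elim)
    then have "C \<subseteq> Dom k" by auto
    have "openin (prod_topology euclidean T) (B \<times> c k ` C)"
      using BC openin_c[OF k(1) BC(2) \<open>C \<subseteq> Dom k\<close>] by (auto simp: openin_prod_Times_iff)
    moreover have "B \<times> c k ` C \<subseteq> ?P"
    proof
      fix q assume "q \<in> B \<times> c k ` C"
      then obtain h y where q: "q = (h, c k y)" "(h, y) \<in> B \<times> C" by auto
      then have "(h, y) \<in> ?Q" using BC(4) by blast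
      then show "q \<in> ?P" using q act k c_in_topspace by auto
    qed
    moreover have "p \<in> B \<times> c k ` C" using p k BC by auto
    ultimately show "\<exists>S. openin (prod_topology euclidean T) S \<and> p \<in> S \<and> S \<subseteq> ?P" by blast
  qed
qed

section \<open>Faithfulness, fixed points and isotropy weights\<close>

lemma faithful:
  assumes "\<forall>x\<in>topspace T. act g x = x" shows "g = 0"
proof -
  obtain \<xi> where \<xi>: "g = ex \<xi>" by (rule obtain_log)
  have "cis (\<mu> k \<xi>) = 1" if "k < N" for k
  proof -
    \<comment> \<open>If the point of an added piece with all coordinates 1 is fixed, the character
      with weight \<open>\<mu> k\<close> is trivial at \<open>g\<close>.\<close>
    have k: "m + k \<in> I" and z: "(\<chi> j. 1) \<in> Dom (m + k)" using that by (auto simp: I_def Dom_def vec_eq_iff)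
    have "c (m + k) (D (m + k) \<xi> (\<chi> j. 1)) = c (m + k) (\<chi> j. 1)"
      using assms \<xi> act_c[OF k z, of \<xi>] c_in_topspace[OF k z] by simp
    then have "D (m + k) \<xi> (\<chi> j. 1) = (\<chi> j. 1)"
      by (rule inj_onD[OF inj_on_c[OF k]]) (simp_all add: z)
    then have "D (m + k) \<xi> (\<chi> j. 1) $ i = 1" for i by simp
    then show ?thesis by (simp add: W_def)
  qed
  then show ?thesis using \<xi> \<mu>_separating by blast
qed

lemma zero_in_Dom: "k < m \<Longrightarrow> 0 \<in> Dom k"
  by (auto simp: Dom_def arm_def)

lemma fixed_points_eq: "fixed_points T act UNIV = (\<lambda>k. c k 0) ` {..<m}"
proof (intro equalityI subsetI)
  fix x assume "x \<in> fixed_points T act UNIV"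
  then have "x \<in> topspace T" and fixed: "\<And>\<xi>. act (ex \<xi>) x = x" by (auto simp: fixed_points_def)
  then obtain k z where k: "k \<in> I" "z \<in> Dom k" "x = c k z" by (auto elim: topspaceE)
  have "c k (D k \<xi> z) = c k z" for \<xi> using fixed k act_c by metis
  then have D: "D k \<xi> z = z" for \<xi>
    by (rule inj_onD[OF inj_on_c[OF k(1)]]) (simp_all add: k)
  have "z $ j = 0" for j
  proof -
    obtain \<xi> where \<xi>: "W k j \<xi> \<noteq> 0" using W_nonzero[OF k(1)] by (metis blinfun_eqI zero_blinfun.rep_eq)
    \<comment> \<open>The scaling gives the weight the value pi, so the coordinate changes
      sign.\<close>
    have "cis (W k j ((pi / W k j \<xi>) *\<^sub>R \<xi>)) * z $ j = z $ j" by (metis D D_nth)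
    then show ?thesis using \<xi> by (simp add: blinfun.scaleR_right)
  qed
  then have "z = 0" by (simp add: vec_eq_iff)
  then show "x \<in> (\<lambda>k. c k 0) ` {..<m}" using k by (auto simp: Dom_def split: if_splits)
next
  fix x assume "x \<in> (\<lambda>k. c k 0) ` {..<m}"
  then obtain k where k: "k < m" "x = c k 0" by auto
  have "act g x = x" for g
    by (rule obtain_log[of g]) (use k act_c[OF I_less[OF k(1)] zero_in_Dom[OF k(1)]] in simp)
  then show "x \<in> fixed_points T act UNIV"
    using k c_in_topspace[OF I_less zero_in_Dom] by (simp add: fixed_points_def)
qed

text \<open>A vertex lies in no collar, hence in a single chart; conditions quantified over all
  charts at a fixed point reduce to that chart.\<close>

lemma c_zero_in_U_iff: "k < m \<Longrightarrow> c k 0 \<in> U l \<longleftrightarrow> l = k"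
  using c_in_U_cases[of k 0 l] zero_in_Dom c_in_U V_nonzero I_less by fastforce

lemma inj_on_c_zero: "inj_on (\<lambda>k. c k 0) {..<m}"
  by (rule inj_onI) (metis c_in_U c_zero_in_U_iff lessThan_iff zero_in_Dom)

lemma charts_at_zero: "k < m \<Longrightarrow> (U', \<phi>') \<in> A \<Longrightarrow> c k 0 \<in> U' \<Longrightarrow> U' = U k \<and> \<phi>' = \<phi> k"
  by (auto simp: A_def c_zero_in_U_iff)

lemma linear_D: "linear (D k \<xi>)"
  by (rule linearI) (auto simp: vec_eq_iff algebra_simps)

lemma isotropy_eq: assumes "k < m" shows "isotropy act (U k) (\<phi> k) (c k 0) (ex \<xi>) = D k \<xi>"
proof -
  have "(D k \<xi> has_derivative D k \<xi>) (at 0)"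
    using linear_D by (intro bounded_linear_imp_has_derivative) (simp add: linear_conv_bounded_linear)
  then have "((\<lambda>y. \<phi> k (act (ex \<xi>) (inv_into (U k) (\<phi> k) y))) has_derivative D k \<xi>) (at 0)"
    by (rule has_derivative_transform_within_open[OF _ open_Dom zero_in_Dom[OF assms]])
       (use assms I_less in \<open>simp add: inv_\<phi> act_c\<close>)
  then show ?thesis using assms I_less zero_in_Dom
    by (simp add: isotropy_def has_derivative_frechet)
qed

lemma isotropy_weights_w:
  assumes "k < m" shows "isotropy_weights ex A act (c k 0) (w k)"
  unfolding isotropy_weights_def
proof (intro ballI, clarify)
  fix U' \<phi>' assume "(U', \<phi>') \<in> A" "c k 0 \<in> U'"
  from charts_at_zero[OF assms this] have [simp]: "U' = U k" "\<phi>' = \<phi> k" by auto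
  let ?b = "\<lambda>i. axis i 1 :: complex^'d"
  have "inj ?b" by (rule injI) (simp add: axis_eq_axis)
  moreover have "vec.independent (range ?b)"
    using vec.independent_mono[OF independent_cart_basis] by (auto simp: cart_basis_def full_SetCompr_eq)
  moreover have "D k \<xi> (?b i) = cis (w k i \<xi>) *s ?b i" for i \<xi>
    using assms by (auto simp: vec_eq_iff axis_def W_def)
  ultimately show "\<exists>b. inj b \<and> vec.independent (range b) \<and>
      (\<forall>i \<xi>. isotropy act U' \<phi>' (c k 0) (ex \<xi>) (b i) = cis (w k i \<xi>) *s b i)"
    using assms by (intro exI[of _ ?b]) (simp add: isotropy_eq)
qed

lemma cis_blinfun_eqD:
  fixes \<beta> \<gamma> :: "'a \<Rightarrow>\<^sub>L real"
  assumes "\<And>\<xi>. cis (\<beta> \<xi>) = cis (\<gamma> \<xi>)" shows "\<beta> = \<gamma>"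
proof (rule ccontr)
  assume "\<beta> \<noteq> \<gamma>"
  then obtain \<xi> where \<xi>: "(\<beta> - \<gamma>) \<xi> \<noteq> 0" by (metis blinfun_eqI zero_blinfun.rep_eq right_minus_eq)
  define \<eta> where "\<eta> = (pi / (\<beta> - \<gamma>) \<xi>) *\<^sub>R \<xi>"
  have "(\<beta> - \<gamma>) \<eta> = pi" using \<xi> by (simp add: \<eta>_def blinfun.scaleR_right)
  moreover have "cis ((\<beta> - \<gamma>) \<eta>) = cis (\<beta> \<eta>) / cis (\<gamma> \<eta>)" by (simp add: cis_divide minus_blinfun.rep_eq)
  ultimately show False using assms[of \<eta>] by simp
qed

text \<open>In an eigenbasis, a nonzero \<open>j\<close>-th entry of \<open>b i\<close> forces
  \<open>v i = w k j\<close>. Each \<open>b i\<close> has a nonzero entry, and since the basis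
  spans, each \<open>j\<close> is the place of a nonzero entry of some \<open>b i\<close>.\<close>

lemma range_isotropy_weights:
  assumes "k < m" and v: "isotropy_weights ex A act (c k 0) v"
  shows "range v = range (w k)"
proof -
  have "(U k, \<phi> k) \<in> A" "c k 0 \<in> U k" using assms I_less c_in_U zero_in_Dom by (auto simp: A_def)
  then obtain b :: "'d \<Rightarrow> complex^'d" where b: "inj b" "vec.independent (range b)"
    "\<And>i \<xi>. D k \<xi> (b i) = cis (v i \<xi>) *s b i"
    using v isotropy_eq[OF assms(1)] unfolding isotropy_weights_def by fastforce
  have eq: "v i = w k j" if "b i $ j \<noteq> 0" for i j
  proof (rule cis_blinfun_eqD)
    fix \<xi>
    have "cis (w k j \<xi>) * b i $ j = cis (v i \<xi>) * b i $ j"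
      using b(3)[of \<xi> i] assms(1) by (simp add: vec_eq_iff W_def)
    then show "cis (v i \<xi>) = cis (w k j \<xi>)" using that by simp
  qed
  have "\<exists>j. b i $ j \<noteq> 0" for i
  proof (rule ccontr)
    assume "\<not> (\<exists>j. b i $ j \<noteq> 0)"
    then have "b i = 0" by (simp add: vec_eq_iff)
    then show False using b(2) vec.dependent_zero by (metis rangeI)
  qed
  then have "range v \<subseteq> range (w k)" using eq by fastforce
  moreover have "range (w k) \<subseteq> range v"
  proof (rule ccontr)
    assume "\<not> range (w k) \<subseteq> range v"
    then obtain j where "w k j \<notin> range v" by auto
    then have "b i $ j = 0" for i using eq by (metis rangeI)
    then have "range b \<subseteq> {z. z $ j = 0}" by auto
    moreover have "vec.subspace {z :: complex^'d. z $ j = 0}" by (auto simp: vec.subspace_def)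
    ultimately have "vec.span (range b) \<subseteq> {z. z $ j = 0}" by (rule vec.span_minimal)
    moreover have "vec.dim (range b) = vec.dim (UNIV :: (complex^'d) set)"
      using b(1,2) by (simp add: vec.dim_eq_card_independent card_image vec.dim_UNIV card_cart_basis)
    then have "vec.span (range b) = UNIV" using vec.dim_eq_span[of "range b" UNIV] by simp
    ultimately have "axis j 1 \<in> {z :: complex^'d. z $ j = 0}" by blast
    then show False by simp
  qed
  ultimately show ?thesis by blast
qed

lemma gkm_action: "gkm_action ex T A act"
  unfolding gkm_action_def
proof (intro conjI)
  show "\<forall>x\<in>topspace T. act 0 x = x" using act_0 by blast
  show "\<forall>g h. \<forall>x\<in>topspace T. act (g + h) x = act g (act h x)" using act_add by blast
  show "smooth_map (prod_topology euclidean T) (prod_charts (log_charts ex) A) T A (\<lambda>(g, x). act g x)"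
    by (simp add: smooth_map_def continuous_map_act in_charts_smooth_on_act)
  show "\<forall>g. in_charts holo_on A A (act g)" using in_charts_holo_on_act by blast
  show "\<forall>g. (\<forall>x\<in>topspace T. act g x = x) \<longrightarrow> g = 0" using faithful by blast
  show "finite (fixed_points T act UNIV)" by (simp add: fixed_points_eq)
  show "\<forall>p\<in>fixed_points T act UNIV. \<exists>w. isotropy_weights ex A act p w \<and> pairwise_independent UNIV w"
    using isotropy_weights_w w_indep by (auto simp: fixed_points_eq)
qed

section \<open>The invariant spheres of the model\<close>

definition Ax :: "'d \<Rightarrow> (complex^'d) set" where
  "Ax i = axis i ` ball 0 2"

text \<open>Two discs overlapping in an annulus, with inversion as the transition: a projective
  line.\<close>

definition Sph :: "nat \<Rightarrow> 'd \<Rightarrow> 'd point set" where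
  "Sph k i = c k ` Ax i \<union> c (nb k i) ` Ax (rv k i)"

lemma axis_in_arm: "axis i t \<in> arm i \<longleftrightarrow> norm t < 2"
  by (auto simp: arm_def axis_def)

lemma axis_in_Dom: "k < m \<Longrightarrow> norm t < 2 \<Longrightarrow> axis i t \<in> Dom k"
  using axis_in_arm arm_subset_Dom by blast

lemma Ax_subset_Dom: "k < m \<Longrightarrow> Ax i \<subseteq> Dom k"
  by (auto simp: Ax_def axis_in_Dom)

lemma Ax_iff: "k < m \<Longrightarrow> z \<in> Dom k \<Longrightarrow> z \<in> Ax i \<longleftrightarrow> (\<forall>j. j \<noteq> i \<longrightarrow> z $ j = 0)"
proof -
  assume "k < m" "z \<in> Dom k"
  then obtain i' where "z \<in> arm i'" by (auto simp: Dom_def)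
  then have "norm (z $ i) < 2" by (cases "i = i'") (auto simp: arm_def intro: less_trans)
  moreover have "z = axis i (z $ i)" if "\<forall>j. j \<noteq> i \<longrightarrow> z $ j = 0" using that by (auto simp: vec_eq_iff axis_def)
  ultimately show ?thesis by (auto simp: Ax_def) (auto simp: axis_def)
qed

lemma \<tau>_axis: assumes "k < m" "t \<noteq> 0" shows "\<tau> k i (axis i t) = axis (rv k i) (inverse t)"
proof -
  have "\<sigma> (nb k i) (rv k i) l = i \<longleftrightarrow> l = rv k i" for l
    using \<sigma>_\<sigma>[OF assms(1), of i i] \<sigma>_\<sigma>'[OF assms(1), of i l] \<sigma>_self[OF assms(1), of i] by auto
  then have "\<tau> k i (axis i t) $ l = axis (rv k i) (inverse t) $ l" for l
    using \<tau>_rv[OF assms(1), of "axis i t" i] assms(2) by (cases "l = rv k i") (auto simp: \<tau>_def axis_def)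
  then show ?thesis by (simp add: vec_eq_iff)
qed

lemma axis_in_V:
  assumes "k < m" shows "axis i t \<in> V k i \<longleftrightarrow> 1 / 2 < norm t \<and> norm t < 2"
proof (cases "t = 0")
  case False
  then show ?thesis
    using assms by (auto simp: V_def \<tau>_axis axis_in_arm norm_inverse norm_divide field_simps)
qed (auto dest: V_nonzero)

lemma axis_in_V_imp: "axis i t \<in> V k j \<Longrightarrow> j = i"
  using V_nonzero by (fastforce simp: axis_def split: if_splits)

lemma c_axis_flip:
  assumes "k < m" "1 / 2 < norm t" "norm t < 2"
  shows "c k (axis i t) = c (nb k i) (axis (rv k i) (inverse t))"
proof -
  have "t \<noteq> 0" using assms(2) by auto
  have "axis i t \<in> V k i" using assms by (simp add: axis_in_V)
  from c_\<tau>[OF assms(1) this] show ?thesis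
    unfolding \<tau>_axis[OF assms(1) \<open>t \<noteq> 0\<close>] by (rule sym)
qed

lemma Sph_rv: "k < m \<Longrightarrow> Sph (nb k i) (rv k i) = Sph k i"
  by (auto simp: Sph_def nb_nb rv_rv)

lemma zero_in_Ax: "0 \<in> Ax i"
  by (auto simp: Ax_def intro!: image_eqI[of _ _ 0])

lemma c_zero_in_Sph: "c k 0 \<in> Sph k i" "c (nb k i) 0 \<in> Sph k i"
  using zero_in_Ax by (auto simp: Sph_def)

lemma Sph_Int_fixed:
  assumes "k < m" shows "Sph k i \<inter> fixed_points T act UNIV = {c k 0, c (nb k i) 0}"
proof -
  have *: "l = k" if "c l 0 \<in> c k ` Ax i" "l < m" "k < m" for k l i
  proof -
    have "c l 0 \<in> U k" using that Ax_subset_Dom by (auto simp: U_def)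
    then show ?thesis using c_zero_in_U_iff[of l k] that by simp
  qed
  show ?thesis
  proof (intro equalityI subsetI)
    fix x assume "x \<in> Sph k i \<inter> fixed_points T act UNIV"
    then obtain l where "l < m" "x = c l 0" "c l 0 \<in> Sph k i" by (auto simp: fixed_points_eq)
    then have "l = k \<or> l = nb k i" using *[of l k i] *[of l "nb k i" "rv k i"] assms nb_less by (auto simp: Sph_def)
    then show "x \<in> {c k 0, c (nb k i) 0}" using \<open>x = c l 0\<close> by auto
  next
    fix x assume "x \<in> {c k 0, c (nb k i) 0}"
    then show "x \<in> Sph k i \<inter> fixed_points T act UNIV"
      using c_zero_in_Sph[of k i] assms nb_less[OF assms] by (auto simp: fixed_points_eq)
  qed
qed

lemma c_nb_zero_neq: "k < m \<Longrightarrow> c k 0 \<noteq> c (nb k i) 0"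
  using inj_on_c_zero nb_less nb_neq by (metis inj_on_def lessThan_iff)

lemma act_Sph: assumes "k < m" shows "act g ` Sph k i = Sph k i"
proof -
  have *: "act g (c k (axis i t)) \<in> c k ` Ax i" if "k < m" "norm t < 2" for g k i t
  proof (rule obtain_log[of g])
    fix \<xi> assume g: "g = ex \<xi>"
    have "D k \<xi> (axis i t) = axis i (cis (W k i \<xi>) * t)" by (auto simp: vec_eq_iff axis_def)
    then have "act g (c k (axis i t)) = c k (axis i (cis (W k i \<xi>) * t))"
      using g act_c[of k "axis i t" \<xi>] axis_in_Dom that I_less by simp
    then show ?thesis using that by (auto simp: Ax_def norm_mult)
  qed
  have sub: "act g ` Sph k i \<subseteq> Sph k i" for g
    using *[OF assms] *[OF nb_less[OF assms]] by (fastforce simp: Sph_def Ax_def)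
  have top: "Sph k i \<subseteq> topspace T"
    using assms nb_less[OF assms] Ax_subset_Dom c_in_topspace I_less by (fastforce simp: Sph_def)
  show ?thesis
  proof (rule equalityI[OF sub], rule subsetI)
    fix x assume x: "x \<in> Sph k i"
    then have "x = act g (act (- g) x)" using top act_add[of x g "- g"] act_0 by auto
    moreover have "act (- g) x \<in> Sph k i" using sub x by blast
    ultimately show "x \<in> act g ` Sph k i" by blast
  qed
qed

lemma fixed_kernel_iff:
  assumes l: "l < m" and \<beta>: "\<beta> = w l j \<or> \<beta> = - w l j" and z: "z \<in> Dom l"
  shows "c l z \<in> fixed_points T act (character_kernel0 ex \<beta>) \<longleftrightarrow> z \<in> Ax j"
proof
  assume fixed: "c l z \<in> fixed_points T act (character_kernel0 ex \<beta>)"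
  have "z $ j' = 0" if ne: "j' \<noteq> j" for j'
  proof -
    obtain \<xi> where \<xi>: "w l j \<xi> = 0" "w l j' \<xi> = 1" using w_dual[OF l ne[symmetric]] by blast
    have "ex (pi *\<^sub>R \<xi>) \<in> character_kernel0 ex \<beta>"
      using \<beta> \<xi> by (intro ex_in_character_kernel0) (auto simp: blinfun.scaleR_right uminus_blinfun.rep_eq)
    then have "c l (D l (pi *\<^sub>R \<xi>) z) = c l z" using fixed act_c[OF I_less[OF l] z, of "pi *\<^sub>R \<xi>"] by (simp add: fixed_points_def)
    then have "D l (pi *\<^sub>R \<xi>) z = z"
      by (rule inj_onD[OF inj_on_c[OF I_less[OF l]]]) (simp_all add: z)
    then have "D l (pi *\<^sub>R \<xi>) z $ j' = z $ j'" by simp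
    then show ?thesis using \<xi> l by (simp add: W_def blinfun.scaleR_right)
  qed
  then show "z \<in> Ax j" using Ax_iff[OF l z] by blast
next
  assume "z \<in> Ax j"
  then obtain t where t: "z = axis j t" by (auto simp: Ax_def)
  have "act g (c l z) = c l z" if g: "g \<in> character_kernel0 ex \<beta>" for g
  proof -
    obtain \<xi> where \<xi>: "g = ex \<xi>" "cis (\<beta> \<xi>) = 1" using character_kernel0_subset g by blast
    then have "cis (w l j \<xi>) = 1" using \<beta> by (auto simp: uminus_blinfun.rep_eq complex_eq_iff)
    then have "D l \<xi> z = z" using l t by (auto simp: vec_eq_iff axis_def W_def)
    then show ?thesis using \<xi> act_c[OF I_less[OF l] z] by simp
  qed
  then show "c l z \<in> fixed_points T act (character_kernel0 ex \<beta>)"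
    using c_in_topspace[OF I_less[OF l] z] by (simp add: fixed_points_def)
qed

lemma fixed_kernel_Int_U:
  assumes "l < m" "\<beta> = w l j \<or> \<beta> = - w l j"
  shows "fixed_points T act (character_kernel0 ex \<beta>) \<inter> U l = c l ` Ax j"
  using fixed_kernel_iff[OF assms] Ax_subset_Dom[OF assms(1)] unfolding U_def by blast

lemma Sph_eq_fixed:
  assumes "k < m"
  shows "Sph k i = fixed_points T act (character_kernel0 ex (w k i)) \<inter> (U k \<union> U (nb k i))"
  using fixed_kernel_Int_U[OF assms, of "w k i" i] fixed_kernel_Int_U[OF nb_less[OF assms], of "w k i" i "rv k i"]
    w_rv[OF assms, of i] by (auto simp: Sph_def)

lemma Sph_Int_U: "k < m \<Longrightarrow> Sph k i \<inter> U k = c k ` Ax i"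
  using Sph_eq_fixed[of k i] fixed_kernel_Int_U[of k "w k i" i] by blast

section \<open>Topology of the spheres and their tangent weights\<close>

lemma continuous_axis: "continuous_on S (axis i :: complex \<Rightarrow> complex^'d)"
  by (rule linear_continuous_on[OF bounded_linear_axis])

lemma continuous_map_c_axis:
  assumes "k < m" shows "continuous_map (top_of_set (ball 0 2)) T (\<lambda>t. c k (axis i t))"
proof -
  have "continuous_map (top_of_set (ball 0 2)) (top_of_set (Dom k)) (axis i)"
    using axis_in_Dom[OF assms] by (auto simp: continuous_axis)
  from continuous_map_compose[OF this continuous_map_c[OF I_less[OF assms]]] show ?thesis by (simp add: o_def)
qed

lemma compactin_c_axis:
  assumes "k < m" "r < 2" shows "compactin T ((\<lambda>t. c k (axis i t)) ` cball 0 r)"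
  by (rule image_compactin[OF _ continuous_map_c_axis[OF assms(1)]]) (use assms(2) in \<open>auto simp: compactin_subtopology\<close>)

text \<open>Outside the closed unit disc, inversion leads into the other one. Closed discs in place
  of open ones give compactness.\<close>

lemma Sph_eq_closed:
  assumes "k < m"
  shows "Sph k i = (\<lambda>t. c k (axis i t)) ` cball 0 1 \<union> (\<lambda>t. c (nb k i) (axis (rv k i) t)) ` cball 0 1"
proof -
  have *: "c k (axis i t) \<in> (\<lambda>t. c k (axis i t)) ` cball 0 1 \<union> (\<lambda>t. c (nb k i) (axis (rv k i) t)) ` cball 0 1"
    if "norm t < 2" "k < m" for t k i
  proof (cases "norm t \<le> 1")
    case False
    then have "c k (axis i t) = c (nb k i) (axis (rv k i) (inverse t))" using that by (intro c_axis_flip) auto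
    moreover have "inverse t \<in> cball 0 1" using False by (simp add: norm_inverse inverse_le_1_iff)
    ultimately show ?thesis by blast
  qed auto
  show ?thesis
  proof (intro equalityI subsetI)
    fix x assume "x \<in> Sph k i"
    then consider t where "x = c k (axis i t)" "norm t < 2"
      | t where "x = c (nb k i) (axis (rv k i) t)" "norm t < 2"
      by (auto simp: Sph_def Ax_def)
    then show "x \<in> (\<lambda>t. c k (axis i t)) ` cball 0 1 \<union> (\<lambda>t. c (nb k i) (axis (rv k i) t)) ` cball 0 1"
    proof cases
      case 1
      then show ?thesis using *[OF 1(2) assms] by simp
    next
      case 2
      then show ?thesis
        using *[OF 2(2) nb_less[OF assms, of i], of "rv k i", unfolded nb_nb[OF assms] rv_rv[OF assms]]
        by (simp only: Un_commute)
    qed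
  qed (auto simp: Sph_def Ax_def)
qed

lemma compactin_Sph: "k < m \<Longrightarrow> compactin T (Sph k i)"
  by (simp add: Sph_eq_closed compactin_Un compactin_c_axis nb_less)

lemma closedin_Sph: "k < m \<Longrightarrow> closedin T (Sph k i)"
  using compactin_Sph Hausdorff_T by (rule compactin_imp_closedin[rotated])

lemma connectedin_Sph: assumes "k < m" shows "connectedin T (Sph k i)"
proof -
  have con: "connectedin T (c k ` Ax i)" if "k < m" for k i
  proof -
    have "connectedin T ((\<lambda>t. c k (axis i t)) ` ball 0 2)"
      by (rule connectedin_continuous_map_image[OF continuous_map_c_axis[OF that]]) (auto simp: connectedin_subtopology)
    then show ?thesis by (simp add: Ax_def image_image)
  qed
  have "c k (axis i 1) = c (nb k i) (axis (rv k i) 1)" using c_axis_flip[OF assms, of 1 i] by simp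
  then have "c k (axis i 1) \<in> c k ` Ax i \<inter> c (nb k i) ` Ax (rv k i)" by (force simp: Ax_def)
  then show ?thesis unfolding Sph_def
    by (intro connectedin_Un con assms nb_less) blast
qed

text \<open>The sphere is connected, open in the fixed point set as the part of it in two charts,
  and closed because it is compact; hence it is a component.\<close>

lemma weight_component_eq:
  assumes "k < m" shows "weight_component ex T act (c k 0) (w k i) = Sph k i"
proof -
  let ?F = "fixed_points T act (character_kernel0 ex (w k i))"
  let ?X = "subtopology T ?F"
  have sub: "Sph k i \<subseteq> ?F" using Sph_eq_fixed[OF assms] by blast
  have "openin ?X (Sph k i)"
    unfolding openin_subtopology using Sph_eq_fixed[OF assms] assms I_less nb_less openin_U
    by (intro exI[of _ "U k \<union> U (nb k i)"]) auto
  moreover have "closedin ?X (Sph k i)"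
    unfolding closedin_subtopology using closedin_Sph[OF assms] sub by blast
  ultimately have "connected_component_of_set ?X (c k 0) \<subseteq> Sph k i \<or> disjnt (connected_component_of_set ?X (c k 0)) (Sph k i)"
    by (intro connectedin_clopen_cases[OF connectedin_connected_component_of])
  moreover have "Sph k i \<subseteq> connected_component_of_set ?X (c k 0)"
    using connectedin_Sph[OF assms] sub c_zero_in_Sph(1)
    by (intro connected_component_of_maximal) (simp_all add: connectedin_subtopology)
  ultimately show ?thesis
    unfolding weight_component_def disjnt_def using c_zero_in_Sph(1)[of k i] by blast
qed

lemma tangent_weight_Sph:
  assumes "k < m" shows "tangent_weight ex A act (Sph k i) (c k 0) (w k i)"
  unfolding tangent_weight_def
proof (intro ballI, clarify)
  fix U' \<phi>' assume "(U', \<phi>') \<in> A" "c k 0 \<in> U'"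
  from charts_at_zero[OF assms this] have [simp]: "U' = U k" "\<phi>' = \<phi> k" by auto
  fix v assume "v \<in> tangent_in_chart U' \<phi>' (Sph k i) (c k 0)"
  then obtain \<gamma> :: "real \<Rightarrow> 'd point" where \<gamma>: "\<gamma> 0 = c k 0" "range \<gamma> \<subseteq> Sph k i \<inter> U k"
      "((\<lambda>t. \<phi> k (\<gamma> t)) has_vector_derivative v) (at 0)"
    by (auto simp: tangent_in_chart_def)
  have v: "v $ j = 0" if "j \<noteq> i" for j
  proof -
    have "\<phi> k (\<gamma> t) $ j = 0" for t
    proof -
      have "\<gamma> t \<in> c k ` Ax i" using \<gamma>(2) Sph_Int_U[OF assms, of i] by blast
      then obtain z where "z \<in> Ax i" "\<gamma> t = c k z" by blast
      then show ?thesis using that assms I_less Ax_subset_Dom[of k i] by (auto simp: Ax_def axis_def subset_iff)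
    qed
    then have "((\<lambda>t. 0 :: complex) has_vector_derivative v $ j) (at 0)"
      using bounded_linear.has_vector_derivative[OF bounded_linear_vec_nth \<gamma>(3), of j] by simp
    then show ?thesis using has_vector_derivative_const vector_derivative_unique_at by blast
  qed
  then have v_axis: "v = axis i (v $ i)" by (auto simp: vec_eq_iff axis_def)
  show "\<i> *s v \<in> tangent_in_chart U' \<phi>' (Sph k i) (c k 0) \<and>
      (\<forall>\<xi>. isotropy act U' \<phi>' (c k 0) (ex \<xi>) v = cis (w k i \<xi>) *s v)"
  proof (intro conjI allI)
    fix \<xi>
    show "isotropy act U' \<phi>' (c k 0) (ex \<xi>) v = cis (w k i \<xi>) *s v"
    proof -
      have "cis (w k j \<xi>) * v $ j = cis (w k i \<xi>) * v $ j" for j by (cases "j = i") (simp_all add: v)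
      then show ?thesis using assms by (simp add: isotropy_eq vec_eq_iff W_def)
    qed
  next
    define s where "s = \<i> * v $ i"
    have sv: "axis i s = \<i> *s v" using v by (auto simp: vec_eq_iff axis_def s_def)
    \<comment> \<open>Curves are defined on the whole real line, so the straight line is replaced by
      0 where it would leave the disc; only small \<open>t\<close> affect the derivative.\<close>
    define \<delta> where "\<delta> t = c k (if norm (of_real t * s) < 2 then axis i (of_real t * s) else 0)" for t :: real
    have "c k (axis i 0) = c k 0" by (rule arg_cong[where f = "c k"]) (simp add: vec_eq_iff axis_def)
    then have "\<delta> 0 = c k 0" by (simp add: \<delta>_def)
    moreover have "\<delta> t \<in> c k ` Ax i" for t using zero_in_Ax by (auto simp: \<delta>_def Ax_def)
    then have "range \<delta> \<subseteq> Sph k i \<inter> U k" using Sph_Int_U[OF assms, of i] by blast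
    moreover have "((\<lambda>t. \<phi> k (\<delta> t)) has_vector_derivative axis i s) (at 0)"
    proof (rule has_vector_derivative_transform_within_open)
      show "((\<lambda>t. axis i (of_real t * s)) has_vector_derivative axis i s) (at 0)"
        by (rule bounded_linear.has_vector_derivative[OF bounded_linear_axis]) (auto intro!: derivative_eq_intros)
      show "open {t :: real. norm (of_real t * s) < 2}" by (intro open_Collect_less continuous_intros)
      fix t :: real assume "t \<in> {t. norm (of_real t * s) < 2}"
      then show "axis i (of_real t * s) = \<phi> k (\<delta> t)" using axis_in_Dom I_less assms by (simp add: \<delta>_def)
    qed simp
    ultimately show "\<i> *s v \<in> tangent_in_chart U' \<phi>' (Sph k i) (c k 0)"
      unfolding tangent_in_chart_def sv by auto
  qed
qed

lemma Sph_inj: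
  assumes "k < m" "Sph k i = Sph k j" shows "i = j"
proof -
  have "c k (axis i 1) \<in> c k ` Ax i" by (auto simp: Ax_def)
  moreover have "c k ` Ax i = c k ` Ax j"
    using Sph_Int_U[OF assms(1), of i] Sph_Int_U[OF assms(1), of j] assms(2) by simp
  ultimately have "c k (axis i 1) \<in> c k ` Ax j" by simp
  then obtain t where "norm t < 2" "c k (axis i 1) = c k (axis j t)" by (auto simp: Ax_def)
  then have "axis i 1 = (axis j t :: complex^'d)"
    by (intro inj_onD[OF inj_on_c[OF I_less[OF assms(1)]]] axis_in_Dom[OF assms(1)]) simp_all
  then show ?thesis by (auto simp: axis_eq_axis)
qed

end

section \<open>Stereographic coordinates and embeddedness\<close>

text \<open>
  Stereographic projection from the pole \<open>(0, 0, s)\<close>, for \<open>s = \<plusminus>1\<close>, extended to be constant along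
  rays; the orientation is chosen such that the coordinates for \<open>s\<close> and \<open>- s\<close> are reciprocal.
\<close>

definition stereo_denom :: "real \<Rightarrow> real^3 \<Rightarrow> real" where
  "stereo_denom s y = norm y - s * y $ 3"

definition stereo :: "real \<Rightarrow> real^3 \<Rightarrow> complex" where
  "stereo s y = Complex (y $ 1) (s * y $ 2) * inverse (of_real (stereo_denom s y))"

text \<open>On the unit sphere the squared modulus of \<open>stereo s y\<close> is the quotient of
  \<open>1 + s * y $ 3\<close> by \<open>1 - s * y $ 3\<close>, which is below 4 exactly if
  \<open>s * y $ 3\<close> is below 3/5. The sets for \<open>s\<close> and \<open>- s\<close> thus
  correspond to the two discs of radius 2, and their overlap to the annulus between 1/2 and
  2.\<close>

definition halfspace :: "real \<Rightarrow> (real^3) set" where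
  "halfspace s = {y. 5 * (s * y $ 3) < 3 * norm y}"

lemma norm_vec3: "(norm (y :: real^3))\<^sup>2 = (y $ 1)\<^sup>2 + (y $ 2)\<^sup>2 + (y $ 3)\<^sup>2"
  by (simp add: norm_vec_def L2_set_def sum_3)

lemma stereo_numerator_sq:
  assumes "s\<^sup>2 = 1"
  shows "(y $ 1)\<^sup>2 + s\<^sup>2 * (y $ 2)\<^sup>2 = stereo_denom s y * stereo_denom (- s) y"
proof -
  have "(y $ 1)\<^sup>2 + s\<^sup>2 * (y $ 2)\<^sup>2 = (norm y)\<^sup>2 - s\<^sup>2 * (y $ 3)\<^sup>2"
    using assms by (simp add: norm_vec3)
  then show ?thesis by (simp add: stereo_denom_def power2_eq_square algebra_simps)
qed

lemma norm_stereo_sq: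
  assumes "s\<^sup>2 = 1" "stereo_denom s y \<noteq> 0"
  shows "(norm (stereo s y))\<^sup>2 = stereo_denom (- s) y / stereo_denom s y"
proof -
  have "(norm (stereo s y))\<^sup>2 = ((y $ 1)\<^sup>2 + s\<^sup>2 * (y $ 2)\<^sup>2) * inverse (stereo_denom s y ^ 2)"
    by (simp add: stereo_def norm_mult norm_inverse cmod_power2 power_mult_distrib power_inverse)
  then show ?thesis
    unfolding stereo_numerator_sq[OF assms(1)] using assms(2)
    by (simp add: power2_eq_square divide_inverse)
qed

lemma open_halfspace: "open (halfspace s)"
  unfolding halfspace_def by (intro open_Collect_less continuous_intros)

lemma halfspace_nonzero: "y \<in> halfspace s \<Longrightarrow> y \<noteq> 0"
  by (auto simp: halfspace_def)

lemma stereo_denom_pos: assumes "y \<in> halfspace s" shows "0 < stereo_denom s y"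
proof -
  have "0 < norm y" using halfspace_nonzero[OF assms] by simp
  moreover have "5 * (s * y $ 3) < 3 * norm y" using assms by (simp only: halfspace_def mem_Collect_eq)
  ultimately show ?thesis unfolding stereo_denom_def by linarith
qed

lemma halfspace_cover: assumes "y \<noteq> 0" shows "y \<in> halfspace 1 \<or> y \<in> halfspace (-1)"
proof -
  have "0 < norm y" using assms by simp
  then have "5 * (1 * y $ 3) < 3 * norm y \<or> 5 * (- 1 * y $ 3) < 3 * norm y" by linarith
  then show ?thesis by (simp only: halfspace_def mem_Collect_eq)
qed

lemma halfspace_iff_norm_stereo:
  assumes "s\<^sup>2 = 1" "stereo_denom s y > 0"
  shows "y \<in> halfspace s \<longleftrightarrow> norm (stereo s y) < 2" "y \<in> halfspace (- s) \<longleftrightarrow> 1 / 2 < norm (stereo s y)"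
proof -
  have sq: "(norm (stereo s y))\<^sup>2 = stereo_denom (- s) y / stereo_denom s y"
    using assms by (intro norm_stereo_sq) auto
  have "norm (stereo s y) < 2 \<longleftrightarrow> (norm (stereo s y))\<^sup>2 < 4"
  proof -
    have "4 \<le> (norm (stereo s y))\<^sup>2 \<longleftrightarrow> 2 \<le> norm (stereo s y)"
      using power_mono_iff[of 2 "norm (stereo s y)" 2] by simp
    then show ?thesis by (metis not_le)
  qed
  also have "\<dots> \<longleftrightarrow> stereo_denom (- s) y < 4 * stereo_denom s y"
    using assms(2) by (simp add: sq divide_less_eq)
  also have "\<dots> \<longleftrightarrow> y \<in> halfspace s" by (auto simp: halfspace_def stereo_denom_def)
  finally show "y \<in> halfspace s \<longleftrightarrow> norm (stereo s y) < 2" by simp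
  have "1 / 2 < norm (stereo s y) \<longleftrightarrow> 1 / 4 < (norm (stereo s y))\<^sup>2"
  proof -
    have "(norm (stereo s y))\<^sup>2 \<le> 1 / 4 \<longleftrightarrow> norm (stereo s y) \<le> 1 / 2"
      using power_mono_iff[of "norm (stereo s y)" "1 / 2" 2] by (simp add: power_divide)
    then show ?thesis by (metis not_le)
  qed
  also have "\<dots> \<longleftrightarrow> stereo_denom s y < 4 * stereo_denom (- s) y"
    unfolding sq using assms(2) by (simp add: field_simps)
  also have "\<dots> \<longleftrightarrow> y \<in> halfspace (- s)" by (auto simp: halfspace_def stereo_denom_def)
  finally show "y \<in> halfspace (- s) \<longleftrightarrow> 1 / 2 < norm (stereo s y)" by simp
qed

lemma norm_stereo_less_2: "s\<^sup>2 = 1 \<Longrightarrow> y \<in> halfspace s \<Longrightarrow> norm (stereo s y) < 2"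
  using halfspace_iff_norm_stereo(1) stereo_denom_pos by blast

lemma stereo_inverse:
  assumes "y \<in> halfspace s" "y \<in> halfspace (- s)" "s\<^sup>2 = 1"
  shows "stereo (- s) y = inverse (stereo s y)"
proof -
  have "stereo_denom s y \<noteq> 0" "stereo_denom (- s) y \<noteq> 0"
    using stereo_denom_pos[OF assms(1)] stereo_denom_pos[OF assms(2)] by auto
  moreover have "Complex (y $ 1) (s * y $ 2) * Complex (y $ 1) (- s * y $ 2) =
      of_real (stereo_denom s y * stereo_denom (- s) y)"
    unfolding stereo_numerator_sq[OF assms(3), symmetric]
    by (simp add: complex_eq_iff power2_eq_square algebra_simps)
  ultimately have "stereo s y * stereo (- s) y = 1"
    by (simp add: stereo_def field_simps)
  then show ?thesis by (rule inverse_unique[symmetric])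
qed

lemma stereo_scale: assumes "r > 0" shows "stereo s (r *\<^sub>R y) = stereo s y"
proof -
  have "Complex (r * y $ 1) (s * (r * y $ 2)) = of_real r * Complex (y $ 1) (s * y $ 2)"
    by (simp add: complex_eq_iff)
  moreover have "stereo_denom s (r *\<^sub>R y) = r * stereo_denom s y"
    using assms by (simp add: stereo_denom_def algebra_simps)
  ultimately show ?thesis using assms by (simp add: stereo_def)
qed

text \<open>The modulus of the coordinate determines the height, hence the denominator, and then the
  numerator.\<close>

lemma stereo_inj:
  assumes s: "s\<^sup>2 = 1" and y: "norm y = 1" "y \<in> halfspace s" and z: "norm z = 1" "z \<in> halfspace s"
    and eq: "stereo s y = stereo s z"
  shows "y = z"
proof -
  have p: "0 < stereo_denom s y" "0 < stereo_denom s z"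
    using stereo_denom_pos y(2) z(2) by auto
  have "stereo_denom (- s) y / stereo_denom s y = stereo_denom (- s) z / stereo_denom s z"
    using norm_stereo_sq[OF s, of y] norm_stereo_sq[OF s, of z] p eq by simp
  then have "stereo_denom (- s) y * stereo_denom s z = stereo_denom (- s) z * stereo_denom s y"
    using p by (simp add: frac_eq_eq)
  then have 3: "s * y $ 3 = s * z $ 3" using y z by (simp add: stereo_denom_def algebra_simps)
  moreover have "s \<noteq> 0" using s by auto
  ultimately have "y $ 3 = z $ 3" by simp
  moreover have "stereo_denom s y = stereo_denom s z" using 3 y z by (simp add: stereo_denom_def)
  then have "Complex (y $ 1) (s * y $ 2) = Complex (z $ 1) (s * z $ 2)"
    using eq p by (simp add: stereo_def)
  then have "y $ 1 = z $ 1" "y $ 2 = z $ 2" using \<open>s \<noteq> 0\<close> by auto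
  ultimately show ?thesis by (simp add: vec_eq_iff forall_3)
qed

lemma stereo_surj:
  assumes "s\<^sup>2 = 1" "norm t < 2"
  obtains y where "norm y = 1" "y \<in> halfspace s" "stereo s y = t"
proof -
  define n where "n = 1 + (norm t)\<^sup>2"
  have n: "n > 0" "n = 1 + (Re t)\<^sup>2 + (Im t)\<^sup>2" by (auto simp: n_def cmod_power2 add_pos_nonneg)
  \<comment> \<open>Inverse stereographic projection, with the second entry reflected for
    \<open>s = -1\<close>.\<close>
  define y :: "real^3" where "y = vector [2 * Re t / n, s * (2 * Im t / n), s * ((n - 2) / n)]"
  have y: "y $ 1 = 2 * Re t / n" "y $ 2 = s * (2 * Im t / n)" "y $ 3 = s * ((n - 2) / n)"
    by (simp_all add: y_def vector_3)
  have ss: "s * (s * x) = x" for x using assms(1) by (simp add: power2_eq_square flip: mult.assoc)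
  have "(norm y)\<^sup>2 = (4 * (Re t)\<^sup>2 + 4 * (Im t)\<^sup>2 + (n - 2)\<^sup>2) / n\<^sup>2"
    unfolding norm_vec3 y using assms(1) by (simp add: power_mult_distrib power_divide add_divide_distrib)
  also have "4 * (Re t)\<^sup>2 + 4 * (Im t)\<^sup>2 + (n - 2)\<^sup>2 = n\<^sup>2"
    by (simp add: n(2) power2_eq_square algebra_simps)
  finally have "(norm y)\<^sup>2 = 1" using n by simp
  then have "norm y = 1" by (simp add: power2_eq_1_iff) (use norm_ge_zero[of y] in linarith)
  have "s * y $ 3 = (n - 2) / n" by (simp only: y ss)
  then have d: "stereo_denom s y = 2 / n" using n(1) \<open>norm y = 1\<close> by (simp add: stereo_denom_def field_simps)
  have "stereo s y = Complex (2 * Re t / n) (2 * Im t / n) * inverse (of_real (2 / n))"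
    by (simp only: stereo_def d y ss)
  also have "\<dots> = t" using n(1) by (simp add: complex_eq_iff)
  finally have "stereo s y = t" .
  moreover have "y \<in> halfspace s"
    using halfspace_iff_norm_stereo(1)[OF assms(1), of y] d n \<open>stereo s y = t\<close> assms(2) by simp
  ultimately show thesis using that \<open>norm y = 1\<close> by blast
qed

lemma bounded_linear_stereo_numerator: "bounded_linear (\<lambda>y :: real^3. Complex (y $ 1) (s * y $ 2))"
proof -
  have "linear (\<lambda>y :: real^3. Complex (y $ 1) (s * y $ 2))"
    by (rule linearI) (simp_all add: complex_eq_iff algebra_simps)
  then show ?thesis by (simp add: linear_conv_bounded_linear)
qed

lemma bounded_linear_scaled_nth: "bounded_linear (\<lambda>y :: real^3. s * y $ 3)"
  by (intro bounded_linear_const_mult bounded_linear_vec_nth)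

lemma smooth_on_stereo: "smooth_on (halfspace s) (stereo s)"
  unfolding smooth_on_def
proof
  fix k
  have "Ck_on k (halfspace s) (\<lambda>y :: real^3. complex_of_real (norm y) + of_real (- (s * y $ 3)))"
    by (intro Ck_on_add Ck_on_norm open_halfspace Ck_on_bounded_linear bounded_linear_minus
          bounded_linear_compose[OF bounded_linear_of_real] bounded_linear_scaled_nth)
       (auto simp: halfspace_def)
  then have "Ck_on k (halfspace s) (\<lambda>y. complex_of_real (stereo_denom s y))"
    by (simp add: stereo_denom_def)
  then have "Ck_on k (halfspace s) (\<lambda>y. inverse (complex_of_real (stereo_denom s y)))"
    by (rule Ck_on_inverse[OF open_halfspace, rotated]) (use stereo_denom_pos in force)
  then show "Ck_on k (halfspace s) (stereo s)"
    unfolding stereo_def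
    by (intro Ck_on_mult open_halfspace Ck_on_bounded_linear[OF _ bounded_linear_stereo_numerator])
qed

text \<open>\<open>stereo s\<close> is a linear map divided by a scalar function, so its derivative
  vanishes on \<open>v\<close> only if numerator and denominator change at the same relative rate
  \<open>l\<close>. Then the first two entries of \<open>v\<close> are \<open>l\<close> times those
  of \<open>x\<close>, and the derivative of the denominator gives the same for the third.\<close>

lemma stereo_immersion:
  assumes s: "s\<^sup>2 = 1" and x: "norm x = 1" "x \<in> halfspace s"
  obtains S where "(stereo s has_derivative S) (at x)" "\<And>v. S v = 0 \<Longrightarrow> v \<in> span {x}"
proof -
  let ?C = "\<lambda>y :: real^3. Complex (y $ 1) (s * y $ 2)"
  let ?q = "\<lambda>y. complex_of_real (stereo_denom s y)"
  let ?q' = "\<lambda>v. complex_of_real (v \<bullet> x - s * v $ 3)"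
  have p: "0 < stereo_denom s x" by (rule stereo_denom_pos[OF x(2)])
  then have q: "?q x \<noteq> 0" by simp
  have "x \<noteq> 0" using x by auto
  then have "(norm has_derivative (\<lambda>v. v \<bullet> x)) (at x)"
    using has_derivative_norm[of x] x by (simp add: sgn_div_norm)
  then have "(stereo_denom s has_derivative (\<lambda>v. v \<bullet> x - s * v $ 3)) (at x)"
    unfolding stereo_denom_def[abs_def]
    by (rule has_derivative_diff[OF _ bounded_linear_imp_has_derivative[OF bounded_linear_scaled_nth]])
  then have dq: "(?q has_derivative ?q') (at x)"
    by (rule bounded_linear.has_derivative[OF bounded_linear_of_real])
  have "(stereo s has_derivative
      (\<lambda>v. ?C x * - (inverse (?q x) * ?q' v * inverse (?q x)) + ?C v * inverse (?q x))) (at x)" (is "(_ has_derivative ?S) _")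
    unfolding stereo_def[abs_def]
    by (rule has_derivative_mult[OF bounded_linear_imp_has_derivative[OF bounded_linear_stereo_numerator[of s]]
          Deriv.has_derivative_inverse[OF q dq]])
  moreover have "v \<in> span {x}" if "?S v = 0" for v
  proof -
    define l where "l = (v \<bullet> x - s * v $ 3) / stereo_denom s x"
    have l: "?q' v = of_real l * ?q x" using p by (simp only: l_def flip: of_real_mult) simp
    have "?S v = (?C v - of_real l * ?C x) * inverse (?q x)"
      unfolding l using q by (simp add: field_simps)
    then have "?C v = of_real l * ?C x" using that q by simp
    moreover have "s \<noteq> 0" using s by auto
    ultimately have v12: "v $ 1 = l * x $ 1" "v $ 2 = l * x $ 2"
      by (simp_all add: complex_eq_iff)
    have vx: "v \<bullet> x = v $ 1 * x $ 1 + v $ 2 * x $ 2 + v $ 3 * x $ 3"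
      by (simp add: inner_vec_def sum_3)
    have ss: "s * s = 1" using s by (simp add: power2_eq_square)
    have x12: "x $ 1 * x $ 1 + x $ 2 * x $ 2 = stereo_denom s x * stereo_denom (- s) x"
      using stereo_numerator_sq[OF s, of x] s by (simp add: power2_eq_square)
    have "(x $ 3 - s) = - s * stereo_denom s x"
      using ss by (simp add: stereo_denom_def x algebra_simps flip: mult.assoc)
    then have x3: "v $ 3 * x $ 3 - s * v $ 3 = - s * v $ 3 * stereo_denom s x"
      by (metis (no_types, opaque_lifting) left_diff_distrib mult.commute mult.left_commute)
    \<comment> \<open>Inserting the first two entries of \<open>v\<close> into the definition of
      \<open>l\<close> leaves an equation for \<open>v $ 3\<close> alone.\<close>
    have "l * stereo_denom s x = v \<bullet> x - s * v $ 3" using p by (simp add: l_def)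
    also have "\<dots> = l * (x $ 1 * x $ 1 + x $ 2 * x $ 2) + (v $ 3 * x $ 3 - s * v $ 3)"
      unfolding vx v12 by (simp add: algebra_simps)
    also have "\<dots> = (l * stereo_denom (- s) x - s * v $ 3) * stereo_denom s x"
      unfolding x12 x3 by (simp add: algebra_simps)
    finally have "l = l * stereo_denom (- s) x - s * v $ 3" using p by simp
    then have "s * v $ 3 = s * (l * x $ 3)" using x(1) by (simp add: stereo_denom_def algebra_simps)
    then have "v $ 3 = l * x $ 3" using \<open>s \<noteq> 0\<close> by simp
    then have "v = l *\<^sub>R x" using v12 by (simp add: vec_eq_iff forall_3)
    then show ?thesis by (simp add: span_base span_scale)
  qed
  ultimately show thesis by (rule that)
qed

section \<open>Parametrising the spheres of the model\<close>

context gkm_model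
begin

definition sphere_map :: "nat \<Rightarrow> 'd \<Rightarrow> real^3 \<Rightarrow> 'd point" where
  "sphere_map k i y = (if y \<in> halfspace 1 then c k (axis i (stereo 1 y))
     else c (nb k i) (axis (rv k i) (stereo (-1) y)))"

lemma sphere_map_south: "y \<in> halfspace 1 \<Longrightarrow> sphere_map k i y = c k (axis i (stereo 1 y))"
  by (simp add: sphere_map_def)

text \<open>On the overlap the two stereographic coordinates are reciprocal, which is the gluing map
  along the axis.\<close>

lemma sphere_map_north:
  assumes "k < m" "y \<in> halfspace (-1)"
  shows "sphere_map k i y = c (nb k i) (axis (rv k i) (stereo (-1) y))"
proof (cases "y \<in> halfspace 1")
  case True
  then have "1 / 2 < norm (stereo 1 y)" "norm (stereo 1 y) < 2"
    using assms(2) halfspace_iff_norm_stereo[of 1 y] stereo_denom_pos[OF True] by auto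
  from c_axis_flip[OF assms(1) this] show ?thesis
    using True assms stereo_inverse[of y 1] by (simp add: sphere_map_south)
qed (simp add: sphere_map_def)

lemma sphere_map_in_U:
  assumes "k < m" "y \<noteq> 0"
  shows "sphere_map k i y \<in> U l \<longleftrightarrow> (l = k \<and> y \<in> halfspace 1) \<or> (l = nb k i \<and> y \<in> halfspace (-1))"
proof
  assume *: "sphere_map k i y \<in> U l"
  have aux: "l = k \<or> l = nb k i \<and> y \<in> halfspace (- s)"
    if "k < m" "y \<in> halfspace s" "s\<^sup>2 = 1" "c k (axis i (stereo s y)) \<in> U l" for k i s
  proof -
    from c_in_U_cases[OF I_less[OF that(1)] axis_in_Dom[OF that(1)] that(4)] norm_stereo_less_2[OF that(3,2)]
    have "l = k \<or> (\<exists>j. l = nb k j \<and> axis i (stereo s y) \<in> V k j)" by blast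
    then have "l = k \<or> l = nb k i \<and> axis i (stereo s y) \<in> V k i" using axis_in_V_imp by blast
    then show ?thesis
      using that(3) stereo_denom_pos[OF that(2)] by (auto simp: axis_in_V[OF that(1)] halfspace_iff_norm_stereo(2))
  qed
  show "(l = k \<and> y \<in> halfspace 1) \<or> (l = nb k i \<and> y \<in> halfspace (-1))"
  proof (cases "y \<in> halfspace 1")
    case True
    then show ?thesis using aux[OF assms(1) True, of i] * by (simp add: sphere_map_south)
  next
    case False
    then have "y \<in> halfspace (-1)" using halfspace_cover[OF assms(2)] by blast
    then show ?thesis
      using aux[OF nb_less[OF assms(1), of i], of "-1" "rv k i"] *
      by (auto simp: sphere_map_north[OF assms(1)] nb_nb[OF assms(1)])
  qed
next
  assume "(l = k \<and> y \<in> halfspace 1) \<or> (l = nb k i \<and> y \<in> halfspace (-1))"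
  then show "sphere_map k i y \<in> U l"
    using assms nb_less norm_stereo_less_2[of 1 y] norm_stereo_less_2[of "-1" y]
    by (auto simp: sphere_map_south sphere_map_north intro!: c_in_U axis_in_Dom)
qed

lemma \<phi>_sphere_map:
  assumes "k < m" "y \<in> halfspace s" "(s, l, j) = (1, k, i) \<or> (s, l, j) = (-1, nb k i, rv k i)"
  shows "\<phi> l (sphere_map k i y) = axis j (stereo s y)"
proof -
  have "l < m" "sphere_map k i y = c l (axis j (stereo s y))" "s\<^sup>2 = 1"
    using assms nb_less by (auto simp: sphere_map_south sphere_map_north)
  then show ?thesis using norm_stereo_less_2[OF _ assms(2)] axis_in_Dom I_less by simp
qed

lemma sphere_map_charts:
  assumes "k < m" "l \<in> I" "y \<noteq> 0" "sphere_map k i y \<in> U l"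
  obtains s j where "s\<^sup>2 = 1" "l < m" "y \<in> halfspace s" "(s, l, j) = (1, k, i) \<or> (s, l, j) = (-1, nb k i, rv k i)"
    "\<And>y'. y' \<in> halfspace s \<Longrightarrow> sphere_map k i y' \<in> U l"
proof -
  from assms sphere_map_in_U consider "l = k" "y \<in> halfspace 1" | "l = nb k i" "y \<in> halfspace (-1)" by blast
  then show thesis
  proof cases
    case 1
    then show thesis using assms(1) sphere_map_in_U halfspace_nonzero by (intro that[of 1 i]) auto
  next
    case 2
    then show thesis using assms(1) nb_less sphere_map_in_U halfspace_nonzero by (intro that[of "-1" "rv k i"]) auto
  qed
qed

lemma continuous_map_sphere_map:
  assumes "k < m" shows "continuous_map (top_of_set (- {0})) T (sphere_map k i)"
proof -
  have cont: "continuous_map (top_of_set (halfspace s)) T (\<lambda>y. c k (axis i (stereo s y)))"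
    if "k < m" "s\<^sup>2 = 1" for k i s
  proof -
    have "continuous_on (halfspace s) (stereo s)" using smooth_on_stereo unfolding smooth_on_def by (metis Ck_on.simps(1))
    then have "continuous_map (top_of_set (halfspace s)) (top_of_set (ball 0 2)) (stereo s)"
      using norm_stereo_less_2[OF that(2)] by auto
    from continuous_map_compose[OF this continuous_map_c_axis[OF that(1), of i]] show ?thesis by (simp add: o_def)
  qed
  have 1: "continuous_map (top_of_set (halfspace 1)) T (sphere_map k i)"
    using cont[OF assms, of 1 i] by (rule continuous_map_eq) (simp_all add: sphere_map_south)
  have 2: "continuous_map (top_of_set (halfspace (-1))) T (sphere_map k i)"
    using cont[OF nb_less[OF assms], of "-1" i "rv k i"] by (rule continuous_map_eq) (simp_all add: sphere_map_north assms)
  show ?thesis unfolding continuous_map_def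
  proof (intro conjI allI impI)
    show "sphere_map k i \<in> topspace (top_of_set (- {0})) \<rightarrow> topspace T"
    proof
      fix y :: "real^3" assume "y \<in> topspace (top_of_set (- {0}))"
      then have "y \<in> halfspace 1 \<or> y \<in> halfspace (-1)" using halfspace_cover by auto
      then show "sphere_map k i y \<in> topspace T" using 1 2 by (auto simp: continuous_map_def Pi_def)
    qed
    fix O' assume O': "openin T O'"
    have "open {y \<in> halfspace s. sphere_map k i y \<in> O'}"
      if "continuous_map (top_of_set (halfspace s)) T (sphere_map k i)" for s
      using that O' open_halfspace unfolding continuous_map_def by (auto simp: openin_open_eq)
    then have "open ({y \<in> halfspace 1. sphere_map k i y \<in> O'} \<union> {y \<in> halfspace (-1). sphere_map k i y \<in> O'})"
      using 1 2 by (intro open_Un)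
    also have "{y \<in> halfspace 1. sphere_map k i y \<in> O'} \<union> {y \<in> halfspace (-1). sphere_map k i y \<in> O'} =
        {y \<in> topspace (top_of_set (- {0})). sphere_map k i y \<in> O'}"
      using halfspace_cover halfspace_nonzero by auto
    finally show "openin (top_of_set (- {0})) {y \<in> topspace (top_of_set (- {0})). sphere_map k i y \<in> O'}"
      by (intro open_subset) auto
  qed
qed

lemma embedded_sphere_Sph: assumes k: "k < m" shows "embedded_sphere T A (Sph k i)"
  unfolding embedded_sphere_def
proof (intro exI[of _ "sphere_map k i"] conjI)
  have inv: "inv_into (- {0}) (\<lambda>x. x) y = y" if "y \<noteq> 0" for y :: "real^3"
    by (rule inv_into_f_eq) (use that in auto)
  have "smooth_on ((\<lambda>x. x) ` (- {0} \<inter> sphere_map k i -` U l)) (\<lambda>y. \<phi> l (sphere_map k i (inv_into (- {0}) (\<lambda>x. x) y)))"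
    if "l \<in> I" for l
  proof (rule smooth_on_local)
    fix y assume "y \<in> (\<lambda>x. x) ` (- {0} \<inter> sphere_map k i -` U l)"
    then have "y \<noteq> 0" "sphere_map k i y \<in> U l" by auto
    with k that obtain s j where s: "s\<^sup>2 = 1" "l < m" "y \<in> halfspace s" "(s, l, j) = (1, k, i) \<or> (s, l, j) = (-1, nb k i, rv k i)"
        "\<And>y'. y' \<in> halfspace s \<Longrightarrow> sphere_map k i y' \<in> U l" by (metis sphere_map_charts)
    have "smooth_on (halfspace s) (\<lambda>y. axis j (stereo s y) :: complex^'d)"
      using smooth_on_stereo[of s] unfolding smooth_on_def
      by (auto intro!: Ck_on_linear_compose[OF open_halfspace bounded_linear_axis])
    moreover have "halfspace s \<subseteq> (\<lambda>x. x) ` (- {0} \<inter> sphere_map k i -` U l)" using s(5) halfspace_nonzero by auto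
    moreover have "\<forall>y\<in>halfspace s. \<phi> l (sphere_map k i (inv_into (- {0}) (\<lambda>x. x) y)) = axis j (stereo s y)"
      using \<phi>_sphere_map[OF k _ s(4)] inv halfspace_nonzero by auto
    ultimately show "\<exists>N g. open N \<and> y \<in> N \<and> N \<subseteq> (\<lambda>x. x) ` (- {0} \<inter> sphere_map k i -` U l) \<and>
        (\<forall>y\<in>N. \<phi> l (sphere_map k i (inv_into (- {0}) (\<lambda>x. x) y)) = g y) \<and> smooth_on N g"
      using open_halfspace s(3) by (intro exI[of _ "halfspace s"] exI[of _ "\<lambda>y. axis j (stereo s y)"] conjI)
  qed
  then show "smooth_map (top_of_set (- {0})) {(- {0}, \<lambda>x. x)} T A (sphere_map k i)"
    using continuous_map_sphere_map[OF k] by (auto simp: smooth_map_def in_charts_def A_def)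
  show "\<forall>x r. x \<noteq> 0 \<longrightarrow> r > 0 \<longrightarrow> sphere_map k i (r *\<^sub>R x) = sphere_map k i x"
  proof (intro allI impI)
    fix x :: "real^3" and r :: real assume "r > 0"
    then have "r *\<^sub>R x \<in> halfspace s \<longleftrightarrow> x \<in> halfspace s" for s
      by (simp add: halfspace_def mult.left_commute[of _ r])
    then show "sphere_map k i (r *\<^sub>R x) = sphere_map k i x" using \<open>r > 0\<close> by (simp add: sphere_map_def stereo_scale)
  qed
  show "inj_on (sphere_map k i) (sphere 0 1)"
  proof (rule inj_onI)
    fix x y :: "real^3" assume x: "x \<in> sphere 0 1" and y: "y \<in> sphere 0 1" and eq: "sphere_map k i x = sphere_map k i y"
    have "x \<noteq> 0" "y \<noteq> 0" using x y by auto
    have aux: "x = y" if xs: "x \<in> halfspace s" and slj: "(s, l, j) = (1, k, i) \<or> (s, l, j) = (-1, nb k i, rv k i)" for s l j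
    proof -
      have "sphere_map k i x \<in> U l" using sphere_map_in_U[OF k \<open>x \<noteq> 0\<close>] xs slj by auto
      then have "y \<in> halfspace s" using sphere_map_in_U[OF k \<open>y \<noteq> 0\<close>] slj eq nb_neq[OF k, of i] by auto
      then have "axis j (stereo s x) = (axis j (stereo s y) :: complex^'d)"
        using \<phi>_sphere_map[OF k _ slj] xs eq by metis
      then have "stereo s x = stereo s y" by (simp add: axis_eq_axis) (auto simp: axis_eq_axis)
      moreover have "s\<^sup>2 = 1" using slj by auto
      ultimately show ?thesis using stereo_inj[of s x y] \<open>y \<in> halfspace s\<close> xs x y by simp
    qed
    show "x = y" using halfspace_cover[OF \<open>x \<noteq> 0\<close>] aux by blast
  qed
  show "\<forall>x\<in>sphere 0 1. \<forall>(U, \<phi>)\<in>A. sphere_map k i x \<in> U \<longrightarrow>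
      (\<forall>v. frechet_derivative (\<lambda>y. \<phi> (sphere_map k i y)) (at x) v = 0 \<longrightarrow> v \<in> span {x})"
  proof (intro ballI, clarify)
    fix x U' \<phi>' v assume x: "x \<in> sphere 0 1" and U': "(U', \<phi>') \<in> A" "sphere_map k i x \<in> U'"
      and v: "frechet_derivative (\<lambda>y. \<phi>' (sphere_map k i y)) (at x) v = 0"
    from U' obtain l where l: "l \<in> I" "U' = U l" "\<phi>' = \<phi> l" by (auto simp: A_def)
    have "x \<noteq> 0" "norm x = 1" using x by auto
    with k l U' obtain s j where s: "s\<^sup>2 = 1" "l < m" "x \<in> halfspace s" "(s, l, j) = (1, k, i) \<or> (s, l, j) = (-1, nb k i, rv k i)"
      by (metis sphere_map_charts)
    obtain S where S: "(stereo s has_derivative S) (at x)" "\<And>v. S v = 0 \<Longrightarrow> v \<in> span {x}"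
      using stereo_immersion[OF s(1) \<open>norm x = 1\<close> s(3)] by blast
    have "((\<lambda>y. axis j (stereo s y) :: complex^'d) has_derivative (\<lambda>v. axis j (S v))) (at x)"
      by (rule bounded_linear.has_derivative[OF bounded_linear_axis S(1)])
    then have "((\<lambda>y. \<phi> l (sphere_map k i y)) has_derivative (\<lambda>v. axis j (S v))) (at x)"
      by (rule has_derivative_transform_within_open[OF _ open_halfspace s(3)]) (simp add: \<phi>_sphere_map[OF k _ s(4)])
    then have "axis j (S v) = (0 :: complex^'d)" using v l by (simp add: has_derivative_frechet)
    then have "(axis j (S v) :: complex^'d) $ j = 0" by (simp only: zero_index)
    then have "S v = 0" by (simp add: axis_def)
    then show "v \<in> span {x}" by (rule S(2))
  qed
  show "Sph k i = sphere_map k i ` sphere 0 1"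
  proof (intro equalityI subsetI)
    fix p assume "p \<in> Sph k i"
    then consider t where "norm t < 2" "p = c k (axis i t)" | t where "norm t < 2" "p = c (nb k i) (axis (rv k i) t)"
      by (auto simp: Sph_def Ax_def)
    then show "p \<in> sphere_map k i ` sphere 0 1"
    proof cases
      case 1
      obtain y where "norm y = 1" "y \<in> halfspace 1" "stereo 1 y = t" using stereo_surj[of 1 t] 1(1) by auto
      then show ?thesis using 1 by (intro image_eqI[of _ _ y]) (auto simp: sphere_map_south)
    next
      case 2
      obtain y where "norm y = 1" "y \<in> halfspace (-1)" "stereo (-1) y = t" using stereo_surj[of "-1" t] 2(1) by auto
      then show ?thesis using 2 k by (intro image_eqI[of _ _ y]) (auto simp: sphere_map_north)
    qed
  next
    fix p assume "p \<in> sphere_map k i ` sphere 0 1"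
    then obtain y where "y \<in> sphere 0 1" and p: "p = sphere_map k i y" by blast
    then have "y \<noteq> 0" by auto
    consider "y \<in> halfspace 1" | "y \<in> halfspace (-1)" using halfspace_cover[OF \<open>y \<noteq> 0\<close>] by blast
    then show "p \<in> Sph k i"
    proof cases
      case 1
      then have "stereo 1 y \<in> ball 0 2" using norm_stereo_less_2[of 1 y] by simp
      then show ?thesis unfolding p sphere_map_south[OF 1] Sph_def Ax_def by blast
    next
      case 2
      then have "stereo (-1) y \<in> ball 0 2" using norm_stereo_less_2[of "-1" y] by simp
      then show ?thesis unfolding p sphere_map_north[OF k 2] Sph_def Ax_def by blast
    qed
  qed
qed

lemma Sph_in_gkm_spheres: "k < m \<Longrightarrow> Sph k i \<in> gkm_spheres T A act"
  using embedded_sphere_Sph act_Sph c_nb_zero_neq by (simp add: gkm_spheres_def Sph_Int_fixed)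

end

section \<open>Uniqueness of the invariant spheres\<close>

lemma punctured_sphere_homeomorphic_plane:
  assumes "a \<in> sphere (0 :: real^3) 1"
  shows "(sphere 0 1 - {a}) homeomorphic (UNIV :: complex set)"
  by (rule homeomorphic_punctured_sphere_affine[OF _ assms]) auto

text \<open>Omitting the point \<open>a\<close> turns the sphere into a plane, so that invariance of
  domain applies.\<close>

lemma open_image_in_sphere:
  fixes h :: "complex \<Rightarrow> real^3"
  assumes B: "open B" "continuous_on B h" "inj_on h B" "h ` B \<subseteq> sphere 0 1" and a: "a \<in> sphere 0 1" "a \<notin> h ` B"
  shows "openin (top_of_set (sphere 0 1)) (h ` B)"
proof -
  obtain p q where pq: "homeomorphism (sphere 0 1 - {a}) (UNIV :: complex set) p q"
    using punctured_sphere_homeomorphic_plane[OF a(1)] by (auto simp: homeomorphic_def)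
  have sub: "h ` B \<subseteq> sphere 0 1 - {a}" using B(4) a(2) by blast
  have qp: "q (p y) = y" if "y \<in> h ` B" for y
    using pq sub that by (auto simp: homeomorphism_def)
  have "open ((p \<circ> h) ` B)"
  proof (rule invariance_of_domain)
    show "continuous_on B (p \<circ> h)"
      using pq sub by (intro continuous_on_compose B) (auto simp: homeomorphism_def intro: continuous_on_subset)
    show "inj_on (p \<circ> h) B"
      by (rule comp_inj_on[OF B(3)]) (metis inj_on_inverseI qp)
  qed (rule B)
  then have "openin (top_of_set (sphere 0 1 - {a})) (q ` (p \<circ> h) ` B)"
    using homeomorphism_imp_open_map[OF homeomorphism_symD[OF pq], of "(p \<circ> h) ` B"] by simp
  moreover have "q ` (p \<circ> h) ` B = h ` B" using qp by (auto simp: image_image)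
  moreover have "openin (top_of_set (sphere 0 1)) (sphere 0 1 - {a})"
    using a(1) by (intro openin_diff) auto
  ultimately show ?thesis using openin_trans by metis
qed

lemma connected_sphere_minus_two:
  assumes "a \<in> sphere (0 :: real^3) 1"
  shows "connected (sphere 0 1 - {a, b})"
proof -
  obtain p q where pq: "homeomorphism (sphere 0 1 - {a}) (UNIV :: complex set) p q"
    using punctured_sphere_homeomorphic_plane[OF assms] by (auto simp: homeomorphic_def)
  show ?thesis
  proof (cases "b \<in> sphere 0 1 - {a}")
    case True
    have "sphere 0 1 - {a, b} = q ` (- {p b})"
    proof (intro equalityI subsetI)
      fix y assume "y \<in> sphere 0 1 - {a, b}"
      then have "q (p y) = y" "q (p b) = b" "y \<noteq> b" using pq True by (auto simp: homeomorphism_def)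
      then show "y \<in> q ` (- {p b})" by (intro image_eqI[of _ _ "p y"]) auto
    next
      fix y assume "y \<in> q ` (- {p b})"
      then obtain u where u: "y = q u" "u \<noteq> p b" by auto
      moreover have "p (q u) = u" "q u \<in> sphere 0 1 - {a}" using pq unfolding homeomorphism_def by blast+
      ultimately show "y \<in> sphere 0 1 - {a, b}" by auto
    qed
    moreover have "connected (q ` (- {p b}))"
      using pq by (intro connected_continuous_image connected_punctured_universe)
        (auto simp: homeomorphism_def intro: continuous_on_subset)
    ultimately show ?thesis by simp
  next
    case False
    have "connected (q ` UNIV)"
      using pq by (intro connected_continuous_image) (auto simp: homeomorphism_def)
    moreover have "q ` UNIV = sphere 0 1 - {a, b}" using pq False by (auto simp: homeomorphism_def)
    ultimately show ?thesis by simp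
  qed
qed

section \<open>Confining an invariant sphere to one edge\<close>

context gkm_model
begin

text \<open>An open neighbourhood of a punctured axis. By \<open>axis_in_wedgeD\<close> a point of a
  punctured axis lies only in the wedges of the two orientations of its edge, so wedges separate the
  punctured axes of different edges.\<close>

definition wedge :: "nat \<Rightarrow> 'd \<Rightarrow> 'd point set" where
  "wedge k i = c k ` {z \<in> Dom k. \<forall>j. j \<noteq> i \<longrightarrow> norm (z $ j) < norm (z $ i)}"

lemma openin_wedge: "k < m \<Longrightarrow> openin T (wedge k i)"
proof -
  assume k: "k < m"
  have "{z \<in> Dom k. \<forall>j. j \<noteq> i \<longrightarrow> norm (z $ j) < norm (z $ i)} =
      Dom k \<inter> (\<Inter>j\<in>-{i}. {z. norm (z $ j) < norm (z $ i)})" by auto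
  also have "open \<dots>"
    by (intro open_Int open_Dom open_INT open_Collect_less continuous_intros ballI) auto
  finally show ?thesis unfolding wedge_def by (intro openin_c I_less k) auto
qed

lemma axis_in_wedge: "k < m \<Longrightarrow> norm t < 2 \<Longrightarrow> t \<noteq> 0 \<Longrightarrow> c k (axis i t) \<in> wedge k i"
  unfolding wedge_def using axis_in_Dom[of k t i]
  by (intro imageI CollectI conjI) (auto simp: axis_def)

lemma axis_in_wedgeD:
  assumes "k < m" "l < m" "norm t < 2" "t \<noteq> 0" "c k (axis i t) \<in> wedge l j"
  shows "(l, j) = (k, i) \<or> (l, j) = (nb k i, rv k i)"
proof -
  obtain z where z: "z \<in> Dom l" "\<And>j'. j' \<noteq> j \<Longrightarrow> norm (z $ j') < norm (z $ j)" "c k (axis i t) = c l z"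
    using assms(5) by (auto simp: wedge_def)
  have max: "j = j'" if "z = axis j' s" "s \<noteq> 0" for j' s
    using z(2)[of j'] that by (cases "j = j'") (auto simp: axis_def)
  have "rel k (axis i t) l z" using z(3) c_eq_iff[OF I_less[OF assms(1)] axis_in_Dom[OF assms(1,3)]] by blast
  then consider "l = k" "axis i t = z" | i' where "l = nb k i'" "axis i t \<in> V k i'" "z = \<tau> k i' (axis i t)"
    unfolding rel_def by blast
  then show ?thesis
  proof cases
    case 1
    then show ?thesis using max[of i t] assms(4) by simp
  next
    case 2
    then have "i' = i" using axis_in_V_imp by blast
    then have "z = axis (rv k i) (inverse t)" using 2 \<tau>_axis[OF assms(1,4)] by simp
    then show ?thesis using 2 \<open>i' = i\<close> max[of "rv k i" "inverse t"] assms(4) by simp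
  qed
qed

lemma openin_main: "openin T (\<Union>k<m. U k)"
  by (intro openin_Union) (auto simp: openin_U I_less)

text \<open>The added pieces are glued to nothing, so a connected set that meets a vertex piece
  stays among the vertex pieces.\<close>

lemma closedin_main: "closedin T (\<Union>k<m. U k)"
proof -
  have "topspace T - (\<Union>k<m. U k) = (\<Union>k\<in>{m..<m + N}. U k)"
  proof (intro equalityI subsetI)
    fix x assume x: "x \<in> topspace T - (\<Union>k<m. U k)"
    then obtain k z where k: "k \<in> I" "z \<in> Dom k" "x = c k z" by (auto elim: topspaceE)
    then have "\<not> k < m" using x c_in_U by auto
    then show "x \<in> (\<Union>k\<in>{m..<m + N}. U k)" using k c_in_U by (auto simp: I_def intro!: bexI[of _ k])
  next
    fix x assume "x \<in> (\<Union>k\<in>{m..<m + N}. U k)"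
    then obtain k z where k: "m \<le> k" "k \<in> I" "z \<in> Dom k" "x = c k z" by (auto simp: U_def I_def)
    have "x \<notin> U l" if "l < m" for l using c_in_U_cases[OF k(2,3), of l] k that by auto
    then show "x \<in> topspace T - (\<Union>k<m. U k)" using k c_in_topspace by auto
  qed
  moreover have "openin T (\<Union>k\<in>{m..<m + N}. U k)"
  proof (intro openin_Union ballI)
    fix S assume "S \<in> U ` {m..<m + N}"
    then obtain k where "k \<in> I" "S = U k" by (auto simp: I_def)
    then show "openin T S" by (simp add: openin_U)
  qed
  moreover have "(\<Union>k<m. U k) \<subseteq> topspace T" using openin_main openin_subset by blast
  ultimately show ?thesis by (simp add: closedin_def)
qed

lemma continuous_map_orbit:
  assumes "k \<in> I" "z \<in> Dom k" shows "continuous_map euclidean T (\<lambda>\<xi>. act (ex \<xi>) (c k z))"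
proof -
  have "continuous_on UNIV (\<lambda>\<xi>. D k \<xi> z)"
    unfolding D_def cis_conv_exp by (intro continuous_intros)
  then have "continuous_map euclidean (top_of_set (Dom k)) (\<lambda>\<xi>. D k \<xi> z)"
    using assms by (simp add: continuous_map_in_subtopology)
  from continuous_map_compose[OF this continuous_map_c[OF assms(1)]]
  show ?thesis using assms by (simp add: o_def act_c)
qed

text \<open>A bounded part of the Lie algebra already sweeps out the group, so orbits are images of
  compact sets.\<close>

lemma orbit_eq_ball: "\<exists>r. range (\<lambda>\<xi>. act (ex \<xi>) x) = (\<lambda>\<xi>. act (ex \<xi>) x) ` cball 0 r"
proof -
  obtain r where "ex ` ball 0 r = UNIV" using ex_ball_UNIV by blast
  then have *: "\<exists>\<eta>\<in>cball 0 r. ex \<xi> = ex \<eta>" for \<xi>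
    by (metis UNIV_I ball_subset_cball imageE subsetD)
  have "act (ex \<xi>) x \<in> (\<lambda>\<xi>. act (ex \<xi>) x) ` cball 0 r" for \<xi>
    using *[of \<xi>] by (metis imageI)
  then show ?thesis by blast
qed

text \<open>
  If two coordinates of a point do not vanish, then its orbit contains an injective image of a
  plane disc. Within a sphere it is therefore open, by invariance of domain, and also compact, so
  it is the whole sphere, which has a fixed point.
\<close>

lemma orbit_in_sphere:
  assumes f: "continuous_map (top_of_set (sphere (0 :: real^3) 1)) T f" "inj_on f (sphere 0 1)" "X = f ` sphere 0 1"
    and invariant: "\<And>g. act g ` X = X" and x0: "x0 \<in> X \<inter> fixed_points T act UNIV"
    and k: "k < m" and z: "z \<in> Dom k" "c k z \<in> X"
  shows "\<exists>i. z \<in> Ax i"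
proof (rule ccontr)
  assume "\<nexists>i. z \<in> Ax i"
  then have nAx: "\<And>i. z \<notin> Ax i" by blast
  then have "z \<noteq> 0" using zero_in_Ax by metis
  then obtain i where i: "z $ i \<noteq> 0" by (auto simp: vec_eq_iff)
  then obtain j where j: "j \<noteq> i" "z $ j \<noteq> 0" using nAx[of i] Ax_iff[OF k z(1)] by blast
  obtain \<xi>\<^sub>1 where \<xi>\<^sub>1: "w k j \<xi>\<^sub>1 = 0" "w k i \<xi>\<^sub>1 = 1" using w_dual[OF k j(1)] by blast
  obtain \<xi>\<^sub>2 where \<xi>\<^sub>2: "w k i \<xi>\<^sub>2 = 0" "w k j \<xi>\<^sub>2 = 1" using w_dual[OF k j(1)[symmetric]] by blast
  \<comment> \<open>A plane in the Lie algebra on which the two weights become the real and the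
    imaginary part.\<close>
  define E where "E t = Re t *\<^sub>R \<xi>\<^sub>1 + Im t *\<^sub>R \<xi>\<^sub>2" for t
  have E: "w k i (E t) = Re t" "w k j (E t) = Im t" for t
    using \<xi>\<^sub>1 \<xi>\<^sub>2 by (simp_all add: E_def blinfun.add_right blinfun.scaleR_right)
  let ?x = "c k z"
  let ?orb = "\<lambda>\<xi>. act (ex \<xi>) ?x"
  have orb: "?orb \<xi> = c k (D k \<xi> z)" for \<xi> using act_c I_less k z by blast
  have orbX: "?orb \<xi> \<in> X" for \<xi> using invariant z(2) by blast
  have XT: "X \<subseteq> topspace T" using f(1,3) by (auto simp: continuous_map_def)
  \<comment> \<open>A continuous injection of a compact space into a Hausdorff space is a
    homeomorphism onto its image, so the orbit can be studied in the round sphere.\<close>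
  have "homeomorphic_map (top_of_set (sphere 0 1)) (subtopology T X) f"
    using f XT Hausdorff_T
    by (intro continuous_imp_homeomorphic_map)
       (auto simp: continuous_map_in_subtopology compact_space_subtopology Hausdorff_space_subtopology)
  then obtain g where "homeomorphic_maps (top_of_set (sphere 0 1)) (subtopology T X) f g"
    using homeomorphic_map_maps by blast
  then have g: "continuous_map (subtopology T X) (top_of_set (sphere 0 1)) g" "\<And>y. y \<in> X \<Longrightarrow> f (g y) = y"
    using XT by (auto simp: homeomorphic_maps_def)
  have gS: "g y \<in> sphere 0 1" if "y \<in> X" for y using g(1) XT that by (auto simp: continuous_map_def)
  have ginj: "y = y'" if "g y = g y'" "y \<in> X" "y' \<in> X" for y y' using g(2) that by metis
  have x0_orb: "x0 \<noteq> ?orb \<xi>" for \<xi>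
  proof
    assume "x0 = ?orb \<xi>"
    moreover obtain l where "l < m" "x0 = c l 0" using x0 fixed_points_eq by auto
    ultimately have "c l 0 = c k (D k \<xi> z)" using orb by simp
    moreover have "c k (D k \<xi> z) \<in> U k" using z(1) by (intro c_in_U) simp
    ultimately have "l = k" using c_zero_in_U_iff[OF \<open>l < m\<close>, of k] by simp
    then have "0 = D k \<xi> z"
      using \<open>c l 0 = c k (D k \<xi> z)\<close> k z(1)
      by (intro inj_onD[OF inj_on_c[OF I_less[OF k]]]) (auto simp: zero_in_Dom)
    then show False using \<open>z \<noteq> 0\<close> D_zero_iff by metis
  qed
  have cont_orb: "continuous_map euclidean (subtopology T X) ?orb"
    using continuous_map_orbit[OF I_less[OF k] z(1)] orbX by (simp add: continuous_map_in_subtopology image_subset_iff)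
  have cont: "continuous_on UNIV (\<lambda>\<xi>. g (?orb \<xi>))"
    using continuous_map_compose[OF cont_orb g(1)] by (simp add: o_def continuous_map_in_subtopology)
  let ?P = "range (\<lambda>\<xi>. g (?orb \<xi>))"
  have "openin (top_of_set (sphere 0 1)) ?P"
  proof -
    \<comment> \<open>The translates by \<open>\<eta>\<close> cover the orbit by such discs. Radius
      1 keeps differences of angles below 2 pi, so that \<open>cis\<close> separates them. The fixed
      point \<open>x0\<close> serves as the omitted point of the sphere.\<close>
    have "openin (top_of_set (sphere 0 1)) ((\<lambda>t. g (?orb (E t + \<eta>))) ` ball 0 1)" for \<eta>
    proof (rule open_image_in_sphere)
      have "continuous_on UNIV (\<lambda>t. E t + \<eta>)" unfolding E_def by (intro continuous_intros)
      from continuous_on_compose2[OF cont this] show "continuous_on (ball 0 1) (\<lambda>t. g (?orb (E t + \<eta>)))"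
        by (rule continuous_on_subset) auto
      show "inj_on (\<lambda>t. g (?orb (E t + \<eta>))) (ball 0 1)"
      proof (rule inj_onI)
        fix t t' :: complex assume t: "t \<in> ball 0 1" "t' \<in> ball 0 1" and "g (?orb (E t + \<eta>)) = g (?orb (E t' + \<eta>))"
        then have "c k (D k (E t + \<eta>) z) = c k (D k (E t' + \<eta>) z)" using ginj orbX orb by metis
        then have "D k (E t + \<eta>) z = D k (E t' + \<eta>) z"
          by (rule inj_onD[OF inj_on_c[OF I_less[OF k]]]) (simp_all add: z)
        then have *: "cis (w k l (E t + \<eta>)) * z $ l = cis (w k l (E t' + \<eta>)) * z $ l" for l
          using k by (simp add: vec_eq_iff W_def)
        have cis_eq: "a = b" if "cis (a + r) = cis (b + r)" "\<bar>a\<bar> < 1" "\<bar>b\<bar> < 1" for a b r :: real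
        proof -
          have "cis (a - b) = cis (a + r) / cis (b + r)" by (simp add: cis_divide)
          then have "cis (a - b) = 1" using that(1) by simp
          then obtain n :: int where n: "a - b = of_int n * 2 * pi" unfolding cis_eq_1_iff by blast
          have "n = 0"
          proof (rule ccontr)
            assume "n \<noteq> 0"
            then have "1 \<le> \<bar>real_of_int n\<bar>" by linarith
            then have "2 * pi \<le> \<bar>real_of_int n\<bar> * (2 * pi)" using pi_gt_zero by (simp add: mult_le_cancel_right1)
            also have "\<dots> = \<bar>a - b\<bar>" by (simp add: n abs_mult)
            finally show False using that pi_gt3 by linarith
          qed
          then show ?thesis using n by simp
        qed
        have "\<bar>Re t\<bar> < 1" "\<bar>Im t\<bar> < 1" "\<bar>Re t'\<bar> < 1" "\<bar>Im t'\<bar> < 1"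
          using t abs_Re_le_cmod[of t] abs_Im_le_cmod[of t] abs_Re_le_cmod[of t'] abs_Im_le_cmod[of t'] by auto
        moreover have "cis (Re t + w k i \<eta>) = cis (Re t' + w k i \<eta>)" "cis (Im t + w k j \<eta>) = cis (Im t' + w k j \<eta>)"
          using *[of i] *[of j] i j by (simp_all add: blinfun.add_right E)
        ultimately have "Re t = Re t'" "Im t = Im t'" by (blast intro: cis_eq)+
        then show "t = t'" by (simp add: complex_eq_iff)
      qed
      show "(\<lambda>t. g (?orb (E t + \<eta>))) ` ball 0 1 \<subseteq> sphere 0 1" using gS orbX by blast
      show "g x0 \<in> sphere 0 1" using gS x0 by blast
      show "g x0 \<notin> (\<lambda>t. g (?orb (E t + \<eta>))) ` ball 0 1" using ginj x0_orb x0 orbX by blast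
    qed simp
    then have "openin (top_of_set (sphere 0 1)) (\<Union>\<eta>. (\<lambda>t. g (?orb (E t + \<eta>))) ` ball 0 1)" by blast
    also have "(\<Union>\<eta>. (\<lambda>t. g (?orb (E t + \<eta>))) ` ball 0 1) = ?P"
    proof (intro equalityI subsetI)
      fix y assume "y \<in> ?P"
      then obtain \<eta> where "y = g (?orb \<eta>)" by blast
      then have "y \<in> (\<lambda>t. g (?orb (E t + \<eta>))) ` ball 0 1" by (intro image_eqI[of _ _ 0]) (auto simp: E_def)
      then show "y \<in> (\<Union>\<eta>. (\<lambda>t. g (?orb (E t + \<eta>))) ` ball 0 1)" by blast
    qed blast
    finally show ?thesis .
  qed
  moreover have "closedin (top_of_set (sphere 0 1)) ?P"
  proof -
    obtain r where r: "range ?orb = ?orb ` cball 0 r" using orbit_eq_ball by blast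
    have "?P = g ` range ?orb" by (simp only: image_image)
    then have "?P = (\<lambda>\<xi>. g (?orb \<xi>)) ` cball 0 r" by (simp only: r image_image)
    then have "compact ?P" using compact_continuous_image[OF continuous_on_subset[OF cont]] by simp
    moreover have "?P \<subseteq> sphere 0 1" using gS orbX by blast
    ultimately show ?thesis by (metis compact_imp_closed closed_subset)
  qed
  moreover have "connected (sphere (0 :: real^3) 1)" by (rule connected_sphere) simp
  ultimately have "?P = sphere 0 1" unfolding connected_clopen by (metis UNIV_not_empty image_is_empty)
  then obtain \<xi> where "g x0 = g (?orb \<xi>)" using gS x0 by blast
  then show False using ginj x0_orb x0 orbX by blast
qed

text \<open>If one point of the axis is missing from \<open>X\<close>, invariance removes its whole
  circle, and this circle separates the two fixed points within the sphere.\<close>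

lemma full_disc:
  assumes k: "k < m" and X: "X \<subseteq> Sph k i" "connectedin T X" "\<And>g. act g ` X = X" "c k 0 \<in> X" "c (nb k i) 0 \<in> X"
    and t: "norm t < 2"
  shows "c k (axis i t) \<in> X"
proof (rule ccontr)
  assume notin: "c k (axis i t) \<notin> X"
  have "axis i 0 = (0 :: complex^'d)" by (simp add: vec_eq_iff axis_def)
  then have "t \<noteq> 0" using notin X(4) by metis
  define r where "r = norm t"
  have circle: "c k (axis i s) \<notin> X" if s: "norm s = r" for s
  proof
    assume "c k (axis i s) \<in> X"
    have "s \<noteq> 0" using s \<open>t \<noteq> 0\<close> by (auto simp: r_def)
    obtain \<xi> where \<xi>: "w k i \<xi> \<noteq> 0" using w_nonzero[OF k] by (metis blinfun_eqI zero_blinfun.rep_eq)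
    \<comment> \<open>Rotation by the argument of the quotient \<open>t / s\<close> carries
      \<open>s\<close> to \<open>t\<close>.\<close>
    define \<eta> where "\<eta> = ((Arg (t / s)) / w k i \<xi>) *\<^sub>R \<xi>"
    have w\<eta>: "w k i \<eta> = Arg (t / s)" using \<xi> by (simp add: \<eta>_def blinfun.scaleR_right)
    have "norm (t / s) = 1" using s \<open>s \<noteq> 0\<close> \<open>t \<noteq> 0\<close> by (simp add: norm_divide r_def)
    moreover have "t / s \<noteq> 0" using \<open>s \<noteq> 0\<close> \<open>t \<noteq> 0\<close> by simp
    then have "cis (Arg (t / s)) = t / s / of_real (norm (t / s))" unfolding sgn_eq[symmetric] by (rule cis_Arg)
    ultimately have arg: "cis (Arg (t / s)) = t / s" by simp
    have "D k \<eta> (axis i s) = axis i t"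
      using k \<open>s \<noteq> 0\<close> by (auto simp: vec_eq_iff axis_def W_def w\<eta> arg)
    then have "act (ex \<eta>) (c k (axis i s)) = c k (axis i t)"
      using act_c[OF I_less[OF k] axis_in_Dom[OF k, of s i], of \<eta>] s t by (simp add: r_def)
    then show False using notin X(3) \<open>c k (axis i s) \<in> X\<close> by (metis imageI)
  qed
  let ?K = "(\<lambda>s. c k (axis i s)) ` cball 0 r"
  \<comment> \<open>The inside of the circle, and the complement of the closed disc; both are open
    in the whole manifold, and on \<open>X\<close> they are disjoint.\<close>
  let ?E1 = "c k ` (Dom k \<inter> {z. norm (z $ i) < r})" and ?E2 = "topspace T - ?K"
  have "r < 2" using t by (simp add: r_def)
  have "openin T ?E1"
    by (intro openin_c I_less k open_Int open_Dom open_Collect_less continuous_intros) auto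
  moreover have "openin T ?E2"
    using compactin_imp_closedin[OF Hausdorff_T compactin_c_axis[OF k \<open>r < 2\<close>]] by blast
  moreover have "X \<subseteq> ?E1 \<union> ?E2"
  proof
    fix x assume x: "x \<in> X"
    show "x \<in> ?E1 \<union> ?E2"
    proof (cases "x \<in> ?K")
      case True
      then obtain s where s: "x = c k (axis i s)" "norm s \<le> r" by auto
      then have "norm s < r" using circle x by force
      then show ?thesis using s axis_in_Dom[OF k, of s i] \<open>r < 2\<close> by (auto simp: axis_def intro!: image_eqI)
    next
      case False
      then show ?thesis using x X(2) connectedin_subset_topspace by blast
    qed
  qed
  moreover have "?E1 \<inter> ?E2 \<inter> X = {}"
  proof -
    have "x \<in> ?K" if "x \<in> X" and xE: "x \<in> ?E1" for x
    proof -
      obtain z where z: "z \<in> Dom k" "norm (z $ i) < r" "x = c k z" using xE by auto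
      then have "x \<in> Sph k i \<inter> U k" using X(1) \<open>x \<in> X\<close> c_in_U by blast
      then obtain s where s: "norm s < 2" "c k z = c k (axis i s)" using Sph_Int_U[OF k] z by (auto simp: Ax_def)
      then have "z = axis i s"
        by (intro inj_onD[OF inj_on_c[OF I_less[OF k]]]) (auto simp: z axis_in_Dom k)
      then show ?thesis using z by (auto intro!: image_eqI[of _ _ s] simp: axis_def)
    qed
    then show ?thesis by blast
  qed
  moreover have "c k 0 \<in> ?E1" using zero_in_Dom[OF k] \<open>t \<noteq> 0\<close> by (auto simp: r_def)
  moreover have "c (nb k i) 0 \<in> ?E2"
  proof -
    have "?K \<subseteq> U k" using axis_in_Dom[OF k] \<open>r < 2\<close> by (auto intro!: c_in_U)
    moreover have "c (nb k i) 0 \<notin> U k"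
      using c_zero_in_U_iff[OF nb_less[OF k, of i], of k] nb_neq[OF k, of i] by simp
    ultimately have "c (nb k i) 0 \<notin> ?K" by blast
    then show ?thesis using X(2,5) connectedin_subset_topspace by blast
  qed
  ultimately show False using X(2,4,5) unfolding connectedin by blast
qed

text \<open>By \<open>orbit_in_sphere\<close>, the sphere without its fixed points lies on punctured
  axes. It remains connected when the two points are removed, so the wedges confine it to one edge.
  It then contains both fixed points of that edge and, by \<open>full_disc\<close>, the whole
  projective line.\<close>

lemma gkm_sphere_is_Sph:
  assumes "X \<in> gkm_spheres T A act"
  shows "\<exists>k<m. \<exists>i. X = Sph k i"
proof -
  define F where "F = X \<inter> fixed_points T act UNIV"
  from assms have invariant: "\<And>g. act g ` X = X" and card: "card F = 2" and "embedded_sphere T A X"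
    by (auto simp: gkm_spheres_def F_def)
  then obtain f :: "real^3 \<Rightarrow> 'd point" where f: "continuous_map (top_of_set (- {0})) T f" "inj_on f (sphere 0 1)" "X = f ` sphere 0 1"
    by (auto simp: embedded_sphere_def smooth_map_def)
  have fS: "continuous_map (top_of_set (sphere 0 1)) T f"
    using continuous_map_from_subtopology_mono[OF f(1)] by auto
  obtain p1 p2 where F: "F = {p1, p2}" "p1 \<noteq> p2" using card by (auto simp: card_2_iff)
  have p1: "p1 \<in> X \<inter> fixed_points T act UNIV" using F F_def by blast
  obtain a b where ab: "a \<in> sphere 0 1" "b \<in> sphere 0 1" "p1 = f a" "p2 = f b"
  proof -
    have "p1 \<in> f ` sphere 0 1" "p2 \<in> f ` sphere 0 1" using F f(3) F_def by blast+
    then show thesis using that by blast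
  qed
  have conX: "connectedin T X"
    unfolding f(3) by (rule connectedin_continuous_map_image[OF fS]) (auto simp: connectedin_subtopology connected_sphere)
  have XT: "X \<subseteq> topspace T" using conX connectedin_subset_topspace by blast
  have XF: "X - F = f ` (sphere 0 1 - {a, b})"
  proof -
    have "f ` (sphere 0 1 - {a, b}) = f ` sphere 0 1 - f ` {a, b}"
      by (rule inj_on_image_set_diff[OF f(2)]) (use ab in auto)
    then show ?thesis using f(3) F(1) ab(3,4) by simp
  qed
  have conXF: "connectedin T (X - F)"
    unfolding XF by (rule connectedin_continuous_map_image[OF fS])
      (auto simp: connectedin_subtopology intro!: connected_sphere_minus_two ab(1))
  have "infinite (sphere (0 :: real^3) 1)"
  proof
    assume "finite (sphere (0 :: real^3) 1)"
    moreover have "connected (sphere (0 :: real^3) 1)" by (rule connected_sphere) simp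
    ultimately have "sphere (0 :: real^3) 1 = {} \<or> (\<exists>x. sphere (0 :: real^3) 1 = {x})"
      by (simp only: connected_finite_iff_sing)
    then have "a = b" using ab(1,2) by (metis empty_iff singletonD)
    then show False using ab(3,4) F(2) by simp
  qed
  then have "X - F \<noteq> {}" unfolding XF by (metis finite.emptyI finite.insertI finite_Diff2 image_is_empty)
  have main: "X \<subseteq> (\<Union>k<m. U k)"
  proof -
    have "p1 \<in> (\<Union>k<m. U k)" using p1 c_in_U zero_in_Dom by (auto simp: fixed_points_eq)
    then show ?thesis
      using connectedin_clopen_cases[OF conX closedin_main openin_main] p1 by (auto simp: disjnt_iff)
  qed
  have axes: "\<exists>k<m. \<exists>i t. norm t < 2 \<and> t \<noteq> 0 \<and> x = c k (axis i t)" if x: "x \<in> X - F" for x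
  proof -
    obtain k z where k: "k < m" "z \<in> Dom k" "x = c k z" using main x by (auto simp: U_def)
    then obtain i where "z \<in> Ax i" using orbit_in_sphere[OF fS f(2,3) invariant p1] x by blast
    then obtain t where t: "norm t < 2" "z = axis i t" by (auto simp: Ax_def)
    moreover have "t \<noteq> 0"
    proof
      assume "t = 0"
      then have "z = 0" using t by (simp add: vec_eq_iff axis_def)
      then show False using k x by (auto simp: F_def fixed_points_eq)
    qed
    ultimately show ?thesis using k by blast
  qed
  obtain x1 where "x1 \<in> X - F" using \<open>X - F \<noteq> {}\<close> by blast
  then obtain k i t1 where k: "k < m" and t1: "norm t1 < 2" "t1 \<noteq> 0" "x1 = c k (axis i t1)" using axes by blast
  \<comment> \<open>Both orientations of the edge on which \<open>x1\<close> lies, since each point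
    of an annulus has a description from either end.\<close>
  define e where "e = {(k, i), (nb k i, rv k i)}"
  have e_rev': "(nb l j, rv l j) \<in> e" if "(l, j) \<in> e" for l j
    using that k by (auto simp: e_def nb_nb rv_rv)
  have e_rev: "(l, j) \<in> e" if "(nb l j, rv l j) \<in> e" "l < m" for l j
    using e_rev'[OF that(1)] that(2) by (simp add: nb_nb rv_rv)
  let ?Q1 = "\<Union>(l, j)\<in>e. wedge l j" and ?Q2 = "\<Union>(l, j)\<in>({..<m} \<times> UNIV) - e. wedge l j"
  have e_less: "l < m" if "(l, j) \<in> e" for l j using that k nb_less by (auto simp: e_def)
  have in_e: "(l', j') \<in> e \<longleftrightarrow> (l, j) \<in> e"
    if "l < m" "l' < m" "norm t < 2" "t \<noteq> 0" "c l (axis j t) \<in> wedge l' j'" for l j l' j' t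
    using axis_in_wedgeD[OF that] e_rev[OF _ that(1)] e_rev' by auto
  have "openin T ?Q1" "openin T ?Q2" using e_less openin_wedge by (auto intro!: openin_Union)
  moreover have "X - F \<subseteq> ?Q1 \<union> ?Q2"
  proof
    fix x assume "x \<in> X - F"
    then obtain l j t where "l < m" "norm t < 2" "t \<noteq> 0" "x = c l (axis j t)" using axes by blast
    then have "l < m" "x \<in> wedge l j" using axis_in_wedge by auto
    then show "x \<in> ?Q1 \<union> ?Q2" by (cases "(l, j) \<in> e") auto
  qed
  moreover have "?Q1 \<inter> ?Q2 \<inter> (X - F) = {}"
  proof -
    have contra: False if x: "x \<in> X - F" and 1: "(l1, j1) \<in> e" "x \<in> wedge l1 j1" and 2: "(l2, j2) \<notin> e" "l2 < m" "x \<in> wedge l2 j2" for x l1 j1 l2 j2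
    proof -
      obtain l j t where *: "l < m" "norm t < 2" "t \<noteq> 0" "x = c l (axis j t)" using axes[OF x] by blast
      then show False
        using in_e[OF *(1) e_less[OF 1(1)] *(2,3)] in_e[OF *(1) 2(2) *(2,3)] 1 2 by blast
    qed
    show ?thesis
    proof (rule equals0I)
      fix x assume x: "x \<in> ?Q1 \<inter> ?Q2 \<inter> (X - F)"
      from x obtain l1 j1 where "(l1, j1) \<in> e" "x \<in> wedge l1 j1" by blast
      moreover from x obtain l2 j2 where "(l2, j2) \<notin> e" "l2 < m" "x \<in> wedge l2 j2" by blast
      ultimately show False using contra x by blast
    qed
  qed
  moreover have "x1 \<in> ?Q1" using axis_in_wedge[OF k t1(1,2)] t1(3) by (auto simp: e_def)
  ultimately have "?Q2 \<inter> (X - F) = {}" using conXF \<open>x1 \<in> X - F\<close> unfolding connectedin by blast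
  have XF_Sph: "X - F \<subseteq> Sph k i"
  proof
    fix x assume x: "x \<in> X - F"
    then obtain l j t where *: "l < m" "norm t < 2" "t \<noteq> 0" "x = c l (axis j t)" using axes by blast
    then have "x \<in> wedge l j" using axis_in_wedge by simp
    then have "(l, j) \<in> e" using \<open>?Q2 \<inter> (X - F) = {}\<close> x *(1) by blast
    moreover have "x \<in> Sph l j" using * by (auto simp: Sph_def Ax_def)
    ultimately show "x \<in> Sph k i" using Sph_rv[OF k] by (auto simp: e_def)
  qed
  have X_Sph: "X \<subseteq> Sph k i"
  proof (rule ccontr)
    assume "\<not> X \<subseteq> Sph k i"
    \<comment> \<open>Outside the closed set \<open>Sph k i\<close>, \<open>X\<close> consists of
      points of the finite set \<open>F\<close>; that part is open and closed in \<open>X\<close>,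
      so connectedness makes it empty.\<close>
    let ?E1 = "topspace T - (F - Sph k i)" and ?E2 = "topspace T - Sph k i"
    have "closedin T (F - Sph k i)"
      using F XT F_def by (intro closedin_Hausdorff_finite[OF Hausdorff_T]) auto
    then have "openin T ?E1" by blast
    moreover have "openin T ?E2" using closedin_Sph[OF k] by blast
    moreover have "X \<subseteq> ?E1 \<union> ?E2" "?E1 \<inter> ?E2 \<inter> X = {}" "?E1 \<inter> X \<noteq> {}" "?E2 \<inter> X \<noteq> {}"
      using XT XF_Sph \<open>x1 \<in> X - F\<close> \<open>\<not> X \<subseteq> Sph k i\<close> by auto
    ultimately show False using conX unfolding connectedin by blast
  qed
  have "F \<subseteq> {c k 0, c (nb k i) 0}" using Sph_Int_fixed[OF k, of i] X_Sph F_def by blast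
  then have "F = {c k 0, c (nb k i) 0}"
    using card by (intro card_subset_eq) (auto simp: c_nb_zero_neq[OF k])
  then have zeros: "c k 0 \<in> X" "c (nb k i) 0 \<in> X" using F_def by auto
  have "c k ` Ax i \<subseteq> X" using full_disc[OF k X_Sph conX invariant zeros] by (auto simp: Ax_def)
  moreover have "X \<subseteq> Sph (nb k i) (rv k i)" "c (nb (nb k i) (rv k i)) 0 \<in> X"
    using X_Sph zeros(1) by (simp_all add: Sph_rv[OF k] nb_nb[OF k])
  then have "c (nb k i) ` Ax (rv k i) \<subseteq> X"
    using full_disc[OF nb_less[OF k] _ conX invariant zeros(2)] by (auto simp: Ax_def)
  ultimately have "X = Sph k i" using X_Sph by (auto simp: Sph_def)
  then show ?thesis using k by blast
qed

section \<open>The one-skeleton of the model\<close>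

lemma gkm_spheres_eq: "gkm_spheres T A act = {Sph k i | k i. k < m}"
  using gkm_sphere_is_Sph Sph_in_gkm_spheres by blast

lemma skeleton_at_vertex:
  assumes "p \<in> fixed_points T act UNIV" "isotropy_weights ex A act p v"
  shows "{X \<in> gkm_spheres T A act. p \<in> X} = range (\<lambda>i. weight_component ex T act p (v i))"
proof -
  obtain k where k: "k < m" "p = c k 0" using assms(1) by (auto simp: fixed_points_eq)
  have "range (\<lambda>i. weight_component ex T act p (v i)) = weight_component ex T act p ` range v" by (simp only: image_image)
  also have "\<dots> = range (\<lambda>i. weight_component ex T act p (w k i))"
    using range_isotropy_weights[OF k(1)] assms(2) k(2) by (simp add: image_image)
  also have "\<dots> = range (Sph k)" using weight_component_eq[OF k(1)] k(2) by simp
  also have "\<dots> = {X \<in> gkm_spheres T A act. p \<in> X}"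
  proof (intro equalityI subsetI)
    fix X assume "X \<in> {X \<in> gkm_spheres T A act. p \<in> X}"
    then obtain l i where l: "l < m" "X = Sph l i" "c k 0 \<in> Sph l i" using k by (auto simp: gkm_spheres_eq)
    then have "c k 0 \<in> {c l 0, c (nb l i) 0}" using Sph_Int_fixed[OF l(1), of i] k by (auto simp: fixed_points_eq)
    then have "k = l \<or> k = nb l i" using inj_on_c_zero k(1) l(1) nb_less[OF l(1)] by (auto dest: inj_onD)
    then show "X \<in> range (Sph k)" using l Sph_rv[OF l(1), of i] by (metis rangeI)
  qed (use k c_zero_in_Sph in \<open>auto simp: gkm_spheres_eq\<close>)
  finally show ?thesis by simp
qed

text \<open>Each sphere occurs twice, once from either end. Parallel edges stay distinct because the
  axes at a vertex can be told apart in its chart.\<close>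

lemma flags_bij:
  "bij_betw (\<lambda>(k, i). (c k 0, Sph k i)) ({..<m} \<times> UNIV)
     {(p, X). X \<in> gkm_spheres T A act \<and> p \<in> X \<inter> fixed_points T act UNIV}"
  (is "bij_betw ?f ?A ?B")
  unfolding bij_betw_def
proof (intro conjI equalityI subsetI)
  show "inj_on ?f ?A"
    using inj_on_c_zero Sph_inj by (intro inj_onI) (auto dest: inj_onD)
next
  fix q assume "q \<in> ?f ` ?A"
  then show "q \<in> ?B" using c_zero_in_Sph by (auto simp: gkm_spheres_eq fixed_points_eq)
next
  fix q assume "q \<in> ?B"
  then obtain p l i where q: "q = (p, Sph l i)" "l < m" "p \<in> Sph l i \<inter> fixed_points T act UNIV"
    by (auto simp: gkm_spheres_eq)
  then have "p = c l 0 \<or> p = c (nb l i) 0" using Sph_Int_fixed by auto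
  then have "q = ?f (l, i) \<or> q = ?f (nb l i, rv l i)" using q Sph_rv[OF q(2), of i] by auto
  then show "q \<in> ?f ` ?A" using q(2) nb_less[OF q(2)] by blast
qed

end

section \<open>Coordinates on an abstract one-skeleton\<close>

theorem theorem3p1p1:
  fixes ex :: "'a::euclidean_space \<Rightarrow> 'g::{topological_ab_group_add, t2_space}"
    and V :: "'v set" and E :: "'e set"
    and ini ter :: "'e \<Rightarrow> 'v" and bar :: "'e \<Rightarrow> 'e"
    and \<theta> :: "'e \<Rightarrow> 'e \<Rightarrow> 'e"
    and \<alpha> :: "'e \<Rightarrow> ('a \<Rightarrow>\<^sub>L real)"
  assumes "torus ex"
    and "abstract_gkm ex CARD('d::finite) V E ini ter bar \<theta> \<alpha>"
  shows "\<exists>(T :: 'd point topology) (A :: ('d point, complex^'d) charts)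
           (act :: 'g \<Rightarrow> 'd point \<Rightarrow> 'd point).
           complex_manifold T A \<and> gkm_action ex T A act \<and>
           is_gkm_one_skeleton ex T A act V E ini ter bar \<alpha>"
proof -
  interpret torus ex by (rule assms(1))
  interpret abstract_gkm ex "CARD('d)" V E ini ter bar \<theta> \<alpha> by (rule assms(2))
  define m where "m = card V"
  obtain v where v: "bij_betw v {..<m} V"
    using ex_bij_betw_nat_finite[OF finite_V] by (auto simp: m_def atLeast0LessThan)
  define idx where "idx = inv_into {..<m} v"
  have idx: "idx p < m" "v (idx p) = p" if "p \<in> V" for p
    using bij_betw_inv_into_right[OF v that] inv_into_into[of p v "{..<m}"] that v
    by (auto simp: idx_def bij_betw_def)
  have vV: "v k \<in> V" and idx_v: "idx (v k) = k" if "k < m" for k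
    using v that by (auto simp: idx_def bij_betw_def)
  define star where "star p = {e \<in> E. ini e = p}" for p
  \<comment> \<open>A star has as many edges as the type \<open>'d\<close> has elements, so the
    edges at a vertex can serve as the coordinate directions there.\<close>
  have "\<exists>h. bij_betw h (UNIV :: 'd set) (star p)" if "p \<in> V" for p
    using valent[OF that] finite_E by (intro finite_same_card_bij) (auto simp: star_def)
  then obtain en :: "'v \<Rightarrow> 'd \<Rightarrow> 'e" where en: "\<And>p. p \<in> V \<Longrightarrow> bij_betw (en p) UNIV (star p)" by metis
  define ed where "ed k i = en (v k) i" for k i
  define co where "co e = inv (en (ini e)) e" for e
  have ed_co: "ed (idx (ini e)) (co e) = e" if "e \<in> E" for e
    using bij_betw_inv_into_right[OF en[OF ini_in[OF that]], of e] that idx(2)[OF ini_in[OF that]]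
    by (simp add: ed_def co_def star_def)
  have ed: "ed k i \<in> E" "ini (ed k i) = v k" if "k < m" for k i
    using bij_betwE[OF en[OF vV[OF that]]] by (auto simp: ed_def star_def)
  have co_ed: "co (ed k i) = i" if "k < m" for k i
    using bij_betw_inv_into_left[OF en[OF vV[OF that]], of i] ed(2)[OF that, of i] by (simp add: co_def) (simp add: ed_def)
  have E_cases: "\<exists>k<m. \<exists>i. e = ed k i" if "e \<in> E" for e
    using ed_co[OF that] idx(1)[OF ini_in[OF that]] by metis
  have \<theta>_in: "\<theta> e e' \<in> E" "ini (\<theta> e e') = ter e" if "e \<in> E" "e' \<in> E" "ini e' = ini e" for e e'
    using bij_betwE[OF connection_bij[OF that(1)]] that by auto
  define nb where "nb k i = idx (ter (ed k i))" for k i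
  define rv where "rv k i = co (bar (ed k i))" for k i
  define \<sigma> where "\<sigma> k i j = co (\<theta> (ed k i) (ed k j))" for k i j
  define w where "w k i = \<alpha> (ed k i)" for k i
  have "\<forall>k i j. \<exists>z::int. k < m \<longrightarrow> \<alpha> (\<theta> (ed k i) (ed k j)) = \<alpha> (ed k j) + of_int z *\<^sub>R \<alpha> (ed k i)"
    using axial_connection ed by metis
  then obtain cc :: "nat \<Rightarrow> 'd \<Rightarrow> 'd \<Rightarrow> int" where
    cc: "\<And>k i j. k < m \<Longrightarrow> \<alpha> (\<theta> (ed k i) (ed k j)) = \<alpha> (ed k j) + of_int (cc k i j) *\<^sub>R \<alpha> (ed k i)" by metis
  obtain \<mu> :: "nat \<Rightarrow> ('a \<Rightarrow>\<^sub>L real)" and N where \<mu>: "\<And>k. k < N \<Longrightarrow> \<mu> k \<in> weight_lattice ex \<and> \<mu> k \<noteq> 0"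
    "\<And>\<xi>. (\<And>k. k < N \<Longrightarrow> cis (\<mu> k \<xi>) = 1) \<Longrightarrow> ex \<xi> = 0"
    using separating_weights by metis
  have nb_m: "nb k i < m" and v_nb: "v (nb k i) = ter (ed k i)" if "k < m" for k i
    using idx[OF ter_in[OF ed(1)[OF that]]] by (auto simp: nb_def)
  have ed_rv: "ed (nb k i) (rv k i) = bar (ed k i)" if "k < m" for k i
    using ed_co[OF bar_in[OF ed(1)[OF that]]] ini_bar[OF ed(1)[OF that]] by (simp add: nb_def rv_def)
  have ed_\<sigma>: "ed (nb k i) (\<sigma> k i j) = \<theta> (ed k i) (ed k j)" if "k < m" for k i j
    using ed_co[OF \<theta>_in(1)] \<theta>_in(2) ed[OF that] by (simp add: nb_def \<sigma>_def)
  interpret M: gkm_model ex m N w nb rv \<sigma> cc \<mu>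
  proof
    fix k i j assume k: "k < m"
    note e = ed(1)[OF k]
    show "nb k i < m" by (rule nb_m[OF k])
    show nb_nb: "nb (nb k i) (rv k i) = k"
      using ed(2)[OF k] idx_v[OF k] by (simp add: nb_def[of "nb k i"] ed_rv[OF k] ter_bar e)
    show rv_rv: "rv (nb k i) (rv k i) = i"
      by (simp add: rv_def[of "nb k i"] ed_rv[OF k] bar_bar e co_ed[OF k])
    show "\<sigma> (nb k i) (rv k i) (\<sigma> k i j) = j"
      using ed[OF k] by (simp add: \<sigma>_def[of "nb k i"] ed_rv[OF k] ed_\<sigma>[OF k] connection_bar co_ed[OF k])
    show "w k i \<in> weight_lattice ex" using axial_weight e by (simp add: w_def)
    show "w (nb k i) (rv k i) = - w k i" by (simp add: w_def ed_rv[OF k] axial_bar e)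
    show "w (nb k i) (\<sigma> k i j) = w k j + of_int (cc k i j) *\<^sub>R w k i"
      by (simp add: w_def ed_\<sigma>[OF k] cc[OF k])
    show "pairwise_independent UNIV (w k)"
      unfolding pairwise_independent_def
    proof (intro ballI)
      fix a b :: 'd
      have "inj_on \<alpha> {ed k a, ed k b}" "independent (\<alpha> ` {ed k a, ed k b})"
        using axial_independent[OF vV[OF k]] ed[OF k] by (auto simp: pairwise_independent_def)
      moreover have "inj (ed k)" using en[OF vV[OF k]] by (simp add: ed_def[abs_def] bij_betw_def)
      ultimately show "inj_on (w k) {a, b} \<and> independent (w k ` {a, b})"
        by (auto simp: w_def inj_on_def)
    qed
  qed (use \<mu> in auto)
  define F where "F p = M.c (idx p) 0" for p
  define S where "S e = M.Sph (idx (ini e)) (co e)" for e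
  have F_ini: "F (ini (ed k i)) = M.c k 0" and S_ed: "S (ed k i) = M.Sph k i"
    and F_ter: "F (ter (ed k i)) = M.c (nb k i) 0" if "k < m" for k i
    using that by (simp_all add: F_def S_def ed idx_v co_ed nb_def)
  have "bij_betw F V (fixed_points M.T M.act UNIV)"
  proof -
    have "bij_betw ((\<lambda>k. M.c k 0) \<circ> idx) V (fixed_points M.T M.act UNIV)"
      by (rule bij_betw_trans[OF _ inj_on_imp_bij_betw[OF M.inj_on_c_zero, folded M.fixed_points_eq]])
        (simp add: idx_def bij_betw_inv_into v)
    then show ?thesis by (simp add: F_def[abs_def] o_def)
  qed
  moreover have "bij_betw (\<lambda>e. (F (ini e), S e)) E
      {(p, X). X \<in> gkm_spheres M.T M.A M.act \<and> p \<in> X \<inter> fixed_points M.T M.act UNIV}"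
  proof -
    have "bij_betw (\<lambda>e. (idx (ini e), co e)) E ({..<m} \<times> UNIV)"
      by (rule bij_betw_byWitness[where f' = "\<lambda>(k, i). ed k i"])
        (use ed_co ed co_ed idx_v idx(1)[OF ini_in] in auto)
    from bij_betw_trans[OF this M.flags_bij] show ?thesis
      by (simp add: o_def F_def S_def)
  qed
  moreover have "S (bar e) = S e \<and> S e \<inter> fixed_points M.T M.act UNIV = {F (ini e), F (ter e)} \<and>
      tangent_weight ex M.A M.act (S e) (F (ini e)) (\<alpha> e)" if e: "e \<in> E" for e
  proof -
    obtain k i where k: "k < m" "e = ed k i" using E_cases[OF e] by blast
    have "S (bar e) = M.Sph (nb k i) (rv k i)" using S_ed[OF nb_m[OF k(1)]] ed_rv[OF k(1)] k(2) by metis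
    then show ?thesis
      using k M.Sph_rv[OF k(1)] M.Sph_Int_fixed[OF k(1)] M.tangent_weight_Sph[OF k(1), of i]
      by (simp add: S_ed F_ini F_ter w_def)
  qed
  ultimately have "is_gkm_one_skeleton ex M.T M.A M.act V E ini ter bar \<alpha>"
    unfolding is_gkm_one_skeleton_def using M.skeleton_at_vertex by blast
  then show ?thesis using M.complex_manifold M.gkm_action by blast
qed

end
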